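(* Let $\mu_0=N(m_0,C_0)$ be a Gaussian measure on $\mathcal H$ with mean $m_0\in\mathcal H$ and (strictly positive, trace-class) covariance operator $C_0$, and let $\mu$ be given by $\frac{d\mu}{d\mu_0}(x)=\frac1{Z_\mu}\exp(-\Phi(x))$. Let $\mathcal G\subseteq\mathcal{HS}(\mathcal H^1,\mathcal H^{-1})$ be a Hilbert space of linear operators, let $\delta>0$, and let $\mathcal A=\{N_{P,0}(m,\Gamma): m\in\mathcal H,\ \Gamma\in\mathcal G\}$. Suppose that $\mathcal G$ consists of symmetric operators on $\mathcal H$ and embeds compactly into the space of bounded linear operators from $\mathcal H^{1-\kappa}$ to $\mathcal H^{-(1-\kappa)}$ for some $0<\kappa<1$. Then, provided that $D_{\rm KL}(\mu_0\|\mu)<\infty$, there exists a minimiser $\nu_\star=N_{P,0}(m_\star,\Gamma_\star)$ for the problem of minimising $$D_{\rm KL}(\nu\|\mu)+\delta\|\Gamma\|_{\mathcal G}^2\qquad\text{over } \nu=N_{P,0}(m,\Gamma)\in\mathcal A .$$ Furthermore, along any minimising sequence $N_{P,0}(m_n,\Gamma_n)$ for this problem there is a subsequence $N_{P,0}(m_{n'},\Gamma_{n'})$ along which $\Gamma_{n'}\to\Gamma_\star$ strongly in $\mathcal G$ and $N_{P,0}(m_{n'},\Gamma_{n'})\to N_{P,0}(m_\star,\Gamma_\star)$ with respect to the total variation distance.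
   Context: $\mathcal H$ is a separable Hilbert space with its Borel $\sigma$-algebra; $N(m,C)$ denotes the Gaussian measure with mean $m$ and covariance operator $C$. $X\subseteq\mathcal H$ is a separable Banach space continuously embedded in $\mathcal H$, Borel measurable as a subset of $\mathcal H$, with $\mu_0(X)=1$; $\Phi:X\to\mathbb R$ is continuous in the topology of $X$, $\exp(-\Phi)$ is $\mu_0$-integrable, $Z_\mu=\int\exp(-\Phi)\,d\mu_0$. $D_{\rm KL}(\nu\|\mu)=\int \log\big(\frac{d\nu}{d\mu}\big)\,d\nu$ if $\nu\ll\mu$ and $+\infty$ otherwise. The total variation distance is $\frac12\int|\frac{d\nu}{d\lambda}-\frac{d\mu}{d\lambda}|\,d\lambda$ for any probability measure $\lambda$ dominating $\nu$ and $\mu$. For $s>0$, $\mathcal H^s$ is the domain of $C_0^{-s/2}$ with scalar product $\langle\cdot,C_0^{-s}\cdot\rangle$ (i.e. $\langle C_0^{-s/2}\cdot,C_0^{-s/2}\cdot\rangle$), and $\mathcal H^{-s}$ is its dual (via the pairing extending the scalar product of $\mathcal H$). $\mathcal{HS}(\mathcal H^1,\mathcal H^{-1})$ is the space of Hilbert–Schmidt operators $\mathcal H^1\to\mathcal H^{-1}$, with norm $\|C_0^{1/2}\Gamma C_0^{1/2}\|_{\mathcal{HS}(\mathcal H)}$, where $\mathcal{HS}(\mathcal H)$ denotes the Hilbert–Schmidt operators on $\mathcal H$. For symmetric $\Gamma\in\mathcal{HS}(\mathcal H^1,\mathcal H^{-1})$ (i.e. $\langle u,\Gamma v\rangle=\langle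 v,\Gamma u\rangle$ for $u,v\in\mathcal H^1$), the quadratic form $Q_\Gamma(u,v)=\langle C_0^{-1/2}u,C_0^{-1/2}v\rangle+\langle u,\Gamma v\rangle$ on $\mathcal H^1$ is closed and bounded below, and $C_0^{-1}+\Gamma$ denotes the associated self-adjoint operator. $N_{P,0}(m,\Gamma)$ is the Gaussian measure with mean $m$ and covariance operator $(C_0^{-1}+\Gamma)^{-1}$ if $C_0^{-1}+\Gamma$ is strictly positive; otherwise, by convention, $N_{P,0}(m,\Gamma)=\delta_0$. A minimising sequence is a sequence, with $m_n\in\mathcal H$ and $\Gamma_n\in\mathcal G$, along which $D_{\rm KL}(N_{P,0}(m_n,\Gamma_n)\|\mu)+\delta\|\Gamma_n\|_{\mathcal G}^2$ converges to the infimum of $D_{\rm KL}(\nu\|\mu)+\delta\|\Gamma\|_{\mathcal G}^2$ over $\nu=N_{P,0}(m,\Gamma)\in\mathcal A$. *)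

theory Defs
  imports "HOL-Probability.Probability"
begin

section \<open>Operators on a Hilbert space\<close>

definition self_adjoint :: "('h::real_inner \<Rightarrow>\<^sub>L 'h) \<Rightarrow> bool" where
  "self_adjoint T \<longleftrightarrow> (\<forall>x y. T x \<bullet> y = x \<bullet> T y)"

definition strictly_positive :: "('h::real_inner \<Rightarrow>\<^sub>L 'h) \<Rightarrow> bool" where
  "strictly_positive T \<longleftrightarrow> (\<forall>x. x \<noteq> 0 \<longrightarrow> 0 < x \<bullet> T x)"

definition orthonormal_basis :: "'h::real_inner set \<Rightarrow> bool" where
  "orthonormal_basis E \<longleftrightarrow>
     pairwise orthogonal E \<and> (\<forall>e\<in>E. norm e = 1) \<and> closure (span E) = UNIV"

text \<open>The trace-class condition in the form valid for nonnegative operators, where no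
  absolute value is needed; the sum does not depend on the basis.\<close>

definition trace_class_nonneg :: "('h::real_inner \<Rightarrow>\<^sub>L 'h) \<Rightarrow> bool" where
  "trace_class_nonneg T \<longleftrightarrow>
     (\<forall>E. orthonormal_basis E \<longrightarrow> (\<lambda>e. e \<bullet> T e) summable_on E)"

definition covariance_operator :: "('h::real_inner \<Rightarrow>\<^sub>L 'h) \<Rightarrow> bool" where
  "covariance_operator C \<longleftrightarrow> self_adjoint C \<and> strictly_positive C \<and> trace_class_nonneg C"

definition hilbert_schmidt :: "('h::real_inner \<Rightarrow> 'h) \<Rightarrow> bool" where
  "hilbert_schmidt T \<longleftrightarrow> bounded_linear T \<and>
     (\<forall>E. orthonormal_basis E \<longrightarrow> (\<lambda>e. (norm (T e))\<^sup>2) summable_on E)"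

text \<open>The power \<open>C\<^sup>r\<close>, \<open>r \<ge> 0\<close>, of a covariance operator. By the spectral theorem the
  eigenvectors of \<open>C\<close> span a dense subspace, so the action on eigenvectors determines it.\<close>

definition op_powr :: "('h::real_inner \<Rightarrow>\<^sub>L 'h) \<Rightarrow> real \<Rightarrow> ('h \<Rightarrow>\<^sub>L 'h)" where
  "op_powr C r = (THE T :: 'h \<Rightarrow>\<^sub>L 'h. \<forall>l v. C v = l *\<^sub>R v \<longrightarrow> T v = (l powr r) *\<^sub>R v)"

text \<open>The unbounded operator \<open>C\<^sup>-\<^sup>r\<close>, meaningful on the range of the injective operator \<open>C\<^sup>r\<close>.\<close>

definition op_neg_powr :: "('h::real_inner \<Rightarrow>\<^sub>L 'h) \<Rightarrow> real \<Rightarrow> 'h \<Rightarrow> 'h" where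
  "op_neg_powr C r = inv (blinfun_apply (op_powr C r))"


section \<open>The scale of spaces generated by a covariance operator\<close>

definition Hs :: "('h::real_inner \<Rightarrow>\<^sub>L 'h) \<Rightarrow> real \<Rightarrow> 'h set" where
  "Hs C s = range (blinfun_apply (op_powr C (s / 2)))"

definition Hs_inner :: "('h::real_inner \<Rightarrow>\<^sub>L 'h) \<Rightarrow> real \<Rightarrow> 'h \<Rightarrow> 'h \<Rightarrow> real" where
  "Hs_inner C s u v = op_neg_powr C (s / 2) u \<bullet> op_neg_powr C (s / 2) v"

definition Hs_norm :: "('h::real_inner \<Rightarrow>\<^sub>L 'h) \<Rightarrow> real \<Rightarrow> 'h \<Rightarrow> real" where
  "Hs_norm C s u = sqrt (Hs_inner C s u u)"

text \<open>An element of \<open>H\<^sup>-\<^sup>s\<close> is a bounded linear functional on \<open>H\<^sup>s\<close>, represented by a function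
  on the whole type of which only the values on \<open>Hs C s\<close> matter. The vector \<open>h\<close> is
  identified with the functional \<open>\<lambda>u. u \<bullet> h\<close>.\<close>

definition Hs_dual :: "('h::real_inner \<Rightarrow>\<^sub>L 'h) \<Rightarrow> real \<Rightarrow> ('h \<Rightarrow> real) set" where
  "Hs_dual C s = {f.
     (\<forall>u\<in>Hs C s. \<forall>v\<in>Hs C s. f (u + v) = f u + f v) \<and>
     (\<forall>a. \<forall>u\<in>Hs C s. f (a *\<^sub>R u) = a * f u) \<and>
     (\<exists>K. \<forall>u\<in>Hs C s. \<bar>f u\<bar> \<le> K * Hs_norm C s u)}"

definition Hs_dual_norm :: "('h::real_inner \<Rightarrow>\<^sub>L 'h) \<Rightarrow> real \<Rightarrow> ('h \<Rightarrow> real) \<Rightarrow> real" where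
  "Hs_dual_norm C s f = (SUP u\<in>{u \<in> Hs C s. Hs_norm C s u \<le> 1}. \<bar>f u\<bar>)"

text \<open>Operators \<open>\<Gamma>\<close> from \<open>H\<^sup>s\<close> to \<open>H\<^sup>-\<^sup>s\<close> are curried: \<open>\<Gamma> v u\<close> is the pairing of
  \<open>u\<close> with \<open>\<Gamma> v\<close>, written \<open>\<langle>u, \<Gamma>v\<rangle>\<close> in the mathematical notation.\<close>

definition bounded_ops ::
    "('h::real_inner \<Rightarrow>\<^sub>L 'h) \<Rightarrow> real \<Rightarrow> ('h \<Rightarrow> 'h \<Rightarrow> real) set" where
  "bounded_ops C s = {\<Gamma>.
     (\<forall>v\<in>Hs C s. \<Gamma> v \<in> Hs_dual C s) \<and>
     (\<forall>v\<in>Hs C s. \<forall>w\<in>Hs C s. \<forall>u\<in>Hs C s. \<Gamma> (v + w) u = \<Gamma> v u + \<Gamma> w u) \<and>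
     (\<forall>a. \<forall>v\<in>Hs C s. \<forall>u\<in>Hs C s. \<Gamma> (a *\<^sub>R v) u = a * \<Gamma> v u) \<and>
     (\<exists>K. \<forall>v\<in>Hs C s. Hs_dual_norm C s (\<Gamma> v) \<le> K * Hs_norm C s v)}"

definition bounded_ops_norm ::
    "('h::real_inner \<Rightarrow>\<^sub>L 'h) \<Rightarrow> real \<Rightarrow> ('h \<Rightarrow> 'h \<Rightarrow> real) \<Rightarrow> real" where
  "bounded_ops_norm C s \<Gamma> =
     (SUP v\<in>{v \<in> Hs C s. Hs_norm C s v \<le> 1}. Hs_dual_norm C s (\<Gamma> v))"

text \<open>The operator \<open>C\<^sup>1\<^sup>/\<^sup>2 \<Gamma> C\<^sup>1\<^sup>/\<^sup>2\<close> on \<open>H\<close>; the outer factor is the extension of \<open>C\<^sup>1\<^sup>/\<^sup>2\<close> to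
  \<open>H\<^sup>-\<^sup>1\<close>, which sends \<open>f\<close> to the vector representing \<open>\<lambda>z. f (C\<^sup>1\<^sup>/\<^sup>2 z)\<close>.\<close>

definition half_conj :: "('h::real_inner \<Rightarrow>\<^sub>L 'h) \<Rightarrow> ('h \<Rightarrow> 'h \<Rightarrow> real) \<Rightarrow> 'h \<Rightarrow> 'h" where
  "half_conj C \<Gamma> x =
     (THE y. \<forall>z. z \<bullet> y = \<Gamma> (op_powr C (1 / 2) x) (op_powr C (1 / 2) z))"

definition HS_ops :: "('h::real_inner \<Rightarrow>\<^sub>L 'h) \<Rightarrow> ('h \<Rightarrow> 'h \<Rightarrow> real) set" where
  "HS_ops C = {\<Gamma> \<in> bounded_ops C 1. hilbert_schmidt (half_conj C \<Gamma>)}"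

definition symmetric_op :: "('h::real_inner \<Rightarrow>\<^sub>L 'h) \<Rightarrow> ('h \<Rightarrow> 'h \<Rightarrow> real) \<Rightarrow> bool" where
  "symmetric_op C \<Gamma> \<longleftrightarrow> (\<forall>u\<in>Hs C 1. \<forall>v\<in>Hs C 1. \<Gamma> v u = \<Gamma> u v)"

text \<open>A Hilbert space of operators contained in \<open>HS(H\<^sup>1, H\<^sup>-\<^sup>1)\<close>, carrying its own scalar
  product: an abstract Hilbert space \<open>'g\<close> with an injective linear map into
  \<open>HS(H\<^sup>1, H\<^sup>-\<^sup>1)\<close>. Equality of operators is equality of all their values on \<open>H\<^sup>1\<close>.\<close>

definition operator_space ::
    "('h::real_inner \<Rightarrow>\<^sub>L 'h) \<Rightarrow> ('g::real_inner \<Rightarrow> 'h \<Rightarrow> 'h \<Rightarrow> real) \<Rightarrow> bool" where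
  "operator_space C \<iota> \<longleftrightarrow>
     (\<forall>g. \<iota> g \<in> HS_ops C) \<and>
     (\<forall>g g'. \<forall>u\<in>Hs C 1. \<forall>v\<in>Hs C 1. \<iota> (g + g') v u = \<iota> g v u + \<iota> g' v u) \<and>
     (\<forall>a g. \<forall>u\<in>Hs C 1. \<forall>v\<in>Hs C 1. \<iota> (a *\<^sub>R g) v u = a * \<iota> g v u) \<and>
     (\<forall>g g'. (\<forall>u\<in>Hs C 1. \<forall>v\<in>Hs C 1. \<iota> g v u = \<iota> g' v u) \<longrightarrow> g = g')"

text \<open>Compact embedding into the bounded operators from \<open>H\<^sup>s\<close> to \<open>H\<^sup>-\<^sup>s\<close>, used for \<open>s < 1\<close>:
  every operator of the space extends from \<open>H\<^sup>1\<close> to a bounded operator on \<open>H\<^sup>s\<close> (uniquely,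
  as \<open>H\<^sup>1\<close> is dense in \<open>H\<^sup>s\<close>), and bounded sequences have subsequences converging in
  operator norm.\<close>

definition compactly_embedded ::
    "('h::real_inner \<Rightarrow>\<^sub>L 'h) \<Rightarrow> real \<Rightarrow> ('g::real_inner \<Rightarrow> 'h \<Rightarrow> 'h \<Rightarrow> real) \<Rightarrow> bool" where
  "compactly_embedded C s \<iota> \<longleftrightarrow>
     (\<exists>J. (\<forall>g. J g \<in> bounded_ops C s \<and> (\<forall>u\<in>Hs C 1. \<forall>v\<in>Hs C 1. J g v u = \<iota> g v u)) \<and>
          (\<forall>g :: nat \<Rightarrow> 'g. bounded (range g) \<longrightarrow>
             (\<exists>r L. strict_mono r \<and> L \<in> bounded_ops C s \<and>
                (\<lambda>n. bounded_ops_norm C s (\<lambda>v u. J (g (r n)) v u - L v u)) \<longlonglongrightarrow> 0)))"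


section \<open>The operator \<open>C\<^sup>-\<^sup>1 + \<Gamma>\<close>\<close>

definition quad_form ::
    "('h::real_inner \<Rightarrow>\<^sub>L 'h) \<Rightarrow> ('h \<Rightarrow> 'h \<Rightarrow> real) \<Rightarrow> 'h \<Rightarrow> 'h \<Rightarrow> real" where
  "quad_form C \<Gamma> u v = op_neg_powr C (1 / 2) u \<bullet> op_neg_powr C (1 / 2) v + \<Gamma> v u"

text \<open>Graph of the self-adjoint operator associated with the form \<open>quad_form C \<Gamma>\<close> with
  form domain \<open>Hs C 1\<close>.\<close>

definition precision_op ::
    "('h::real_inner \<Rightarrow>\<^sub>L 'h) \<Rightarrow> ('h \<Rightarrow> 'h \<Rightarrow> real) \<Rightarrow> ('h \<times> 'h) set" where
  "precision_op C \<Gamma> = {(u, w). u \<in> Hs C 1 \<and> (\<forall>v\<in>Hs C 1. quad_form C \<Gamma> u v = w \<bullet> v)}"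

definition graph_strictly_positive :: "('h::real_inner \<times> 'h) set \<Rightarrow> bool" where
  "graph_strictly_positive A \<longleftrightarrow> (\<forall>(u, w)\<in>A. u \<noteq> 0 \<longrightarrow> 0 < u \<bullet> w)"

definition graph_inverse :: "('h::real_inner \<times> 'h) set \<Rightarrow> ('h \<Rightarrow>\<^sub>L 'h)" where
  "graph_inverse A = (THE K. \<forall>x. (blinfun_apply K x, x) \<in> A)"


section \<open>Gaussian measures\<close>

text \<open>One-dimensional marginals are Gaussian, with Dirac measures as degenerate case.\<close>

definition gaussian_measure :: "'h::{real_inner, second_countable_topology} measure \<Rightarrow> bool" where
  "gaussian_measure \<nu> \<longleftrightarrow> prob_space \<nu> \<and> sets \<nu> = sets borel \<and>
     (\<forall>h. \<exists>a \<sigma>. 0 \<le> \<sigma> \<and> distr \<nu> borel (\<lambda>x. x \<bullet> h) =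
        (if \<sigma> = 0 then return borel a else density lborel (\<lambda>t. ennreal (normal_density a \<sigma> t))))"

definition has_mean :: "'h::real_inner measure \<Rightarrow> 'h \<Rightarrow> bool" where
  "has_mean \<nu> m \<longleftrightarrow> (\<forall>h. has_bochner_integral \<nu> (\<lambda>x. x \<bullet> h) (m \<bullet> h))"

definition has_covariance :: "'h::real_inner measure \<Rightarrow> 'h \<Rightarrow> ('h \<Rightarrow>\<^sub>L 'h) \<Rightarrow> bool" where
  "has_covariance \<nu> m C \<longleftrightarrow>
     (\<forall>h k. has_bochner_integral \<nu> (\<lambda>x. ((x - m) \<bullet> h) * ((x - m) \<bullet> k)) (h \<bullet> C k))"

definition is_gaussian ::
    "'h::{real_inner, second_countable_topology} measure \<Rightarrow> 'h \<Rightarrow> ('h \<Rightarrow>\<^sub>L 'h) \<Rightarrow> bool" where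
  "is_gaussian \<nu> m C \<longleftrightarrow> gaussian_measure \<nu> \<and> has_mean \<nu> m \<and> has_covariance \<nu> m C"

definition gaussian ::
    "'h::{real_inner, second_countable_topology} \<Rightarrow> ('h \<Rightarrow>\<^sub>L 'h) \<Rightarrow> 'h measure" where
  "gaussian m C = (THE \<nu>. is_gaussian \<nu> m C)"

text \<open>The measure \<open>N\<^sub>P\<^sub>,\<^sub>0(m, \<Gamma>)\<close> relative to the reference covariance \<open>C\<close>.\<close>

definition gaussian_P0 ::
    "('h::{real_inner, second_countable_topology} \<Rightarrow>\<^sub>L 'h) \<Rightarrow> 'h \<Rightarrow> ('h \<Rightarrow> 'h \<Rightarrow> real) \<Rightarrow> 'h measure"
  where
  "gaussian_P0 C m \<Gamma> =
     (if graph_strictly_positive (precision_op C \<Gamma>)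
      then gaussian m (graph_inverse (precision_op C \<Gamma>))
      else return borel 0)"


section \<open>Target measure, Kullback-Leibler divergence, total variation\<close>

text \<open>The space \<open>X\<close> is a type \<open>'x\<close> with its embedding \<open>j\<close>. The function \<open>exp(-\<Phi>)\<close> on \<open>X\<close>
  is extended by \<open>0\<close> outside the range of \<open>j\<close>, a null set for the reference measure.\<close>

definition exp_weight :: "('x \<Rightarrow> 'h) \<Rightarrow> ('x \<Rightarrow> real) \<Rightarrow> 'h \<Rightarrow> real" where
  "exp_weight j \<Phi> y = (if y \<in> range j then exp (- \<Phi> (inv j y)) else 0)"

definition partition_const :: "'h measure \<Rightarrow> ('x \<Rightarrow> 'h) \<Rightarrow> ('x \<Rightarrow> real) \<Rightarrow> real" where
  "partition_const \<mu>0 j \<Phi> = (\<integral>y. exp_weight j \<Phi> y \<partial>\<mu>0)"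

definition target_measure :: "'h measure \<Rightarrow> ('x \<Rightarrow> 'h) \<Rightarrow> ('x \<Rightarrow> real) \<Rightarrow> 'h measure" where
  "target_measure \<mu>0 j \<Phi> =
     density \<mu>0 (\<lambda>y. ennreal (exp_weight j \<Phi> y / partition_const \<mu>0 j \<Phi>))"

text \<open>The divergence of \<open>\<nu>\<close> from \<open>\<mu>\<close> with values in \<open>[0, \<infinity>]\<close>. For \<open>\<nu> \<lless> \<mu>\<close> the negative part of
  the log-density is always \<open>\<nu>\<close>-integrable, so if the log-density is not integrable, its
  integral is \<open>\<infinity>\<close> (whereas the real-valued library constant then returns \<open>0\<close>).\<close>

definition kl_div :: "'a measure \<Rightarrow> 'a measure \<Rightarrow> ereal" where
  "kl_div \<nu> \<mu> =
     (if absolutely_continuous \<mu> \<nu> \<and> integrable \<nu> (entropy_density (exp 1) \<mu> \<nu>)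
      then ereal (KL_divergence (exp 1) \<mu> \<nu>) else \<infinity>)"

text \<open>The value does not depend on the choice of the dominating probability measure.\<close>

definition tv_dist :: "'a measure \<Rightarrow> 'a measure \<Rightarrow> real" where
  "tv_dist \<nu> \<mu> =
     (let l = (SOME l. prob_space l \<and> sets l = sets \<nu> \<and>
                       absolutely_continuous l \<nu> \<and> absolutely_continuous l \<mu>)
      in (1 / 2) * (\<integral>x. \<bar>enn2real (RN_deriv l \<nu> x) - enn2real (RN_deriv l \<mu> x)\<bar> \<partial>l))"


section \<open>The minimisation problem\<close>

definition objective ::
    "('h::{real_inner, second_countable_topology} \<Rightarrow>\<^sub>L 'h) \<Rightarrow> ('g::real_normed_vector \<Rightarrow> 'h \<Rightarrow> 'h \<Rightarrow> real)
      \<Rightarrow> 'h measure \<Rightarrow> real \<Rightarrow> 'h \<Rightarrow> 'g \<Rightarrow> ereal" where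
  "objective C \<iota> \<mu> \<delta> m g = kl_div (gaussian_P0 C m (\<iota> g)) \<mu> + ereal (\<delta> * (norm g)\<^sup>2)"

definition is_minimiser :: "('h \<Rightarrow> 'g \<Rightarrow> ereal) \<Rightarrow> 'h \<Rightarrow> 'g \<Rightarrow> bool" where
  "is_minimiser F m g \<longleftrightarrow> (\<forall>m' g'. F m g \<le> F m' g')"

definition minimising_sequence ::
    "('h \<Rightarrow> 'g \<Rightarrow> ereal) \<Rightarrow> (nat \<Rightarrow> 'h) \<Rightarrow> (nat \<Rightarrow> 'g) \<Rightarrow> bool" where
  "minimising_sequence F m g \<longleftrightarrow> (\<lambda>n. F (m n) (g n)) \<longlonglongrightarrow> (INF (m', g')\<in>UNIV. F m' g')"

end

theory Submission
  imports Defs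
begin

text \<open>
  Write \<open>S = C\<^sup>1\<^sup>/\<^sup>2 \<Gamma> C\<^sup>1\<^sup>/\<^sup>2\<close>. Then \<open>N\<^sub>P\<^sub>,\<^sub>0(m, \<Gamma>)\<close> has covariance \<open>C\<^sup>1\<^sup>/\<^sup>2 (1 + S)\<^sup>-\<^sup>1 C\<^sup>1\<^sup>/\<^sup>2\<close>, and if its divergence
  from \<open>\<mu>\<close> is finite, it has a density \<open>f\<close> with respect to \<open>\<mu>\<close>. The functional
  \<open>(f, g) \<mapsto> \<integral> f ln f d\<mu> + \<delta> \<parallel>g\<parallel>\<^sup>2\<close> is uniformly midpoint convex with respect to the norm of
  \<open>L\<^sup>1(\<mu>) \<times> G\<close>, so almost minimal elements of the convex hulls of the tails of a minimising sequence
  \<open>(f\<^sub>n, \<Gamma>\<^sub>n)\<close> converge in norm, say to \<open>(f, \<Gamma>)\<close>, and the value at \<open>(f, \<Gamma>)\<close> is at most the infimum.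

  The bound on the divergence makes the Gaussian measures tight, hence bounds their means and
  covariances; along a subsequence the means converge weakly, and \<open>S\<^sub>n \<rightarrow> S\<close> in operator norm by the
  compact embedding. Bounded covariances prevent \<open>1 + S\<close> from having a kernel, so the characteristic
  functions of the Gaussian measures converge to that of \<open>N\<^sub>P\<^sub>,\<^sub>0(m, \<Gamma>)\<close>. They also converge to that of
  \<open>f \<mu>\<close>, since passing to convex combinations of tails does not change the limit. Thus \<open>f\<close> is the
  density of \<open>N\<^sub>P\<^sub>,\<^sub>0(m, \<Gamma>)\<close>, this measure is a minimiser, and convexity forces the sequence itself to
  converge in \<open>L\<^sup>1(\<mu>) \<times> G\<close>.
\<close>

section \<open>Orthonormal systems in Hilbert spaces\<close>

text \<open>The obstacle is that the admissible measures do not form a convex set: a mixture of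
  Gaussian measures is in general not Gaussian, so convexity of the divergence cannot be exploited
  inside the class. The argument leaves the class and returns to it. Outside, only quantities that
  are affine in the pair of density and operator are followed, namely values of characteristic
  functions and pairings \<open>\<iota> g v u\<close>; this is why their limits can be compared
  although the convex combinations are no longer admissible. The quantitative convexity is a
  midpoint form of Pinsker's inequality with gap one eighth of the squared L1 distance; the squared
  norm contributes its gap by the parallelogram law. Uniform convexity takes the place of weak
  compactness in L1 and gives strong limits at once. Strict positivity of 1 + S might be lost in the
  limit. With K the covariance, Cauchy-Schwarz for the form of 1 + S reads \<open>(half u \<bullet>
  x)\<^sup>2 \<le> (u \<bullet> K u) * (x \<bullet> (x + S x))\<close>, so a degenerating direction
  x would force some variance to blow up.\<close>

text \<open>Zero vectors are allowed, so that bases of finite-dimensional spaces can be indexed by all natural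
  numbers, too.\<close>

definition orthosys :: "(nat \<Rightarrow> 'h::real_inner) \<Rightarrow> bool" where
  "orthosys e \<longleftrightarrow> (\<forall>i j. i \<noteq> j \<longrightarrow> e i \<bullet> e j = 0) \<and> (\<forall>i. e i \<bullet> e i = 0 \<or> e i \<bullet> e i = 1)"

text \<open>Totality is expressed by a trivial orthogonal complement, the form that a maximality
  argument produces and that makes vectors comparable coordinate by coordinate; convergence of
  expansions is derived from it in \<open>onb_sums\<close>.\<close>

definition onb :: "(nat \<Rightarrow> 'h::real_inner) \<Rightarrow> bool" where
  "onb e \<longleftrightarrow> orthosys e \<and> (\<forall>x. (\<forall>i. x \<bullet> e i = 0) \<longrightarrow> x = 0)"

lemma onb_orthosys: "onb e \<Longrightarrow> orthosys e"
  by (simp add: onb_def)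

lemma orthosys_norm_le: "orthosys e \<Longrightarrow> norm (e i) \<le> 1"
  by (auto simp: orthosys_def norm_eq_sqrt_inner dest!: spec[of _ i])

text \<open>Absorbs the factor \<open>e i \<bullet> e i\<close>, which is 1 unless
  \<open>e i\<close> is a zero vector, in the coefficients of expansions.\<close>

lemma orthosys_inner_self: "orthosys e \<Longrightarrow> (x \<bullet> e i) * (e i \<bullet> e i) = x \<bullet> e i"
  by (auto simp: orthosys_def dest!: spec[of _ i])

lemma orthosys_inner_sum:
  assumes "orthosys e" "finite I"
  shows "(\<Sum>i\<in>I. c i *\<^sub>R e i) \<bullet> e k = (if k \<in> I then c k * (e k \<bullet> e k) else 0)"
proof -
  have "(\<Sum>i\<in>I. c i *\<^sub>R e i) \<bullet> e k = (\<Sum>i\<in>I. if i = k then c k * (e k \<bullet> e k) else 0)"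
    using assms(1) by (auto simp: inner_sum_left orthosys_def intro!: sum.cong)
  also have "\<dots> = (if k \<in> I then c k * (e k \<bullet> e k) else 0)"
    using assms(2) by simp
  finally show ?thesis .
qed

lemma orthosys_norm_sum:
  assumes "orthosys e" "finite I"
  shows "(norm (\<Sum>i\<in>I. c i *\<^sub>R e i))\<^sup>2 = (\<Sum>i\<in>I. (c i)\<^sup>2 * (e i \<bullet> e i))"
proof -
  have "(norm (\<Sum>i\<in>I. c i *\<^sub>R e i))\<^sup>2 = (\<Sum>k\<in>I. c k * ((\<Sum>i\<in>I. c i *\<^sub>R e i) \<bullet> e k))"
    by (simp add: power2_norm_eq_inner inner_sum_right)
  also have "\<dots> = (\<Sum>i\<in>I. (c i)\<^sup>2 * (e i \<bullet> e i))"
    by (intro sum.cong refl) (simp add: orthosys_inner_sum[OF assms] power2_eq_square)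
  finally show ?thesis .
qed

lemma orthosys_norm_sum_le:
  assumes "orthosys e" "finite I"
  shows "(norm (\<Sum>i\<in>I. c i *\<^sub>R e i))\<^sup>2 \<le> (\<Sum>i\<in>I. (c i)\<^sup>2)"
  unfolding orthosys_norm_sum[OF assms]
proof (rule sum_mono)
  fix i
  have "e i \<bullet> e i = 0 \<or> e i \<bullet> e i = 1" using assms by (simp add: orthosys_def)
  then show "(c i)\<^sup>2 * (e i \<bullet> e i) \<le> (c i)\<^sup>2" by auto
qed

lemma bessel:
  assumes "orthosys e" "finite I"
  shows "(\<Sum>i\<in>I. (x \<bullet> e i)\<^sup>2) \<le> (norm x)\<^sup>2"
proof -
  define y where "y = (\<Sum>i\<in>I. (x \<bullet> e i) *\<^sub>R e i)"
  have xy: "x \<bullet> y = (\<Sum>i\<in>I. (x \<bullet> e i)\<^sup>2)"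
    by (simp add: y_def inner_sum_right power2_eq_square)
  have yy: "y \<bullet> y \<le> (\<Sum>i\<in>I. (x \<bullet> e i)\<^sup>2)"
    using orthosys_norm_sum_le[OF assms] unfolding y_def by (simp add: power2_norm_eq_inner)
  have "0 \<le> (x - y) \<bullet> (x - y)" by simp
  also have "\<dots> = x \<bullet> x - 2 * (x \<bullet> y) + y \<bullet> y"
    by (simp add: inner_diff_left inner_diff_right inner_commute)
  finally show ?thesis using xy yy by (simp add: power2_norm_eq_inner)
qed

lemma bessel_summable:
  assumes "orthosys e"
  shows "summable (\<lambda>i. (x \<bullet> e i)\<^sup>2)"
  by (rule bounded_imp_summable[where B="(norm x)\<^sup>2"]) (auto intro: bessel assms)

text \<open>By Pythagoras, a block of the vector series is controlled by the same block of the
  numerical series, so the Cauchy property passes from one to the other.\<close>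

lemma orthosys_summable:
  fixes e :: "nat \<Rightarrow> 'h::{real_inner,complete_space}"
  assumes e: "orthosys e" and c: "summable (\<lambda>i. (c i)\<^sup>2)"
  shows "summable (\<lambda>i. c i *\<^sub>R e i)"
proof -
  have "Cauchy (\<lambda>n. \<Sum>i<n. c i *\<^sub>R e i)"
  proof (rule metric_CauchyI)
    fix d :: real assume "0 < d"
    then have d2: "0 < d\<^sup>2" by simp
    obtain N where N: "\<And>m n. m \<ge> N \<Longrightarrow> norm (\<Sum>i=m..<n. (c i)\<^sup>2) < d\<^sup>2"
      using c[unfolded summable_Cauchy] d2 by blast
    have main: "norm ((\<Sum>i<n. c i *\<^sub>R e i) - (\<Sum>i<m. c i *\<^sub>R e i)) < d" if "N \<le> m" "m \<le> n" for m n
    proof -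
      have "(\<Sum>i<n. c i *\<^sub>R e i) - (\<Sum>i<m. c i *\<^sub>R e i) = (\<Sum>i=m..<n. c i *\<^sub>R e i)"
        using that(2) by (metis atLeast0LessThan less_eq_nat.simps(1) sum_diff_nat_ivl)
      then have "(norm ((\<Sum>i<n. c i *\<^sub>R e i) - (\<Sum>i<m. c i *\<^sub>R e i)))\<^sup>2 \<le> (\<Sum>i=m..<n. (c i)\<^sup>2)"
        using orthosys_norm_sum_le[OF e, of "{m..<n}" c] by simp
      also have "\<dots> < d\<^sup>2" using N[OF that(1), of n] by auto
      finally show ?thesis using \<open>0 < d\<close> by (meson less_imp_le power2_less_imp_less)
    qed
    have "dist (\<Sum>i<m. c i *\<^sub>R e i) (\<Sum>i<n. c i *\<^sub>R e i) < d" if "m \<ge> N" "n \<ge> N" for m n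
      using main[of m n] main[of n m] that by (cases "m \<le> n") (auto simp: dist_norm norm_minus_commute)
    then show "\<exists>M. \<forall>m\<ge>M. \<forall>n\<ge>M. dist (\<Sum>i<m. c i *\<^sub>R e i) (\<Sum>i<n. c i *\<^sub>R e i) < d" by blast
  qed
  then show ?thesis by (simp add: summable_iff_convergent Cauchy_convergent_iff)
qed

lemma orthosys_inner_suminf:
  fixes e :: "nat \<Rightarrow> 'h::{real_inner,complete_space}"
  assumes e: "orthosys e" and c: "summable (\<lambda>i. (c i)\<^sup>2)"
  shows "(\<Sum>i. c i *\<^sub>R e i) \<bullet> e k = c k * (e k \<bullet> e k)"
proof -
  have "(\<lambda>n. (\<Sum>i<n. c i *\<^sub>R e i) \<bullet> e k) \<longlonglongrightarrow> (\<Sum>i. c i *\<^sub>R e i) \<bullet> e k"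
    using orthosys_summable[OF assms] by (intro tendsto_intros summable_LIMSEQ)
  moreover have "(\<lambda>n. (\<Sum>i<n. c i *\<^sub>R e i) \<bullet> e k) \<longlonglongrightarrow> c k * (e k \<bullet> e k)"
    by (rule tendsto_eventually, rule eventually_sequentiallyI[of "Suc k"])
      (simp add: orthosys_inner_sum[OF e])
  ultimately show ?thesis by (rule LIMSEQ_unique)
qed

lemma onb_eqI:
  assumes "onb e" "\<And>i. x \<bullet> e i = y \<bullet> e i"
  shows "x = y"
proof -
  have "\<forall>i. (x - y) \<bullet> e i = 0" using assms(2) by (simp add: inner_diff_left)
  then show ?thesis using assms(1) unfolding onb_def by (metis right_minus_eq)
qed

lemma onb_sums:
  fixes e :: "nat \<Rightarrow> 'h::{real_inner,complete_space}"
  assumes "onb e"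
  shows "(\<lambda>i. (x \<bullet> e i) *\<^sub>R e i) sums x"
proof -
  note e = onb_orthosys[OF assms]
  note s = orthosys_summable[OF e bessel_summable[OF e]]
  have "(\<Sum>i. (x \<bullet> e i) *\<^sub>R e i) = x"
    by (rule onb_eqI[OF assms])
      (simp add: orthosys_inner_suminf[OF e bessel_summable[OF e]] orthosys_inner_self[OF e])
  then show ?thesis using summable_sums[OF s] by metis
qed

lemma onb_inner_sums:
  fixes e :: "nat \<Rightarrow> 'h::{real_inner,complete_space}"
  assumes "onb e"
  shows "(\<lambda>i. (x \<bullet> e i) * (y \<bullet> e i)) sums (x \<bullet> y)"
  using bounded_linear.sums[OF bounded_linear_inner_right onb_sums[OF assms, of x], of y]
  by (simp add: inner_commute)

lemma onb_norm_sums: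
  fixes e :: "nat \<Rightarrow> 'h::{real_inner,complete_space}"
  assumes "onb e"
  shows "(\<lambda>i. (x \<bullet> e i)\<^sup>2) sums (norm x)\<^sup>2"
  using onb_inner_sums[OF assms, of x x] by (simp add: power2_norm_eq_inner flip: power2_eq_square)

lemma onb_norm_suminf:
  fixes e :: "nat \<Rightarrow> 'h::{real_inner,complete_space}"
  assumes "onb e"
  shows "(\<Sum>i. (x \<bullet> e i)\<^sup>2) = (norm x)\<^sup>2"
  using onb_norm_sums[OF assms] by (simp add: sums_iff)

subsection \<open>Diagonal operators\<close>

text \<open>\<open>Blinfun\<close> is meaningful only for bounded linear maps, hence the bound
  \<open>B\<close> in \<open>diag_op_apply\<close>.\<close>

definition diag_op :: "(nat \<Rightarrow> 'h::{real_inner,complete_space}) \<Rightarrow> (nat \<Rightarrow> real) \<Rightarrow> ('h \<Rightarrow>\<^sub>L 'h)" where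
  "diag_op e a = Blinfun (\<lambda>x. \<Sum>i. (a i * (x \<bullet> e i)) *\<^sub>R e i)"

lemma diag_op_square_summable:
  assumes e: "orthosys e" and a: "\<And>i. \<bar>a i\<bar> \<le> B"
  shows "summable (\<lambda>i. (a i * (x \<bullet> e i))\<^sup>2)"
    "(\<Sum>i. (a i * (x \<bullet> e i))\<^sup>2) \<le> (B * norm x)\<^sup>2"
proof -
  have le: "(a i * (x \<bullet> e i))\<^sup>2 \<le> B\<^sup>2 * (x \<bullet> e i)\<^sup>2" for i
    using power_mono[OF a[of i] abs_ge_zero, of 2] by (simp add: power_mult_distrib mult_right_mono)
  have s: "summable (\<lambda>i. B\<^sup>2 * (x \<bullet> e i)\<^sup>2)" using bessel_summable[OF e] by (rule summable_mult)
  show s': "summable (\<lambda>i. (a i * (x \<bullet> e i))\<^sup>2)"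
    by (rule summable_comparison_test'[OF s, of 0]) (use le in auto)
  have "(\<Sum>i. (a i * (x \<bullet> e i))\<^sup>2) \<le> (\<Sum>i. B\<^sup>2 * (x \<bullet> e i)\<^sup>2)"
    by (rule suminf_le[OF le s' s])
  also have "\<dots> = B\<^sup>2 * (\<Sum>i. (x \<bullet> e i)\<^sup>2)" by (rule suminf_mult[OF bessel_summable[OF e]])
  also have "\<dots> \<le> B\<^sup>2 * (norm x)\<^sup>2"
    by (intro mult_left_mono suminf_le_const bessel_summable e bessel) auto
  finally show "(\<Sum>i. (a i * (x \<bullet> e i))\<^sup>2) \<le> (B * norm x)\<^sup>2" by (simp add: power_mult_distrib)
qed

lemma diag_op_apply:
  assumes e: "onb e" and a: "\<And>i. \<bar>a i\<bar> \<le> B"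
  shows "diag_op e a x = (\<Sum>i. (a i * (x \<bullet> e i)) *\<^sub>R e i)"
    and "diag_op e a x \<bullet> e i = a i * (x \<bullet> e i)"
    and "norm (diag_op e a x) \<le> B * norm x"
proof -
  note o = onb_orthosys[OF e]
  note s = diag_op_square_summable[OF o, of a, OF a]
  let ?f = "\<lambda>x. \<Sum>i. (a i * (x \<bullet> e i)) *\<^sub>R e i"
  have c: "?f x \<bullet> e i = a i * (x \<bullet> e i)" for x i
    using orthosys_inner_suminf[OF o s(1)] by (simp add: orthosys_inner_self[OF o] mult.assoc)
  have B: "0 \<le> B" using a[of 0] by linarith
  have n: "norm (?f x) \<le> B * norm x" for x
  proof -
    have "(norm (?f x))\<^sup>2 = (\<Sum>i. (?f x \<bullet> e i)\<^sup>2)" by (rule onb_norm_suminf[OF e, symmetric])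
    also have "\<dots> = (\<Sum>i. (a i * (x \<bullet> e i))\<^sup>2)" unfolding c ..
    also have "\<dots> \<le> (B * norm x)\<^sup>2" by (rule s(2))
    finally show ?thesis using B by (meson mult_nonneg_nonneg norm_ge_zero power2_le_imp_le)
  qed
  have "bounded_linear ?f"
  proof (rule bounded_linear_intro[where K=B])
    \<comment> \<open>Linearity is checked on coordinates, where no series has to be
      rearranged.\<close>
    show "?f (x + y) = ?f x + ?f y" for x y
    proof (rule onb_eqI[OF e])
      fix i show "?f (x + y) \<bullet> e i = (?f x + ?f y) \<bullet> e i"
        using c[of "x + y" i] c[of x i] c[of y i] by (metis inner_add_left distrib_left)
    qed
    show "?f (r *\<^sub>R x) = r *\<^sub>R ?f x" for r x
    proof (rule onb_eqI[OF e])
      fix i show "?f (r *\<^sub>R x) \<bullet> e i = (r *\<^sub>R ?f x) \<bullet> e i"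
        using c[of "r *\<^sub>R x" i] c[of x i] by (metis inner_scaleR_left mult.left_commute)
    qed
    show "norm (?f x) \<le> norm x * B" for x using n[of x] by (simp add: mult.commute)
  qed
  then show 1: "diag_op e a x = ?f x" by (simp add: diag_op_def bounded_linear_Blinfun_apply)
  show "diag_op e a x \<bullet> e i = a i * (x \<bullet> e i)" unfolding 1 by (rule c)
  show "norm (diag_op e a x) \<le> B * norm x" unfolding 1 by (rule n)
qed

lemma suminf_tendsto_dominated:
  fixes a :: "nat \<Rightarrow> nat \<Rightarrow> real"
  assumes "summable g" "\<And>n i. \<bar>a n i\<bar> \<le> g i" "\<And>i. (\<lambda>n. a n i) \<longlonglongrightarrow> b i"
  shows "(\<lambda>n. \<Sum>i. a n i) \<longlonglongrightarrow> (\<Sum>i. b i)"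
proof -
  have "eventually (\<lambda>(i,n). norm (a n i) \<le> g i) (at_top \<times>\<^sub>F sequentially)"
    using assms(2) by (intro always_eventually) auto
  from tannerys_theorem[OF assms(3) this assms(1)] show ?thesis by simp
qed

text \<open>Parseval and dominated convergence of series turn coordinatewise convergence into norm
  convergence.\<close>

lemma onb_tendsto_zero:
  fixes y :: "nat \<Rightarrow> 'h::{real_inner,complete_space}"
  assumes e: "onb e" and g: "summable g" and le: "\<And>n i. (y n \<bullet> e i)\<^sup>2 \<le> g i"
    and lim: "\<And>i. (\<lambda>n. y n \<bullet> e i) \<longlonglongrightarrow> 0"
  shows "y \<longlonglongrightarrow> 0"
proof -
  have "(\<lambda>n. \<Sum>i. (y n \<bullet> e i)\<^sup>2) \<longlonglongrightarrow> (\<Sum>i::nat. 0::real)"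
  proof (rule suminf_tendsto_dominated[OF g])
    show "(\<lambda>n. (y n \<bullet> e i)\<^sup>2) \<longlonglongrightarrow> 0" for i using tendsto_power[OF lim, of i 2] by simp
  qed (use le in auto)
  then have "(\<lambda>n. (norm (y n))\<^sup>2) \<longlonglongrightarrow> 0" by (simp add: onb_norm_suminf[OF e])
  then have "(\<lambda>n. norm (y n)) \<longlonglongrightarrow> 0"
    using tendsto_real_sqrt by fastforce
  then show ?thesis by (rule tendsto_norm_zero_cancel)
qed

subsection \<open>Existence of orthonormal bases\<close>

text \<open>Distinct elements are at distance sqrt 2, so the balls of radius 1/2 around them are
  disjoint; a second countable space has only countably many disjoint nonempty open sets.\<close>

lemma orthonormal_set_countable:
  fixes E :: "'h::{real_inner,second_countable_topology} set"
  assumes "pairwise orthogonal E" "\<And>e. e \<in> E \<Longrightarrow> norm e = 1"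
  shows "countable E"
proof -
  let ?B = "\<lambda>e::'h. ball e (1/2)"
  have d: "1 < dist e f" if "e \<in> E" "f \<in> E" "e \<noteq> f" for e f
  proof -
    have "e \<bullet> f = 0" using assms(1) that by (auto simp: pairwise_def orthogonal_def)
    moreover have "e \<bullet> e = 1" "f \<bullet> f = 1" using assms(2) that by (auto simp: norm_eq_1)
    ultimately have "(dist e f)\<^sup>2 = 2"
      by (simp add: dist_norm power2_norm_eq_inner inner_diff_left inner_diff_right inner_commute)
    then have "(1::real)\<^sup>2 < (dist e f)\<^sup>2" by simp
    then show ?thesis by (rule power2_less_imp_less) simp
  qed
  have disj: "?B e \<inter> ?B f = {}" if "e \<in> E" "f \<in> E" "e \<noteq> f" for e f
  proof (rule ccontr)
    assume "?B e \<inter> ?B f \<noteq> {}"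
    then obtain z where "dist e z < 1/2" "dist f z < 1/2" by auto
    then have "dist e f < 1" using dist_triangle2[of e f z] by linarith
    then show False using d[OF that] by simp
  qed
  have inj: "inj_on ?B E"
  proof (rule inj_onI)
    fix x y assume "x \<in> E" "y \<in> E" "?B x = ?B y"
    then show "x = y" using disj[of x y] by (metis centre_in_ball disjoint_iff half_gt_zero_iff zero_less_one)
  qed
  have "countable (?B ` E)"
    by (rule countable_disjoint_open_subsets) (auto simp: pairwise_def disjnt_def intro!: disj dest: disj)
  then show ?thesis using inj by (rule countable_image_inj_on)
qed

text \<open>Positions that no element occupies carry 0, so a finite basis also becomes a sequence
  over all natural numbers.\<close>

definition set_to_seq :: "'h::real_vector set \<Rightarrow> nat \<Rightarrow> 'h" where
  "set_to_seq E n = (if n \<in> to_nat_on E ` E then from_nat_into E n else 0)"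

lemma set_to_seq_cases:
  assumes "countable E"
  shows "set_to_seq E n = 0 \<or> (set_to_seq E n \<in> E \<and> to_nat_on E (set_to_seq E n) = n)"
proof (cases "n \<in> to_nat_on E ` E")
  case True
  then obtain x where "x \<in> E" "n = to_nat_on E x" by blast
  then show ?thesis using assms by (simp add: set_to_seq_def)
qed (simp add: set_to_seq_def)

lemma set_to_seq_to_nat_on: "countable E \<Longrightarrow> x \<in> E \<Longrightarrow> set_to_seq E (to_nat_on E x) = x"
  by (simp add: set_to_seq_def)

lemma set_to_seq_orthosys:
  assumes "countable E" "pairwise orthogonal E" "\<And>e. e \<in> E \<Longrightarrow> norm e = 1"
  shows "orthosys (set_to_seq E)"
  unfolding orthosys_def
proof (intro conjI allI impI)
  fix i j :: nat assume "i \<noteq> j"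
  then show "set_to_seq E i \<bullet> set_to_seq E j = 0"
  proof (cases "set_to_seq E i = 0 \<or> set_to_seq E j = 0")
    case False
    then have "set_to_seq E i \<in> E" "set_to_seq E j \<in> E" "set_to_seq E i \<noteq> set_to_seq E j"
      using set_to_seq_cases[OF assms(1), of i] set_to_seq_cases[OF assms(1), of j] \<open>i \<noteq> j\<close> by auto
    then show ?thesis using assms(2) unfolding pairwise_def orthogonal_def by blast
  qed auto
next
  fix i show "set_to_seq E i \<bullet> set_to_seq E i = 0 \<or> set_to_seq E i \<bullet> set_to_seq E i = 1"
    using set_to_seq_cases[OF assms(1), of i] assms(3) by (auto simp: norm_eq_1)
qed

lemma summable_on_set_to_seq:
  fixes f :: "'h::real_vector \<Rightarrow> real"
  assumes "countable E" "f summable_on E" "f 0 = 0"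
  shows "summable (\<lambda>n. f (set_to_seq E n))"
proof -
  let ?t = "to_nat_on E"
  have "(f \<circ> set_to_seq E \<circ> ?t) summable_on E"
    using assms(2) by (rule summable_on_cong[THEN iffD1, rotated]) (simp add: set_to_seq_to_nat_on assms(1))
  then have "(f \<circ> set_to_seq E) summable_on (?t ` E)"
    using summable_on_reindex[OF inj_on_to_nat_on[OF assms(1)], of "f \<circ> set_to_seq E"] by simp
  then have "(f \<circ> set_to_seq E) summable_on UNIV"
    by (rule summable_on_cong_neutral[THEN iffD1, rotated -1]) (auto simp: set_to_seq_def assms(3))
  then show ?thesis by (auto dest!: summable_on_imp_summable simp: o_def)
qed

text \<open>With \<open>P\<close> trivial this yields an orthonormal basis, with \<open>P\<close> the eigenvectors of an
  operator the spectral theorem.\<close>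

lemma exists_orthonormal_basis:
  fixes P :: "'h::{real_inner,complete_space,second_countable_topology} \<Rightarrow> bool"
  assumes ext: "\<And>E. pairwise orthogonal E \<Longrightarrow> (\<And>e. e \<in> E \<Longrightarrow> norm e = 1 \<and> P e) \<Longrightarrow>
      (\<exists>x. x \<noteq> 0 \<and> (\<forall>e\<in>E. x \<bullet> e = 0)) \<Longrightarrow> \<exists>x. norm x = 1 \<and> P x \<and> (\<forall>e\<in>E. x \<bullet> e = 0)"
  obtains E where "orthonormal_basis E" "\<And>e. e \<in> E \<Longrightarrow> P e" "onb (set_to_seq E)" "countable E"
proof -
  define \<A> where "\<A> = {E::'h set. pairwise orthogonal E \<and> (\<forall>e\<in>E. norm e = 1 \<and> P e)}"
  have "\<exists>M\<in>\<A>. \<forall>X\<in>\<A>. M \<subseteq> X \<longrightarrow> X = M"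
  proof (rule subset_Zorn_nonempty)
    show "\<A> \<noteq> {}" unfolding \<A>_def by (auto intro!: exI[of _ "{}"])
    fix \<C> assume c: "\<C> \<noteq> {}" "subset.chain \<A> \<C>"
    have "pairwise orthogonal (\<Union>\<C>)"
      unfolding pairwise_def
    proof (intro ballI impI)
      fix x y assume "x \<in> \<Union>\<C>" "y \<in> \<Union>\<C>" "x \<noteq> y"
      then obtain X Y where XY: "X \<in> \<C>" "Y \<in> \<C>" "x \<in> X" "y \<in> Y" by blast
      then have "X \<subseteq> Y \<or> Y \<subseteq> X" using c(2) by (auto simp: subset.chain_def)
      then obtain Z where "Z \<in> \<C>" "x \<in> Z" "y \<in> Z" using XY by blast
      then show "orthogonal x y" using c(2) \<open>x \<noteq> y\<close> unfolding subset.chain_def \<A>_def pairwise_def by blast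
    qed
    then show "\<Union>\<C> \<in> \<A>" using c(2) unfolding subset.chain_def \<A>_def by blast
  qed
  then obtain E where E: "E \<in> \<A>" and max: "\<And>X. X \<in> \<A> \<Longrightarrow> E \<subseteq> X \<Longrightarrow> X = E" by blast
  have o: "pairwise orthogonal E" and n: "\<And>e. e \<in> E \<Longrightarrow> norm e = 1 \<and> P e" using E by (auto simp: \<A>_def)
  \<comment> \<open>A nonzero vector orthogonal to the maximal set would allow \<open>ext\<close> to
    enlarge it.\<close>
  have tot: "x = 0" if x: "\<forall>e\<in>E. x \<bullet> e = 0" for x
  proof (rule ccontr)
    assume "x \<noteq> 0"
    then obtain y where y: "norm y = 1" "P y" "\<forall>e\<in>E. y \<bullet> e = 0" using ext[OF o n] x by blast
    then have "insert y E \<in> \<A>"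
      using o n by (auto simp: \<A>_def pairwise_insert orthogonal_def inner_commute)
    then have "y \<in> E" using max by blast
    then show False using y by (metis norm_eq_1 zero_neq_one)
  qed
  have cnt: "countable E" using orthonormal_set_countable o n by blast
  have b: "onb (set_to_seq E)"
    unfolding onb_def using set_to_seq_orthosys[OF cnt o] n tot
    by (metis cnt set_to_seq_to_nat_on)
  have "closure (span E) = UNIV"
  proof -
    have "x \<in> closure (span E)" for x
      unfolding closure_sequential
    proof (intro exI conjI allI)
      show "(\<lambda>n. \<Sum>i<n. (x \<bullet> set_to_seq E i) *\<^sub>R set_to_seq E i) \<longlonglongrightarrow> x"
        using onb_sums[OF b] by (simp add: sums_def)
      have "set_to_seq E i \<in> span E" for i using set_to_seq_cases[OF cnt, of i] by (auto intro: span_base span_zero)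
      then show "(\<Sum>i<n. (x \<bullet> set_to_seq E i) *\<^sub>R set_to_seq E i) \<in> span E" for n
        by (intro span_sum span_scale)
    qed
    then show ?thesis by blast
  qed
  then have "orthonormal_basis E" using o n by (simp add: orthonormal_basis_def)
  then show thesis using that n b cnt by blast
qed

lemma exists_onb:
  obtains e :: "nat \<Rightarrow> 'h::{real_inner,complete_space,second_countable_topology}" and E
  where "onb e" "orthonormal_basis E" "e = set_to_seq E" "countable E"
proof (rule exists_orthonormal_basis[where P="\<lambda>x::'h. True"])
  fix E :: "'h set"
  assume "\<exists>x. x \<noteq> 0 \<and> (\<forall>e\<in>E. x \<bullet> e = 0)"
  then obtain x where "x \<noteq> 0" "\<forall>e\<in>E. x \<bullet> e = 0" by blast
  then show "\<exists>x. norm x = 1 \<and> True \<and> (\<forall>e\<in>E. x \<bullet> e = 0)"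
    by (intro exI[of _ "x /\<^sub>R norm x"]) auto
qed (use that in blast)

subsection \<open>Weak compactness\<close>

text \<open>Bessel's inequality, passed to the limit, makes \<open>c\<close> square summable and
  yields the candidate \<open>y\<close>; boundedness reduces arbitrary test vectors to finite
  combinations of the basis.\<close>

lemma weak_tendsto_onb:
  fixes x :: "nat \<Rightarrow> 'h::{real_inner,complete_space}"
  assumes e: "onb e" and B: "\<And>n. norm (x n) \<le> B" and lim: "\<And>i. (\<lambda>n. x n \<bullet> e i) \<longlonglongrightarrow> c i"
  obtains y where "\<And>u. (\<lambda>n. x n \<bullet> u) \<longlonglongrightarrow> y \<bullet> u" "norm y \<le> B"
proof -
  note o = onb_orthosys[OF e]
  have B0: "0 \<le> B" using B[of 0] norm_ge_zero order_trans by blast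
  have fin: "(\<Sum>i<n. (c i)\<^sup>2) \<le> B\<^sup>2" for n
  proof (rule LIMSEQ_le_const2)
    show "(\<lambda>k. \<Sum>i<n. (x k \<bullet> e i)\<^sup>2) \<longlonglongrightarrow> (\<Sum>i<n. (c i)\<^sup>2)"
      by (intro tendsto_intros lim)
    have "(\<Sum>i<n. (x k \<bullet> e i)\<^sup>2) \<le> B\<^sup>2" for k
      using bessel[OF o, of "{..<n}" "x k"] power_mono[OF B, of k 2] by simp
    then show "\<exists>N. \<forall>k\<ge>N. (\<Sum>i<n. (x k \<bullet> e i)\<^sup>2) \<le> B\<^sup>2" by blast
  qed
  have c: "summable (\<lambda>i. (c i)\<^sup>2)" by (rule bounded_imp_summable[OF _ fin[of "Suc _", unfolded lessThan_Suc_atMost]]) simp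
  define y where "y = (\<Sum>i. c i *\<^sub>R e i)"
  \<comment> \<open>At a zero vector the limit \<open>c i\<close> is 0, as it must be for a
    coordinate of \<open>y\<close>.\<close>
  have ce: "c i * (e i \<bullet> e i) = c i" for i
  proof -
    have "(\<lambda>n. (x n \<bullet> e i) * (e i \<bullet> e i)) \<longlonglongrightarrow> c i * (e i \<bullet> e i)" by (intro tendsto_intros lim)
    then show ?thesis unfolding orthosys_inner_self[OF o] using lim LIMSEQ_unique by blast
  qed
  have ye: "y \<bullet> e i = c i" for i
    unfolding y_def by (simp add: orthosys_inner_suminf[OF o c] ce)
  have ny: "norm y \<le> B"
  proof -
    have "(norm y)\<^sup>2 = (\<Sum>i. (c i)\<^sup>2)" using onb_norm_suminf[OF e, of y] ye by simp
    also have "\<dots> \<le> B\<^sup>2" by (rule suminf_le_const[OF c fin])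
    finally show ?thesis using B0 by (rule power2_le_imp_le)
  qed
  have "(\<lambda>n. x n \<bullet> u) \<longlonglongrightarrow> y \<bullet> u" for u
  proof (rule LIMSEQ_I)
    fix r :: real assume r: "0 < r"
    \<comment> \<open>Since \<open>x n - y\<close> has norm at most \<open>2 * B\<close>, this
      choice makes the error at most \<open>r / 2\<close>; adding 1 keeps the denominator positive
      for \<open>B = 0\<close>.\<close>
    define d where "d = r / (4 * (B + 1))"
    have d: "0 < d" using r B0 by (simp add: d_def)
    obtain N where N: "norm ((\<Sum>i<N. (u \<bullet> e i) *\<^sub>R e i) - u) < d"
      using LIMSEQ_D[OF onb_sums[OF e, of u, unfolded sums_def] d] by blast
    define v where "v = (\<Sum>i<N. (u \<bullet> e i) *\<^sub>R e i)"
    have "(\<lambda>n. x n \<bullet> v) \<longlonglongrightarrow> y \<bullet> v"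
      unfolding v_def inner_sum_right inner_scaleR_right ye by (intro tendsto_intros lim)
    then obtain M where M: "\<And>n. n \<ge> M \<Longrightarrow> norm (x n \<bullet> v - y \<bullet> v) < r / 2"
      using LIMSEQ_D[of _ _ "r/2"] r by (metis half_gt_zero)
    have "norm (x n \<bullet> u - y \<bullet> u) < r" if "n \<ge> M" for n
    proof -
      have "x n \<bullet> u - y \<bullet> u = (x n \<bullet> v - y \<bullet> v) + (x n - y) \<bullet> (u - v)"
        by (simp add: inner_diff_left inner_diff_right)
      moreover have "\<bar>(x n - y) \<bullet> (u - v)\<bar> \<le> (2 * B) * d"
      proof -
        have "norm (x n - y) \<le> 2 * B" using norm_triangle_ineq4[of "x n" y] B[of n] ny by linarith
        moreover have "norm (u - v) \<le> d" using N by (simp add: v_def norm_minus_commute)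
        ultimately show ?thesis
          using B0 by (intro order_trans[OF Cauchy_Schwarz_ineq2] mult_mono) auto
      qed
      moreover have "2 * B * d \<le> r / 2"
      proof -
        have "2 * B * d = (r / 2) * (B / (B + 1))" using B0 by (simp add: d_def divide_simps)
        also have "\<dots> \<le> (r / 2) * 1" using r B0 by (intro mult_left_mono) auto
        finally show ?thesis by simp
      qed
      ultimately show ?thesis using M[OF that] unfolding real_norm_def by linarith
    qed
    then show "\<exists>no. \<forall>n\<ge>no. norm (x n \<bullet> u - y \<bullet> u) < r" by blast
  qed
  then show thesis using that ny by blast
qed

text \<open>Cantor's diagonal argument, with one refinement per coordinate.\<close>

lemma bounded_coords_convergent_subseq:
  fixes f :: "nat \<Rightarrow> nat \<Rightarrow> real"
  assumes "\<And>n i. \<bar>f n i\<bar> \<le> B"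
  obtains r c where "strict_mono r" "\<And>i. (\<lambda>n. f (r n) i) \<longlonglongrightarrow> c i"
proof -
  let ?P = "\<lambda>n (s::nat \<Rightarrow> nat). convergent (\<lambda>k. f (s k) n)"
  interpret subseqs ?P
  proof
    fix n :: nat and s :: "nat \<Rightarrow> nat" assume "strict_mono s"
    have "bounded (range (\<lambda>k. f (s k) n))" by (rule boundedI[where B=B]) (use assms in \<open>auto simp: real_norm_def\<close>)
    then obtain r l where r: "strict_mono r" "((\<lambda>k. f (s k) n) \<circ> r) \<longlonglongrightarrow> l"
      using bounded_imp_convergent_subsequence[of "\<lambda>k. f (s k) n"] by metis
    then have "convergent (\<lambda>k. f ((s \<circ> r) k) n)"
      by (intro convergentI[of _ l]) (simp add: o_def)
    with r(1) show "\<exists>r'. strict_mono r' \<and> convergent (\<lambda>k. f ((s \<circ> r') k) n)" by blast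
  qed
  have "convergent (\<lambda>k. f (diagseq k) i)" for i
  proof -
    \<comment> \<open>From index \<open>Suc i\<close> on, the diagonal sequence is a subsequence of
      the refinement for coordinate \<open>i\<close>; the initial segment does not affect
      convergence.\<close>
    have "convergent (\<lambda>k. f ((diagseq \<circ> (+) (Suc i)) k) i)"
    proof (rule diagseq_holds[where k=i])
      fix x :: nat and s r :: "nat \<Rightarrow> nat"
      assume "strict_mono r" "convergent (\<lambda>k. f (s k) x)"
      then show "convergent (\<lambda>k. f ((s \<circ> r) k) x)"
        using convergent_subseq_convergent[of "\<lambda>k. f (s k) x" r] by (simp add: o_def)
    qed
    then have "convergent (\<lambda>k. f (diagseq (k + Suc i)) i)" by (simp add: o_def add.commute)
    then show ?thesis using convergent_ignore_initial_segment[of "\<lambda>k. f (diagseq k) i" "Suc i"] by simp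
  qed
  then have "(\<lambda>k. f (diagseq k) i) \<longlonglongrightarrow> lim (\<lambda>k. f (diagseq k) i)" for i
    by (simp add: convergent_LIMSEQ_iff)
  then show thesis using that[of diagseq "\<lambda>i. lim (\<lambda>k. f (diagseq k) i)"] subseq_diagseq by simp
qed

lemma weak_sequential_compactness:
  fixes x :: "nat \<Rightarrow> 'h::{real_inner,complete_space,second_countable_topology}"
  assumes B: "\<And>n. norm (x n) \<le> B"
  obtains r y where "strict_mono r" "\<And>u. (\<lambda>n. x (r n) \<bullet> u) \<longlonglongrightarrow> y \<bullet> u" "norm y \<le> B"
proof -
  obtain e :: "nat \<Rightarrow> 'h" where e: "onb e" using exists_onb by metis
  have "\<bar>x n \<bullet> e i\<bar> \<le> B" for n i
  proof -
    have "\<bar>x n \<bullet> e i\<bar> \<le> norm (x n) * norm (e i)" by (rule Cauchy_Schwarz_ineq2)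
    also have "\<dots> \<le> norm (x n) * 1"
      using orthosys_norm_le[OF onb_orthosys[OF e]] by (intro mult_left_mono) auto
    finally show ?thesis using B[of n] by simp
  qed
  then obtain r c where r: "strict_mono r" "\<And>i. (\<lambda>n. x (r n) \<bullet> e i) \<longlonglongrightarrow> c i"
    using bounded_coords_convergent_subseq[of "\<lambda>n i. x n \<bullet> e i" B] by blast
  obtain y where "\<And>u. (\<lambda>n. x (r n) \<bullet> u) \<longlonglongrightarrow> y \<bullet> u" "norm y \<le> B"
    using weak_tendsto_onb[OF e, of "\<lambda>n. x (r n)" B c] B r(2) by blast
  then show thesis using that[OF r(1)] by blast
qed

subsection \<open>The spectral theorem\<close>

text \<open>Compactness of Hilbert-Schmidt operators in sequential form: self-adjointness moves
  \<open>T\<close> to the basis, so the coordinates of \<open>T (x n - y)\<close> are dominated by a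
  multiple of \<open>norm (T (e i))\<close>, which is square summable.\<close>

lemma self_adjoint_weak_to_strong:
  fixes T :: "'h::{real_inner,complete_space,second_countable_topology} \<Rightarrow>\<^sub>L 'h"
  assumes T: "self_adjoint T" "hilbert_schmidt T"
    and B: "\<And>n. norm (x n) \<le> B" and w: "\<And>u. (\<lambda>n. x n \<bullet> u) \<longlonglongrightarrow> y \<bullet> u"
  shows "(\<lambda>n. T (x n)) \<longlonglongrightarrow> T y"
proof -
  obtain e :: "nat \<Rightarrow> 'h" and E where e: "onb e" "orthonormal_basis E" "e = set_to_seq E" "countable E"
    by (rule exists_onb)
  have sE: "(\<lambda>e. (norm (T e))\<^sup>2) summable_on E" using T(2) e(2) by (simp add: hilbert_schmidt_def)
  have "summable (\<lambda>i. (norm (T (e i)))\<^sup>2)"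
    using summable_on_set_to_seq[OF e(4) sE] e(3) by (simp add: blinfun.zero_right)
  then have s: "summable (\<lambda>i. (B + norm y)\<^sup>2 * (norm (T (e i)))\<^sup>2)" by (rule summable_mult)
  have sa: "T u \<bullet> v = u \<bullet> T v" for u v using T(1) by (simp add: self_adjoint_def)
  have "(\<lambda>n. T (x n - y)) \<longlonglongrightarrow> 0"
  proof (rule onb_tendsto_zero[OF e(1) s])
    fix n i
    have "\<bar>T (x n - y) \<bullet> e i\<bar> \<le> norm (x n - y) * norm (T (e i))"
      unfolding sa by (rule Cauchy_Schwarz_ineq2)
    also have "\<dots> \<le> (B + norm y) * norm (T (e i))"
      using norm_triangle_ineq4[of "x n" y] B[of n] by (intro mult_right_mono) auto
    finally show "(T (x n - y) \<bullet> e i)\<^sup>2 \<le> (B + norm y)\<^sup>2 * (norm (T (e i)))\<^sup>2"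
      by (metis abs_ge_zero power2_abs power_mono power_mult_distrib)
  next
    fix i show "(\<lambda>n. T (x n - y) \<bullet> e i) \<longlonglongrightarrow> 0"
      unfolding sa inner_diff_left using w[of "T (e i)"] by (simp add: LIM_zero)
  qed
  then show ?thesis by (simp add: blinfun.diff_right LIM_zero_iff)
qed

text \<open>A unit vector of \<open>W\<close> at which the norm \<open>M\<close> of \<open>T\<close>
  on \<open>W\<close> is attained is an eigenvector of T^2. Maximising the norm rather than the
  quadratic form postpones the sign of the extremal eigenvalue to the end, where T^2 - M^2 is
  factorised.\<close>

lemma exists_eigenvector:
  fixes T :: "'h::{real_inner,complete_space,second_countable_topology} \<Rightarrow>\<^sub>L 'h"
  assumes T: "self_adjoint T" "hilbert_schmidt T"
    and W: "subspace W" "closed W" "\<And>x. x \<in> W \<Longrightarrow> T x \<in> W" and x0: "x0 \<in> W" "x0 \<noteq> 0"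
  shows "\<exists>x l. x \<in> W \<and> norm x = 1 \<and> T x = l *\<^sub>R x"
proof -
  define U where "U = {norm (T x) | x. x \<in> W \<and> norm x = 1}"
  define M where "M = Sup U"
  have bdd: "bdd_above U" unfolding U_def bdd_above_def
    by (intro exI[of _ "norm T"]) (auto intro: norm_blinfun[of T, THEN order_trans])
  have nrm: "x /\<^sub>R norm x \<in> W \<and> norm (x /\<^sub>R norm x) = 1" if "x \<in> W" "x \<noteq> 0" for x
    using that W(1) by (simp add: subspace_scale)
  have U0: "U \<noteq> {}" unfolding U_def using nrm[OF x0] by blast
  have bound: "norm (T x) \<le> M * norm x" if "x \<in> W" for x
  proof (cases "x = 0")
    case False
    have "norm (T (x /\<^sub>R norm x)) \<le> M" unfolding M_def
      by (rule cSup_upper[OF _ bdd]) (use nrm[OF that False] in \<open>auto simp: U_def\<close>)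
    then show ?thesis using False by (simp add: blinfun.scaleR_right field_simps)
  qed simp
  have M0: "0 \<le> M"
  proof (rule ccontr)
    assume "\<not> 0 \<le> M"
    then have "M * norm x0 < 0" using x0(2) by (simp add: mult_neg_pos)
    then show False using bound[OF x0(1)] norm_ge_zero[of "T x0"] by linarith
  qed
  have "\<exists>x. x \<in> W \<and> norm x = 1 \<and> M - 1 / real (Suc n) < norm (T x)" for n
  proof -
    have "M - 1 / real (Suc n) < M" by simp
    then obtain z where "z \<in> U" "M - 1 / real (Suc n) < z" using less_cSup_iff[OF U0 bdd] unfolding M_def by blast
    then show ?thesis unfolding U_def by blast
  qed
  then obtain x where x: "\<And>n. x n \<in> W" "\<And>n. norm (x n) = 1" "\<And>n. M - 1 / real (Suc n) < norm (T (x n))"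
    by metis
  obtain r y where r: "strict_mono r" "\<And>u. (\<lambda>n. x (r n) \<bullet> u) \<longlonglongrightarrow> y \<bullet> u"
    using weak_sequential_compactness[of x 1] x(2) by (metis order_refl)
  define z where "z n = x (r n)" for n
  have z: "z n \<in> W" "norm (z n) = 1" for n using x by (simp_all add: z_def)
  have Tz: "(\<lambda>n. T (z n)) \<longlonglongrightarrow> T y"
    unfolding z_def by (rule self_adjoint_weak_to_strong[OF T, where B=1]) (use x r in auto)
  have nTz: "(\<lambda>n. norm (T (z n))) \<longlonglongrightarrow> M"
  proof (rule tendsto_sandwich)
    show "(\<lambda>n. M - 1 / real (Suc n)) \<longlonglongrightarrow> M"
      using tendsto_diff[OF tendsto_const LIMSEQ_inverse_real_of_nat, of M] by (simp add: divide_inverse)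
    show "\<forall>\<^sub>F n in sequentially. M - 1 / real (Suc n) \<le> norm (T (z n))"
    proof (rule always_eventually, rule allI)
      fix n
      have "1 / real (Suc (r n)) \<le> 1 / real (Suc n)"
        using seq_suble[OF r(1), of n] by (intro divide_left_mono) auto
      then show "M - 1 / real (Suc n) \<le> norm (T (z n))" using x(3)[of "r n"] unfolding z_def by linarith
    qed
    show "\<forall>\<^sub>F n in sequentially. norm (T (z n)) \<le> M"
      using bound[OF z(1)] z(2) by simp
  qed auto
  show ?thesis
  proof (cases "M = 0")
    \<comment> \<open>Then \<open>T\<close> vanishes on \<open>W\<close>, and any unit vector there
      has eigenvalue 0.\<close>
    case True
    then have "T (x 0) = 0 *\<^sub>R x 0" using bound[OF x(1), of 0] by simp
    then show ?thesis using x by blast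
  next
    case False
    then have Mp: "0 < M" using M0 by simp
    have sa: "T u \<bullet> v = u \<bullet> T v" for u v using T(1) by (simp add: self_adjoint_def)
    \<comment> \<open>Expand the square and use \<open>norm (z n) = 1\<close> together with
      \<open>bound\<close> for \<open>T (z n)\<close>. The right-hand side tends to 0 because
      \<open>norm (T (z n))\<close> tends to \<open>M\<close>.\<close>
    have le: "(norm (T (T (z n)) - M\<^sup>2 *\<^sub>R z n))\<^sup>2 \<le> M\<^sup>2 * (M\<^sup>2 - (norm (T (z n)))\<^sup>2)" for n
    proof -
      have "(norm (T (T (z n)) - M\<^sup>2 *\<^sub>R z n))\<^sup>2
          = (norm (T (T (z n))))\<^sup>2 - 2 * M\<^sup>2 * (norm (T (z n)))\<^sup>2 + (M\<^sup>2)\<^sup>2 * (norm (z n))\<^sup>2"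
        using sa[of "T (z n)" "z n"]
        unfolding power2_norm_eq_inner
        by (simp add: inner_diff_left inner_diff_right power2_eq_square inner_commute algebra_simps)
      also have "(norm (T (T (z n))))\<^sup>2 \<le> (M * norm (T (z n)))\<^sup>2"
        using bound[OF W(3)[OF z(1)]] by (intro power_mono) auto
      finally show ?thesis by (simp add: z(2) power_mult_distrib algebra_simps power2_eq_square)
    qed
    have "(\<lambda>n. M\<^sup>2 * (M\<^sup>2 - (norm (T (z n)))\<^sup>2)) \<longlonglongrightarrow> M\<^sup>2 * (M\<^sup>2 - M\<^sup>2)"
      by (intro tendsto_intros nTz)
    then have lim0: "(\<lambda>n. M\<^sup>2 * (M\<^sup>2 - (norm (T (z n)))\<^sup>2)) \<longlonglongrightarrow> 0" by simp
    have "(\<lambda>n. (norm (T (T (z n)) - M\<^sup>2 *\<^sub>R z n))\<^sup>2) \<longlonglongrightarrow> 0"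
      by (rule tendsto_sandwich[OF _ _ tendsto_const lim0]) (use le in auto)
    then have "(\<lambda>n. norm (T (T (z n)) - M\<^sup>2 *\<^sub>R z n)) \<longlonglongrightarrow> 0"
      using tendsto_real_sqrt by fastforce
    then have d: "(\<lambda>n. T (T (z n)) - M\<^sup>2 *\<^sub>R z n) \<longlonglongrightarrow> 0" by (rule tendsto_norm_zero_cancel)
    have TT: "(\<lambda>n. T (T (z n))) \<longlonglongrightarrow> T (T y)" by (intro blinfun.tendsto tendsto_const Tz)
    \<comment> \<open>Since \<open>M\<close> is positive, \<open>z\<close> is recovered from two
      convergent sequences, so its weak convergence has become strong.\<close>
    have "(\<lambda>n. (1 / M\<^sup>2) *\<^sub>R (T (T (z n)) - (T (T (z n)) - M\<^sup>2 *\<^sub>R z n))) \<longlonglongrightarrow> (1 / M\<^sup>2) *\<^sub>R (T (T y) - 0)"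
      by (intro tendsto_intros TT d)
    then have zl: "z \<longlonglongrightarrow> (1 / M\<^sup>2) *\<^sub>R T (T y)" using Mp by simp
    define q where "q = (1 / M\<^sup>2) *\<^sub>R T (T y)"
    have zq: "z \<longlonglongrightarrow> q" using zl by (simp add: q_def)
    have qW: "q \<in> W" by (rule closed_sequentially[OF W(2)]) (use z zq in auto)
    have q1: "norm q = 1" using tendsto_norm[OF zq] z(2) by (simp add: LIMSEQ_const_iff)
    have "(\<lambda>n. T (T (z n)) - M\<^sup>2 *\<^sub>R z n) \<longlonglongrightarrow> T (T q) - M\<^sup>2 *\<^sub>R q"
      by (intro tendsto_intros blinfun.tendsto zq)
    then have TTq: "T (T q) = M\<^sup>2 *\<^sub>R q" using d LIMSEQ_unique by fastforce
    \<comment> \<open>Here (T - M)(T + M) q = 0: either \<open>p\<close> is an eigenvector for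
      \<open>M\<close>, or \<open>p = 0\<close> and \<open>q\<close> is one for
      \<open>- M\<close>.\<close>
    define p where "p = T q + M *\<^sub>R q"
    have Tp: "T p = M *\<^sub>R p"
      by (simp add: p_def blinfun.add_right blinfun.scaleR_right TTq scaleR_add_right power2_eq_square)
    have pW: "p \<in> W" unfolding p_def by (intro subspace_add subspace_scale W qW)
    show ?thesis
    proof (cases "p = 0")
      case True
      then have "T q = (- M) *\<^sub>R q" by (simp add: p_def eq_neg_iff_add_eq_0)
      then show ?thesis using qW q1 by blast
    next
      case False
      have "T (p /\<^sub>R norm p) = M *\<^sub>R (p /\<^sub>R norm p)" by (simp add: blinfun.scaleR_right Tp)
      then show ?thesis using nrm[OF pW False] by blast
    qed
  qed
qed

text \<open>A maximal orthonormal set of eigenvectors is total: its orthogonal complement is closed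
  and invariant under \<open>T\<close>, so if it were nontrivial, \<open>exists_eigenvector\<close>
  would supply a further member.\<close>

theorem spectral_theorem:
  fixes T :: "'h::{real_inner,complete_space,second_countable_topology} \<Rightarrow>\<^sub>L 'h"
  assumes T: "self_adjoint T" "hilbert_schmidt T"
  obtains e E l where "onb e" "orthonormal_basis E" "e = set_to_seq E" "countable E"
    "\<And>i. T (e i) = l i *\<^sub>R e i" "\<And>i. l i = e i \<bullet> T (e i)" "summable (\<lambda>i. (l i)\<^sup>2)"
proof -
  have sa: "T u \<bullet> v = u \<bullet> T v" for u v using T(1) by (simp add: self_adjoint_def)
  obtain E :: "'h set" where E: "orthonormal_basis E" "\<And>x. x \<in> E \<Longrightarrow> \<exists>l. T x = l *\<^sub>R x"
      "onb (set_to_seq E)" "countable E"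
  proof (rule exists_orthonormal_basis[where P="\<lambda>x. \<exists>l. T x = l *\<^sub>R x"])
    fix E :: "'h set"
    assume n: "\<And>e. e \<in> E \<Longrightarrow> norm e = 1 \<and> (\<exists>l. T e = l *\<^sub>R e)"
      and x: "\<exists>x. x \<noteq> 0 \<and> (\<forall>e\<in>E. x \<bullet> e = 0)"
    define W where "W = {x. \<forall>e\<in>E. x \<bullet> e = 0}"
    have "subspace W" by (auto simp: W_def subspace_def inner_add_left)
    moreover have "closed W"
    proof -
      have "W = (\<Inter>e\<in>E. {x. x \<bullet> e = 0})" by (auto simp: W_def)
      then show ?thesis by (simp only:) (intro closed_INT ballI closed_Collect_eq continuous_intros)
    qed
    moreover have "T x \<in> W" if "x \<in> W" for x
      unfolding W_def
    proof (intro CollectI ballI)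
      fix e assume "e \<in> E"
      then obtain l where "T e = l *\<^sub>R e" using n by blast
      then show "T x \<bullet> e = 0" using that \<open>e \<in> E\<close> by (simp add: sa W_def)
    qed
    moreover obtain x0 where "x0 \<in> W" "x0 \<noteq> 0" using x by (auto simp: W_def)
    ultimately show "\<exists>x. norm x = 1 \<and> (\<exists>l. T x = l *\<^sub>R x) \<and> (\<forall>e\<in>E. x \<bullet> e = 0)"
      using exists_eigenvector[OF T, of W x0] by (auto simp: W_def)
  qed (use that in blast)
  define e where "e = set_to_seq E"
  \<comment> \<open>Unlike the eigenvalue equation, this formula fixes the value 0 at zero vectors
    of \<open>e\<close>.\<close>
  define l where "l i = e i \<bullet> T (e i)" for i
  have o: "onb e" using E(3) by (simp add: e_def)
  have ev: "T (e i) = l i *\<^sub>R e i" for i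
  proof (cases "e i = 0")
    case False
    then have "e i \<in> E" using set_to_seq_cases[OF E(4), of i] by (auto simp: e_def)
    then obtain k where k: "T (e i) = k *\<^sub>R e i" using E(2) by blast
    have "e i \<bullet> e i = 1" using onb_orthosys[OF o] False unfolding orthosys_def by (metis inner_eq_zero_iff)
    then show ?thesis using k by (simp add: l_def)
  qed simp
  have sE: "(\<lambda>e. (norm (T e))\<^sup>2) summable_on E" using T(2) E(1) by (simp add: hilbert_schmidt_def)
  have "summable (\<lambda>i. (norm (T (e i)))\<^sup>2)"
    using summable_on_set_to_seq[OF E(4) sE] by (simp add: e_def blinfun.zero_right)
  moreover have "(norm (T (e i)))\<^sup>2 = (l i)\<^sup>2" for i
  proof (cases "e i = 0")
    case False
    then have "e i \<bullet> e i = 1" using onb_orthosys[OF o] unfolding orthosys_def by (metis inner_eq_zero_iff)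
    then show ?thesis by (simp add: ev norm_eq_sqrt_inner)
  qed (simp add: l_def)
  ultimately show thesis using that[OF o E(1) e_def E(4) ev l_def] by simp
qed

text \<open>The representing vector has the coordinates \<open>f (e i)\<close>. Testing
  \<open>f\<close> on its own truncated series \<open>y\<close> gives
  \<open>(norm y)\<^sup>2 \<le> norm y * K\<close>, whence square summability.\<close>

lemma riesz_representation:
  fixes f :: "'h::{real_inner,complete_space,second_countable_topology} \<Rightarrow> real"
  assumes f: "bounded_linear f"
  shows "\<exists>!y. \<forall>z. z \<bullet> y = f z"
proof (rule ex_ex1I)
  interpret bounded_linear f by (rule f)
  obtain e :: "nat \<Rightarrow> 'h" where e: "onb e" using exists_onb by metis
  note o = onb_orthosys[OF e]
  obtain K where K: "\<And>x. norm (f x) \<le> norm x * K" "0 < K" using pos_bounded by blast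
  have "(\<Sum>i<n. (f (e i))\<^sup>2) \<le> K\<^sup>2" for n
  proof -
    define y where "y = (\<Sum>i<n. f (e i) *\<^sub>R e i)"
    define a where "a = (\<Sum>i<n. (f (e i))\<^sup>2)"
    have "f y = a" by (simp add: y_def a_def sum scaleR power2_eq_square)
    then have "a \<le> norm y * K" using K(1)[of y] by simp
    moreover have "(norm y)\<^sup>2 \<le> a" unfolding y_def a_def by (rule orthosys_norm_sum_le[OF o]) simp
    ultimately have "(norm y)\<^sup>2 \<le> norm y * K" by linarith
    then have "norm y \<le> K" using K(2) by (cases "norm y = 0") (auto simp: power2_eq_square)
    then have "norm y * K \<le> K * K" using K(2) by (intro mult_right_mono) auto
    then show ?thesis using \<open>a \<le> norm y * K\<close> by (simp add: a_def power2_eq_square)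
  qed
  then have s: "summable (\<lambda>i. (f (e i))\<^sup>2)"
    by (intro bounded_imp_summable[where B="K\<^sup>2"]) (simp_all only: zero_le_power2 flip: lessThan_Suc_atMost)
  have "z \<bullet> (\<Sum>i. f (e i) *\<^sub>R e i) = f z" for z
  proof -
    have "(\<lambda>i. f ((z \<bullet> e i) *\<^sub>R e i)) sums f z" by (rule sums[OF onb_sums[OF e]])
    then have 1: "(\<lambda>i. (z \<bullet> e i) * f (e i)) sums f z" by (simp add: scaleR)
    have "(\<Sum>i. f (e i) *\<^sub>R e i) \<bullet> e k = f (e k)" for k
      using orthosys_inner_suminf[OF o s, of k] o by (auto simp: orthosys_def zero dest!: spec[of _ k])
    then have "(\<lambda>i. (z \<bullet> e i) * f (e i)) sums (z \<bullet> (\<Sum>i. f (e i) *\<^sub>R e i))"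
      using onb_inner_sums[OF e, of z "\<Sum>i. f (e i) *\<^sub>R e i"] by simp
    then show ?thesis using 1 sums_unique2 by blast
  qed
  then show "\<exists>y. \<forall>z. z \<bullet> y = f z" by blast
next
  fix y y' assume "\<forall>z. z \<bullet> y = f z" "\<forall>z. z \<bullet> y' = f z"
  then have "\<forall>z. z \<bullet> y = z \<bullet> y'" by simp
  then show "y = y'" by (metis vector_eq_ldot)
qed

section \<open>Characteristic functions and Gaussian measures\<close>

definition cf :: "'h::real_inner measure \<Rightarrow> 'h \<Rightarrow> complex" where
  "cf \<nu> h = (CLINT x|\<nu>. iexp (x \<bullet> h))"

section \<open>One-dimensional normal laws and marginals of Gaussian measures\<close>

definition normal_law :: "real \<Rightarrow> real \<Rightarrow> real measure" where
  "normal_law a \<sigma> = (if \<sigma> = 0 then return borel a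
     else density lborel (\<lambda>t. ennreal (normal_density a \<sigma> t)))"

lemma real_distribution_normal_law:
  assumes "0 \<le> \<sigma>" shows "real_distribution (normal_law a \<sigma>)"
proof -
  have "prob_space (normal_law a \<sigma>)"
    using assms prob_space_normal_density[of \<sigma> a] prob_space_return[of a borel]
    by (auto simp: normal_law_def)
  then show ?thesis
    by (auto simp: real_distribution_def real_distribution_axioms_def normal_law_def)
qed

lemma normal_law_distributed:
  assumes "0 < \<sigma>" shows "distributed (normal_law a \<sigma>) lborel (\<lambda>x. x) (normal_density a \<sigma>)"
  using assms unfolding distributed_def normal_law_def
  by (auto intro!: distr_id2 measurable_ident_sets)

lemma char_normal_law:
  assumes "0 \<le> \<sigma>" shows "char (normal_law a \<sigma>) t = iexp (a * t) * exp (- (\<sigma> * t)\<^sup>2 / 2)"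
proof (cases "\<sigma> = 0")
  case True
  then show ?thesis by (simp add: normal_law_def char_def integral_return mult.commute)
next
  case False
  then have s: "0 < \<sigma>" using assms by simp
  interpret N: real_distribution "normal_law a \<sigma>" by (rule real_distribution_normal_law[OF assms])
  let ?Y = "\<lambda>x. (x - a) / \<sigma>"
  have "distributed (normal_law a \<sigma>) lborel ?Y std_normal_density"
    using N.normal_standard_normal_convert[OF s, of "\<lambda>x. x" a] normal_law_distributed[OF s] by simp
  then have d: "distr (normal_law a \<sigma>) lborel ?Y = std_normal_distribution"
    by (simp add: distributed_def)
  have "char (normal_law a \<sigma>) t = (CLINT x|normal_law a \<sigma>. iexp (a * t) * iexp ((\<sigma> * t) * ?Y x))"
    unfolding char_def
  proof (intro Bochner_Integration.integral_cong refl)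
    fix x
    have "t * x = a * t + (\<sigma> * t) * ?Y x" using s by (simp add: field_simps)
    then show "iexp (t * x) = iexp (a * t) * iexp ((\<sigma> * t) * ?Y x)"
      by (simp only: of_real_add distrib_left exp_add)
  qed
  also have "\<dots> = iexp (a * t) * (CLINT x|normal_law a \<sigma>. iexp ((\<sigma> * t) * ?Y x))"
    by (rule integral_mult_right_zero)
  also have "(CLINT x|normal_law a \<sigma>. iexp ((\<sigma> * t) * ?Y x)) = char (distr (normal_law a \<sigma>) lborel ?Y) (\<sigma> * t)"
    unfolding char_def by (rule integral_distr[symmetric]) auto
  also have "\<dots> = exp (- (\<sigma> * t)\<^sup>2 / 2)"
    unfolding d char_std_normal_distribution by simp
  finally show ?thesis .
qed

lemma has_bochner_integral_return:
  fixes f :: "'a \<Rightarrow> 'b::{banach, second_countable_topology}"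
  assumes f: "f \<in> borel_measurable M" and a: "a \<in> space M"
  shows "has_bochner_integral (return M a) f (f a)"
proof -
  interpret prob_space "return M a" by (rule prob_space_return[OF a])
  have c: "has_bochner_integral (return M a) (\<lambda>_. f a) (f a)"
    using prob_space by (simp add: has_bochner_integral_iff)
  have ae: "AE x in return M a. f x = f a"
  proof -
    have "{x \<in> space M. f x = f a} = f -` {f a} \<inter> space M" by auto
    also have "\<dots> \<in> sets M" by (rule measurable_sets[OF f]) simp
    finally have "Measurable.pred M (\<lambda>x. f x = f a)" by (simp add: pred_def)
    then show ?thesis using AE_return[OF a] by metis
  qed
  have "has_bochner_integral (return M a) f (f a) \<longleftrightarrow> has_bochner_integral (return M a) (\<lambda>_. f a) (f a)"
    by (rule has_bochner_integral_cong_AE) (use f ae in simp_all)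
  then show ?thesis using c by simp
qed

lemma normal_law_moments:
  assumes "0 \<le> \<sigma>"
  shows "has_bochner_integral (normal_law a \<sigma>) (\<lambda>x. x) a"
    and "has_bochner_integral (normal_law a \<sigma>) (\<lambda>x. (x - a)\<^sup>2) (\<sigma>\<^sup>2)"
proof -
  interpret N: real_distribution "normal_law a \<sigma>" by (rule real_distribution_normal_law[OF assms])
  show "has_bochner_integral (normal_law a \<sigma>) (\<lambda>x. x) a"
  proof (cases "\<sigma> = 0")
    case True
    then show ?thesis
      using has_bochner_integral_return[of "\<lambda>x. x" borel a] by (simp add: normal_law_def)
  next
    case False
    then have s: "0 < \<sigma>" using assms by simp
    have "has_bochner_integral (density lborel (\<lambda>t. ennreal (normal_density a \<sigma> t))) (\<lambda>x. x) a"
      by (rule has_bochner_integral_density) (use normal_moment_nz_1[OF s] in auto)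
    then show ?thesis using False by (simp add: normal_law_def)
  qed
  show "has_bochner_integral (normal_law a \<sigma>) (\<lambda>x. (x - a)\<^sup>2) (\<sigma>\<^sup>2)"
  proof (cases "\<sigma> = 0")
    case True
    then show ?thesis
      using has_bochner_integral_return[of "\<lambda>x. (x - a)\<^sup>2" borel a] by (simp add: normal_law_def)
  next
    case False
    then have s: "0 < \<sigma>" using assms by simp
    have "has_bochner_integral (density lborel (\<lambda>t. ennreal (normal_density a \<sigma> t))) (\<lambda>x. (x - a)\<^sup>2) (\<sigma>\<^sup>2)"
      by (rule has_bochner_integral_density)
        (use normal_moment_even[OF s, of a 1] in \<open>auto simp: power2_eq_square\<close>)
    then show ?thesis using False by (simp add: normal_law_def)
  qed
qed

lemma real_distribution_inner:
  fixes \<nu> :: "'h::{real_inner,second_countable_topology} measure"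
  assumes "prob_space \<nu>" "sets \<nu> = sets borel"
  shows "real_distribution (distr \<nu> borel (\<lambda>x. x \<bullet> h))"
    and "char (distr \<nu> borel (\<lambda>x. x \<bullet> h)) t = cf \<nu> (t *\<^sub>R h)"
proof -
  have m[measurable]: "(\<lambda>x. x \<bullet> h) \<in> borel_measurable \<nu>" using assms(2) by (simp cong: measurable_cong_sets)
  show "real_distribution (distr \<nu> borel (\<lambda>x. x \<bullet> h))"
    using prob_space.prob_space_distr[OF assms(1) m]
    by (auto simp: real_distribution_def real_distribution_axioms_def)
  show "char (distr \<nu> borel (\<lambda>x. x \<bullet> h)) t = cf \<nu> (t *\<^sub>R h)"
    unfolding char_def cf_def by (subst integral_distr) auto
qed

lemma gaussian_measure_iff:
  "gaussian_measure \<nu> \<longleftrightarrow> prob_space \<nu> \<and> sets \<nu> = sets borel \<and>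
     (\<forall>h. \<exists>a \<sigma>. 0 \<le> \<sigma> \<and> distr \<nu> borel (\<lambda>x. x \<bullet> h) = normal_law a \<sigma>)"
  by (simp add: gaussian_measure_def normal_law_def)

text \<open>The definition of a Gaussian measure provides unspecified parameters for each marginal;
  comparing the first two moments with the mean and the covariance identifies them.\<close>

lemma is_gaussian_marginal:
  assumes "is_gaussian \<nu> m K"
  shows "0 \<le> h \<bullet> K h" "distr \<nu> borel (\<lambda>x. x \<bullet> h) = normal_law (m \<bullet> h) (sqrt (h \<bullet> K h))"
proof -
  have pr: "prob_space \<nu>" and st: "sets \<nu> = sets borel" using assms by (auto simp: is_gaussian_def gaussian_measure_def)
  have [measurable]: "(\<lambda>x. x \<bullet> h) \<in> borel_measurable \<nu>" using st by (simp cong: measurable_cong_sets)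
  obtain a \<sigma> where s: "0 \<le> \<sigma>" and d: "distr \<nu> borel (\<lambda>x. x \<bullet> h) = normal_law a \<sigma>"
    using assms unfolding is_gaussian_def gaussian_measure_iff by blast
  note mom = normal_law_moments[OF s, of a, folded d]
  have "has_bochner_integral \<nu> (\<lambda>x. x \<bullet> h) a"
    using mom(1) by (simp add: has_bochner_integral_iff integrable_distr_eq integral_distr)
  moreover have "has_bochner_integral \<nu> (\<lambda>x. x \<bullet> h) (m \<bullet> h)"
    using assms by (simp add: is_gaussian_def has_mean_def)
  ultimately have a: "a = m \<bullet> h" by (rule has_bochner_integral_eq)
  have "has_bochner_integral \<nu> (\<lambda>x. (x \<bullet> h - a)\<^sup>2) (\<sigma>\<^sup>2)"
    using mom(2) by (simp add: has_bochner_integral_iff integrable_distr_eq integral_distr)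
  moreover have "has_bochner_integral \<nu> (\<lambda>x. (x \<bullet> h - a)\<^sup>2) (h \<bullet> K h)"
    using assms unfolding is_gaussian_def has_covariance_def a
    by (simp add: inner_diff_left power2_eq_square)
  ultimately have v: "\<sigma>\<^sup>2 = h \<bullet> K h" by (rule has_bochner_integral_eq)
  show "0 \<le> h \<bullet> K h" by (simp flip: v)
  show "distr \<nu> borel (\<lambda>x. x \<bullet> h) = normal_law (m \<bullet> h) (sqrt (h \<bullet> K h))"
    using s by (simp add: d a flip: v)
qed

lemma is_gaussian_cf:
  assumes "is_gaussian \<nu> m K"
  shows "cf \<nu> h = iexp (m \<bullet> h) * exp (- (h \<bullet> K h) / 2)"
proof -
  have pr: "prob_space \<nu>" and st: "sets \<nu> = sets borel" using assms by (auto simp: is_gaussian_def gaussian_measure_def)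
  have "cf \<nu> h = char (normal_law (m \<bullet> h) (sqrt (h \<bullet> K h))) 1"
    using real_distribution_inner(2)[OF pr st, of h 1] is_gaussian_marginal(2)[OF assms, of h] by simp
  also have "\<dots> = iexp (m \<bullet> h) * exp (- (h \<bullet> K h) / 2)"
    using is_gaussian_marginal(1)[OF assms, of h] by (subst char_normal_law) auto
  finally show ?thesis .
qed

text \<open>On each line through 0 the function is the characteristic function of a normal law, so
  Levy's uniqueness theorem identifies every marginal. Polarisation turns the variances into
  covariances.\<close>

lemma cf_imp_is_gaussian:
  assumes pr: "prob_space \<nu>" and st: "sets \<nu> = sets borel"
    and K: "self_adjoint K" "\<And>h. 0 \<le> h \<bullet> K h"
    and cf: "\<And>h. cf \<nu> h = iexp (m \<bullet> h) * exp (- (h \<bullet> K h) / 2)"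
  shows "is_gaussian \<nu> m K"
proof -
  have [measurable]: "(\<lambda>x. x \<bullet> h) \<in> borel_measurable \<nu>" for h using st by (simp cong: measurable_cong_sets)
  have d: "distr \<nu> borel (\<lambda>x. x \<bullet> h) = normal_law (m \<bullet> h) (sqrt (h \<bullet> K h))" for h
  proof (rule Levy_uniqueness)
    show "char (distr \<nu> borel (\<lambda>x. x \<bullet> h)) = char (normal_law (m \<bullet> h) (sqrt (h \<bullet> K h)))"
    proof
      fix t
      show "char (distr \<nu> borel (\<lambda>x. x \<bullet> h)) t = char (normal_law (m \<bullet> h) (sqrt (h \<bullet> K h))) t"
        unfolding real_distribution_inner(2)[OF pr st] cf char_normal_law[OF real_sqrt_ge_zero[OF K(2)]]
        using K(2)[of h] by (simp add: power_mult_distrib blinfun.scaleR_right power2_eq_square mult_ac)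
    qed
  qed (auto intro!: real_distribution_inner[OF pr st] real_distribution_normal_law K)
  have mean: "has_bochner_integral \<nu> (\<lambda>x. x \<bullet> h) (m \<bullet> h)" for h
    using normal_law_moments(1)[of "sqrt (h \<bullet> K h)" "m \<bullet> h", folded d] K(2)[of h]
    by (simp add: has_bochner_integral_iff integrable_distr_eq integral_distr)
  have var: "has_bochner_integral \<nu> (\<lambda>x. (x \<bullet> h - m \<bullet> h)\<^sup>2) (h \<bullet> K h)" for h
    using normal_law_moments(2)[of "sqrt (h \<bullet> K h)" "m \<bullet> h", folded d] K(2)[of h]
    by (simp add: has_bochner_integral_iff integrable_distr_eq integral_distr)
  have "has_bochner_integral \<nu> (\<lambda>x. ((x - m) \<bullet> h) * ((x - m) \<bullet> k)) (h \<bullet> K k)" for h k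
  proof -
    have hk: "k \<bullet> K h = h \<bullet> K k" using K(1) by (metis inner_commute self_adjoint_def)
    have "has_bochner_integral \<nu>
        (\<lambda>x. (1/4) * ((x \<bullet> (h + k) - m \<bullet> (h + k))\<^sup>2 - (x \<bullet> (h - k) - m \<bullet> (h - k))\<^sup>2))
        ((1/4) * ((h + k) \<bullet> K (h + k) - (h - k) \<bullet> K (h - k)))"
      by (intro has_bochner_integral_mult_right has_bochner_integral_diff var)
    moreover have "(1/4) * ((h + k) \<bullet> K (h + k) - (h - k) \<bullet> K (h - k)) = h \<bullet> K k"
      by (simp add: blinfun.add_right blinfun.diff_right inner_add_left inner_add_right
          inner_diff_left inner_diff_right hk)
    moreover have "(1/4) * ((x \<bullet> (h + k) - m \<bullet> (h + k))\<^sup>2 - (x \<bullet> (h - k) - m \<bullet> (h - k))\<^sup>2)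
        = ((x - m) \<bullet> h) * ((x - m) \<bullet> k)" for x
      by (simp add: inner_add_right inner_diff_left inner_diff_right power2_eq_square algebra_simps)
    ultimately show ?thesis by simp
  qed
  moreover have "\<exists>a \<sigma>. 0 \<le> \<sigma> \<and> distr \<nu> borel (\<lambda>x. x \<bullet> h) = normal_law a \<sigma>" for h
    using d[of h] K(2)[of h] real_sqrt_ge_zero by blast
  ultimately show ?thesis
    using mean pr st by (simp add: is_gaussian_def gaussian_measure_iff has_mean_def has_covariance_def)
qed

subsection \<open>The characteristic function determines the measure\<close>

text \<open>Levy's uniqueness theorem is about probability measures, so the weighted marginals are
  normalised by their common mass, which is the transform at \<open>t = 0\<close>. If the mass
  vanishes, \<open>V\<close> is zero almost everywhere and so are both sides.\<close>

lemma marginal_weight_eq: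
  fixes \<mu> \<nu> :: "'h::{real_inner,second_countable_topology} measure"
  assumes [simp]: "prob_space \<mu>" "prob_space \<nu>" and st: "sets \<mu> = sets borel" "sets \<nu> = sets borel"
    and V[measurable]: "V \<in> borel_measurable borel" and Vb: "\<And>x. 0 \<le> V x" "\<And>x. V x \<le> (C::real)"
    and eq: "\<And>t. (CLINT x|\<mu>. V x * iexp (t * (x \<bullet> e))) = (CLINT x|\<nu>. V x * iexp (t * (x \<bullet> e)))"
    and B[measurable]: "B \<in> sets borel"
  shows "(LINT x|\<mu>. V x * indicator B (x \<bullet> e)) = (LINT x|\<nu>. V x * indicator B (x \<bullet> e))"
proof -
  define c where "c = (LINT x|\<mu>. V x)"
  have main: "real_distribution (distr (density \<rho> (\<lambda>x. ennreal (V x / c))) borel (\<lambda>x. x \<bullet> e)) \<and>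
      char (distr (density \<rho> (\<lambda>x. ennreal (V x / c))) borel (\<lambda>x. x \<bullet> e)) t
        = (CLINT x|\<rho>. V x * iexp (t * (x \<bullet> e))) / c \<and>
      measure (distr (density \<rho> (\<lambda>x. ennreal (V x / c))) borel (\<lambda>x. x \<bullet> e)) B
        = (LINT x|\<rho>. V x * indicator B (x \<bullet> e)) / c"
    if pr: "prob_space \<rho>" and s: "sets \<rho> = sets borel" and c: "(LINT x|\<rho>. V x) = c" and cpos: "0 < c" for \<rho> :: "'h measure" and t
  proof -
    interpret prob_space \<rho> by (rule pr)
    note [measurable_cong] = s
    have int: "integrable \<rho> V" by (rule integrable_const_bound[of _ C]) (use Vb in auto)
    let ?D = "density \<rho> (\<lambda>x. ennreal (V x / c))"
    have "emeasure ?D (space ?D) = (\<integral>\<^sup>+x. ennreal (V x / c) \<partial>\<rho>)"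
      by (simp add: emeasure_density cong: nn_integral_cong)
    also have "\<dots> = ennreal (LINT x|\<rho>. V x / c)"
      by (rule nn_integral_eq_integral) (use int Vb cpos in auto)
    also have "\<dots> = 1" using c cpos by simp
    finally have pD: "prob_space ?D" by (rule prob_spaceI)
    have 1: "real_distribution (distr ?D borel (\<lambda>x. x \<bullet> e))"
      by (rule real_distribution_inner(1)[OF pD]) (simp add: s)
    have "char (distr ?D borel (\<lambda>x. x \<bullet> e)) t = (CLINT x|?D. iexp (t * (x \<bullet> e)))"
      unfolding char_def by (subst integral_distr) auto
    also have "\<dots> = (CLINT x|\<rho>. (V x / c) *\<^sub>R iexp (t * (x \<bullet> e)))"
      by (rule integral_density) (use Vb cpos in auto)
    also have "\<dots> = (CLINT x|\<rho>. (V x * iexp (t * (x \<bullet> e))) / c)"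
      by (simp add: scaleR_conv_of_real)
    also have "\<dots> = (CLINT x|\<rho>. V x * iexp (t * (x \<bullet> e))) / c" by (rule integral_divide_zero)
    finally have 2: "char (distr ?D borel (\<lambda>x. x \<bullet> e)) t = (CLINT x|\<rho>. V x * iexp (t * (x \<bullet> e))) / c" .
    interpret R: real_distribution "distr ?D borel (\<lambda>x. x \<bullet> e)" by (rule 1)
    have "measure (distr ?D borel (\<lambda>x. x \<bullet> e)) B = (LINT y|distr ?D borel (\<lambda>x. x \<bullet> e). indicator B y)" by simp
    also have "\<dots> = (LINT x|?D. indicator B (x \<bullet> e))"
      by (subst integral_distr) auto
    also have "\<dots> = (LINT x|\<rho>. (V x / c) *\<^sub>R indicator B (x \<bullet> e))"
      by (rule integral_density) (use Vb cpos in auto)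
    also have "\<dots> = (LINT x|\<rho>. V x * indicator B (x \<bullet> e)) / c" by simp
    finally show ?thesis using 1 2 by blast
  qed
  have cc: "(LINT x|\<rho>. V x * iexp (0 * (x \<bullet> e))) = complex_of_real (LINT x|\<rho>. V x)" for \<rho> :: "'h measure"
    by simp
  have c2: "(LINT x|\<nu>. V x) = c" using eq[of 0] unfolding cc c_def by simp
  have c0: "0 \<le> c" unfolding c_def using Vb by simp
  show ?thesis
  proof (cases "c = 0")
    case True
    have "(LINT x|\<rho>. V x * indicator B (x \<bullet> e)) = 0"
      if pr: "prob_space \<rho>" and s: "sets \<rho> = sets borel" and c: "(LINT x|\<rho>. V x) = 0" for \<rho> :: "'h measure"
    proof -
      interpret prob_space \<rho> by (rule pr)
      note [measurable_cong] = s
      have int: "integrable \<rho> V" by (rule integrable_const_bound[of _ C]) (use Vb in auto)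
      have "AE x in \<rho>. V x = 0" using integral_nonneg_eq_0_iff_AE[OF int] Vb c by simp
      then show ?thesis by (intro integral_eq_zero_AE) auto
    qed
    then show ?thesis using True c2 st by (simp add: c_def)
  next
    case False
    then have cp: "0 < c" using c0 by simp
    note m1 = main[OF assms(1) st(1) c_def[symmetric] cp] and m2 = main[OF assms(2) st(2) c2 cp]
    have "distr (density \<mu> (\<lambda>x. ennreal (V x / c))) borel (\<lambda>x. x \<bullet> e)
        = distr (density \<nu> (\<lambda>x. ennreal (V x / c))) borel (\<lambda>x. x \<bullet> e)"
      by (rule Levy_uniqueness) (use m1 m2 eq in \<open>auto intro!: ext\<close>)
    then show ?thesis using m1 m2 cp by (metis divide_cancel_right less_irrefl)
  qed
qed

text \<open>Moves one more constraint \<open>x \<bullet> e \<in> B\<close> into the weight while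
  keeping equality for all frequencies \<open>h\<close>. The factor
  \<open>iexp (x \<bullet> h)\<close> is not a nonnegative weight as
  \<open>marginal_weight_eq\<close> demands; its real and imaginary parts are therefore replaced by
  \<open>1 + cos\<close> and \<open>1 + sin\<close>.\<close>

lemma weighted_cf_restrict:
  fixes \<mu> \<nu> :: "'h::{real_inner,second_countable_topology} measure"
  assumes pr: "prob_space \<mu>" "prob_space \<nu>" and st: "sets \<mu> = sets borel" "sets \<nu> = sets borel"
    and W[measurable]: "W \<in> borel_measurable borel" and Wb: "\<And>x. 0 \<le> W x" "\<And>x. W x \<le> (1::real)"
    and eq: "\<And>h. (CLINT x|\<mu>. W x * iexp (x \<bullet> h)) = (CLINT x|\<nu>. W x * iexp (x \<bullet> h))"
    and B[measurable]: "B \<in> sets borel"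
  shows "(CLINT x|\<mu>. complex_of_real (W x * indicator B (x \<bullet> e)) * iexp (x \<bullet> h))
    = (CLINT x|\<nu>. complex_of_real (W x * indicator B (x \<bullet> e)) * iexp (x \<bullet> h))"
proof -
  have int: "integrable \<rho> (\<lambda>x. of_real (G x) * iexp (x \<bullet> k))"
    if "prob_space \<rho>" and s: "sets \<rho> = sets borel" and G: "G \<in> borel_measurable borel" "\<And>x. \<bar>G x\<bar> \<le> 1"
    for \<rho> :: "'h measure" and k G
  proof -
    interpret prob_space \<rho> by fact
    note [measurable_cong] = s
    note [measurable] = G(1)
    show ?thesis by (rule integrable_const_bound[of _ 1]) (use G(2) in \<open>auto simp: norm_mult\<close>)
  qed
  have intW: "integrable \<rho> (\<lambda>x. of_real (W x) * iexp (x \<bullet> k))"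
    if "prob_space \<rho>" "sets \<rho> = sets borel" for \<rho> :: "'h measure" and k
    by (rule int[OF that W]) (use Wb in \<open>simp add: abs_of_nonneg\<close>)
  have ex: "iexp (t * (x \<bullet> e)) * iexp (x \<bullet> h) = iexp (x \<bullet> (t *\<^sub>R e + h))"
     "iexp (t * (x \<bullet> e)) * iexp (- (x \<bullet> h)) = iexp (x \<bullet> (t *\<^sub>R e - h))" for x t
    by (simp_all add: inner_add_right inner_diff_right distrib_left right_diff_distrib exp_add exp_diff exp_minus divide_inverse)
  have cs: "complex_of_real (cos r) = (iexp r + iexp (- r)) / 2" "complex_of_real (sin r) = (iexp r - iexp (- r)) / (2 * \<i>)" for r
    by (simp_all add: cos_exp_eq sin_exp_eq cos_of_real sin_of_real)
       (simp_all add: cos_exp_eq sin_exp_eq flip: cos_of_real sin_of_real)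
  have V1: "(CLINT x|\<mu>. W x * iexp (t * (x \<bullet> e))) = (CLINT x|\<nu>. W x * iexp (t * (x \<bullet> e)))" for t
    using eq[of "t *\<^sub>R e"] by simp
  \<comment> \<open>Writing the cosine with exponentials shifts the frequency
    \<open>t *\<^sub>R e\<close> by \<open>h\<close> and by \<open>- h\<close>, so the transform of
    the new weight is a combination of transforms known to agree.\<close>
  have V2': "(CLINT x|\<rho>. complex_of_real (W x * (1 + cos (x \<bullet> h))) * iexp (t * (x \<bullet> e)))
    = (CLINT x|\<rho>. W x * iexp (x \<bullet> (t *\<^sub>R e))) + (CLINT x|\<rho>. W x * iexp (x \<bullet> (t *\<^sub>R e + h))) / 2
      + (CLINT x|\<rho>. W x * iexp (x \<bullet> (t *\<^sub>R e - h))) / 2"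
    if "prob_space \<rho>" "sets \<rho> = sets borel" for \<rho> :: "'h measure" and t
  proof -
    have "complex_of_real (W x * (1 + cos (x \<bullet> h))) * iexp (t * (x \<bullet> e)) =
      (W x * iexp (x \<bullet> (t *\<^sub>R e)) + (W x * iexp (x \<bullet> (t *\<^sub>R e + h))) / 2) + (W x * iexp (x \<bullet> (t *\<^sub>R e - h))) / 2" for x
      unfolding ex[symmetric] of_real_mult of_real_add cs by (simp add: algebra_simps)
    then show ?thesis using intW[OF that]
      by (simp only: Bochner_Integration.integral_add Bochner_Integration.integral_diff Bochner_Integration.integrable_add
          integrable_divide_zero integral_divide_zero simp_thms)
  qed
  have V3': "(CLINT x|\<rho>. complex_of_real (W x * (1 + sin (x \<bullet> h))) * iexp (t * (x \<bullet> e)))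
    = (CLINT x|\<rho>. W x * iexp (x \<bullet> (t *\<^sub>R e))) + (CLINT x|\<rho>. W x * iexp (x \<bullet> (t *\<^sub>R e + h))) / (2 * \<i>)
      - (CLINT x|\<rho>. W x * iexp (x \<bullet> (t *\<^sub>R e - h))) / (2 * \<i>)"
    if "prob_space \<rho>" "sets \<rho> = sets borel" for \<rho> :: "'h measure" and t
  proof -
    have "complex_of_real (W x * (1 + sin (x \<bullet> h))) * iexp (t * (x \<bullet> e)) =
      (W x * iexp (x \<bullet> (t *\<^sub>R e)) + (W x * iexp (x \<bullet> (t *\<^sub>R e + h))) / (2 * \<i>)) - (W x * iexp (x \<bullet> (t *\<^sub>R e - h))) / (2 * \<i>)" for x
      unfolding ex[symmetric] of_real_mult of_real_add cs by (simp add: algebra_simps diff_divide_distrib)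
    then show ?thesis using intW[OF that]
      by (simp only: Bochner_Integration.integral_add Bochner_Integration.integral_diff Bochner_Integration.integrable_add
          integrable_divide_zero integral_divide_zero simp_thms)
  qed
  have bd: "0 \<le> 1 + cos r" "0 \<le> 1 + sin r" "1 + cos r \<le> 2" "1 + sin r \<le> 2" for r :: real
    using cos_ge_minus_one[of r] sin_ge_minus_one[of r] cos_le_one[of r] sin_le_one[of r] by linarith+
  let ?I = "\<lambda>x. indicator B (x \<bullet> e) :: real"
  have E1: "(LINT x|\<mu>. W x * ?I x) = (LINT x|\<nu>. W x * ?I x)"
    by (rule marginal_weight_eq[OF pr st W Wb V1 B])
  have E2: "(LINT x|\<mu>. W x * (1 + cos (x \<bullet> h)) * ?I x) = (LINT x|\<nu>. W x * (1 + cos (x \<bullet> h)) * ?I x)"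
  proof (rule marginal_weight_eq[OF pr st _ _ _ _ B, where C=2])
    show "W x * (1 + cos (x \<bullet> h)) \<le> 2" for x
      using mult_mono[OF Wb(2)[of x] bd(3)[of "x \<bullet> h"]] bd(1)[of "x \<bullet> h"] by simp
    show "(CLINT x|\<mu>. complex_of_real (W x * (1 + cos (x \<bullet> h))) * iexp (t * (x \<bullet> e)))
        = (CLINT x|\<nu>. complex_of_real (W x * (1 + cos (x \<bullet> h))) * iexp (t * (x \<bullet> e)))" for t
      by (simp only: V2'[OF pr(1) st(1)] V2'[OF pr(2) st(2)] eq)
  qed (use bd Wb in auto)
  have E3: "(LINT x|\<mu>. W x * (1 + sin (x \<bullet> h)) * ?I x) = (LINT x|\<nu>. W x * (1 + sin (x \<bullet> h)) * ?I x)"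
  proof (rule marginal_weight_eq[OF pr st _ _ _ _ B, where C=2])
    show "W x * (1 + sin (x \<bullet> h)) \<le> 2" for x
      using mult_mono[OF Wb(2)[of x] bd(4)[of "x \<bullet> h"]] bd(2)[of "x \<bullet> h"] by simp
    show "(CLINT x|\<mu>. complex_of_real (W x * (1 + sin (x \<bullet> h))) * iexp (t * (x \<bullet> e)))
        = (CLINT x|\<nu>. complex_of_real (W x * (1 + sin (x \<bullet> h))) * iexp (t * (x \<bullet> e)))" for t
      by (simp only: V3'[OF pr(1) st(1)] V3'[OF pr(2) st(2)] eq)
  qed (use bd Wb in auto)
  \<comment> \<open>Subtracting the integral with weight \<open>W\<close> alone removes the summand
    1 again.\<close>
  have fin: "(CLINT x|\<rho>. complex_of_real (W x * ?I x) * iexp (x \<bullet> h))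
      = ((LINT x|\<rho>. W x * (1 + cos (x \<bullet> h)) * ?I x) - (LINT x|\<rho>. W x * ?I x))
        + \<i> * ((LINT x|\<rho>. W x * (1 + sin (x \<bullet> h)) * ?I x) - (LINT x|\<rho>. W x * ?I x))"
    if "prob_space \<rho>" and s: "sets \<rho> = sets borel" for \<rho> :: "'h measure"
  proof -
    interpret prob_space \<rho> by fact
    note [measurable_cong] = s
    have WI: "\<bar>W x * ?I x\<bar> \<le> 1" for x using Wb[of x] by (auto simp: indicator_def)
    have i0: "integrable \<rho> (\<lambda>x. W x * ?I x)"
      by (rule integrable_const_bound[of _ 1]) (use WI in auto)
    have ic: "integrable \<rho> (\<lambda>x. (W x * ?I x) * cos (x \<bullet> h))"
      by (rule Bochner_Integration.integrable_bound[OF i0]) (auto simp: abs_mult mult_left_le)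
    have si: "integrable \<rho> (\<lambda>x. (W x * ?I x) * sin (x \<bullet> h))"
      by (rule Bochner_Integration.integrable_bound[OF i0]) (auto simp: abs_mult mult_left_le)
    have "(CLINT x|\<rho>. complex_of_real (W x * ?I x) * iexp (x \<bullet> h))
        = (CLINT x|\<rho>. complex_of_real ((W x * ?I x) * cos (x \<bullet> h)) + \<i> * complex_of_real ((W x * ?I x) * sin (x \<bullet> h)))"
      by (intro Bochner_Integration.integral_cong refl)
        (simp add: exp_Euler cos_of_real sin_of_real algebra_simps)
    also have "\<dots> = complex_of_real (LINT x|\<rho>. (W x * ?I x) * cos (x \<bullet> h)) + \<i> * complex_of_real (LINT x|\<rho>. (W x * ?I x) * sin (x \<bullet> h))"
      using ic si by (simp del: of_real_mult)
    also have "(LINT x|\<rho>. (W x * ?I x) * cos (x \<bullet> h)) = (LINT x|\<rho>. W x * (1 + cos (x \<bullet> h)) * ?I x) - (LINT x|\<rho>. W x * ?I x)"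
      using i0 ic by (simp add: algebra_simps)
    also have "(LINT x|\<rho>. (W x * ?I x) * sin (x \<bullet> h)) = (LINT x|\<rho>. W x * (1 + sin (x \<bullet> h)) * ?I x) - (LINT x|\<rho>. W x * ?I x)"
      using i0 si by (simp add: algebra_simps)
    finally show ?thesis by simp
  qed
  show ?thesis unfolding fin[OF pr(1) st(1)] fin[OF pr(2) st(2)] E1 E2 E3 ..
qed

text \<open>The partial sums of the expansion are measurable for the sigma-algebra of the cylinders
  and converge pointwise to the identity, which is therefore measurable into the Borel sets.\<close>

lemma cylinder_sets_generate:
  fixes e :: "nat \<Rightarrow> 'h::{real_inner,complete_space,second_countable_topology}"
  assumes e: "onb e"
  defines "\<C> \<equiv> {{x. \<forall>i<n. x \<bullet> e i \<in> B i} | n B. \<forall>i. B i \<in> sets (borel :: real measure)}"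
  shows "sets borel = sigma_sets UNIV \<C>" "Int_stable \<C>" "UNIV \<in> \<C>"
proof -
  have sub: "\<C> \<subseteq> sets borel"
  proof
    fix A assume "A \<in> \<C>"
    then obtain n B where A: "A = {x. \<forall>i<n. x \<bullet> e i \<in> B i}" and [measurable]: "\<And>i. B i \<in> sets borel"
      unfolding \<C>_def by blast
    have "{x \<in> space borel. \<forall>i\<in>{..<n}. x \<bullet> e i \<in> B i} \<in> sets borel" by measurable
    then show "A \<in> sets borel" by (simp add: A Ball_def)
  qed
  define N where "N = sigma UNIV \<C>"
  have sN: "sets N = sigma_sets UNIV \<C>" "space N = UNIV" by (simp_all add: N_def)
  have co[measurable]: "(\<lambda>x. x \<bullet> e i) \<in> borel_measurable N" for i
  proof (rule measurableI)
    fix A :: "real set" assume A: "A \<in> sets borel"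
    have "(\<lambda>x. x \<bullet> e i) -` A = {x. \<forall>j<Suc i. x \<bullet> e j \<in> (if j = i then A else UNIV)}" by auto
    also have "\<dots> \<in> \<C>" unfolding \<C>_def using A
      by (intro CollectI exI[of _ "Suc i"] exI[of _ "\<lambda>j. if j = i then A else UNIV"] conjI refl) auto
    finally show "(\<lambda>x. x \<bullet> e i) -` A \<inter> space N \<in> sets N" by (simp add: sN)
  qed (simp add: sN)
  have "(\<lambda>x. x) \<in> borel_measurable N"
  proof (rule borel_measurable_LIMSEQ_metric)
    show "(\<lambda>x. \<Sum>i<n. (x \<bullet> e i) *\<^sub>R e i) \<in> borel_measurable N" for n by measurable
    show "(\<lambda>n. \<Sum>i<n. (x \<bullet> e i) *\<^sub>R e i) \<longlonglongrightarrow> x" for x using onb_sums[OF e] by (simp add: sums_def)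
  qed
  then have "A \<in> sets N" if "A \<in> sets borel" for A
    using measurable_sets[OF _ that, of "\<lambda>x. x" N] by (simp add: sN)
  moreover have "sigma_sets UNIV \<C> \<subseteq> sets borel" using sets.sigma_sets_subset[OF sub] by simp
  ultimately show "sets borel = sigma_sets UNIV \<C>" using sN by blast
  show "Int_stable \<C>"
  proof (rule Int_stableI)
    fix A A' assume "A \<in> \<C>" "A' \<in> \<C>"
    then obtain n B n' B' where A: "A = {x. \<forall>i<n. x \<bullet> e i \<in> B i}" "A' = {x. \<forall>i<n'. x \<bullet> e i \<in> B' i}"
      and B: "\<forall>i. B i \<in> sets borel" "\<forall>i. B' i \<in> sets borel"
      unfolding \<C>_def by blast
    have "A \<inter> A' = {x. \<forall>i<max n n'. x \<bullet> e i \<in> (if i < n then B i else UNIV) \<inter> (if i < n' then B' i else UNIV)}"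
    proof -
      have m: "y \<in> (if b then S else UNIV) \<longleftrightarrow> (b \<longrightarrow> y \<in> S)" for y b and S :: "real set" by simp
      show ?thesis unfolding A set_eq_iff Int_iff mem_Collect_eq m less_max_iff_disj by blast
    qed
    moreover have "\<forall>i. (if i < n then B i else UNIV) \<inter> (if i < n' then B' i else UNIV) \<in> sets borel"
      using B by auto
    ultimately show "A \<inter> A' \<in> \<C>" unfolding \<C>_def
      by (intro CollectI exI[of _ "max n n'"] exI[of _ "\<lambda>i. (if i < n then B i else UNIV) \<inter> (if i < n' then B' i else UNIV)"] conjI)
  qed
  show "UNIV \<in> \<C>" unfolding \<C>_def by (intro CollectI exI[of _ 0] exI[of _ "\<lambda>_. {}"]) auto
qed

text \<open>Instead of inverting an n-dimensional transform, the constraints of a cylinder are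
  inserted one coordinate at a time, with \<open>h\<close> arbitrary in the induction. At
  \<open>h = 0\<close> the measure of the cylinder appears.\<close>

theorem cf_determines_measure:
  fixes \<mu> \<nu> :: "'h::{real_inner,complete_space,second_countable_topology} measure"
  assumes pr: "prob_space \<mu>" "prob_space \<nu>" and st: "sets \<mu> = sets borel" "sets \<nu> = sets borel"
    and eq: "\<And>h. cf \<mu> h = cf \<nu> h"
  shows "\<mu> = \<nu>"
proof -
  interpret M: prob_space \<mu> by (rule pr)
  interpret N: prob_space \<nu> by (rule pr)
  obtain e :: "nat \<Rightarrow> 'h" where e: "onb e" using exists_onb by metis
  let ?C = "{{x. \<forall>i<n. x \<bullet> e i \<in> B i} | n B. \<forall>i. B i \<in> sets (borel :: real measure)}"
  note gen = cylinder_sets_generate[OF e]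
  have cyl: "(CLINT x|\<mu>. indicator {x. \<forall>i<n. x \<bullet> e i \<in> B i} x * iexp (x \<bullet> h))
      = (CLINT x|\<nu>. indicator {x. \<forall>i<n. x \<bullet> e i \<in> B i} x * iexp (x \<bullet> h))"
    if B[measurable]: "\<And>i. B i \<in> sets (borel :: real measure)" for n h and B :: "nat \<Rightarrow> real set"
  proof (induction n arbitrary: h)
    case 0
    then show ?case using eq[of h] by (simp add: cf_def)
  next
    case (Suc n)
    let ?W = "indicator {x. \<forall>i<n. x \<bullet> e i \<in> B i} :: 'h \<Rightarrow> real"
    have c: "indicator {x. \<forall>i<Suc n. x \<bullet> e i \<in> B i} x = complex_of_real (?W x * indicator (B n) (x \<bullet> e n))" for x
      by (auto simp: indicator_def less_Suc_eq)
    have "{x. \<forall>i<n. x \<bullet> e i \<in> B i} \<in> sets borel"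
      unfolding gen(1) by (rule sigma_sets.Basic) (use B in blast)
    then have W: "?W \<in> borel_measurable borel" by simp
    have "(CLINT x|\<mu>. ?W x * iexp (x \<bullet> h)) = (CLINT x|\<nu>. ?W x * iexp (x \<bullet> h))" for h
      using Suc[of h] by (simp add: of_real_indicator)
    from weighted_cf_restrict[OF pr st W _ _ this B[of n], of "e n" h]
    show ?case unfolding c by simp
  qed
  show ?thesis
  proof (rule measure_eqI_generator_eq[OF gen(2), where A="\<lambda>_. UNIV" and \<Omega>=UNIV])
    show "\<And>X. X \<in> ?C \<Longrightarrow> emeasure \<mu> X = emeasure \<nu> X"
    proof -
      fix X assume X: "X \<in> ?C"
      then obtain n B where XB: "X = {x. \<forall>i<n. x \<bullet> e i \<in> B i}" and B: "\<And>i. B i \<in> sets borel" by blast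
      have Xb: "X \<in> sets borel" unfolding gen(1) by (rule sigma_sets.Basic) (rule X)
      have 1: "complex_of_real (measure \<mu> X) = (CLINT x|\<mu>. of_real (indicator X x))"
        using Xb st(1) by (subst integral_complex_of_real) (simp add: sets_eq_imp_space_eq[OF st(1)])
      have 2: "complex_of_real (measure \<nu> X) = (CLINT x|\<nu>. of_real (indicator X x))"
        using Xb st(2) by (subst integral_complex_of_real) (simp add: sets_eq_imp_space_eq[OF st(2)])
      have "(CLINT x|\<mu>. complex_of_real (indicator X x)) = (CLINT x|\<nu>. of_real (indicator X x))"
        using cyl[of B n 0, OF B] by (simp add: XB of_real_indicator)
      then have "measure \<mu> X = measure \<nu> X" using 1 2 by simp
      then show "emeasure \<mu> X = emeasure \<nu> X" by (simp add: M.emeasure_eq_measure N.emeasure_eq_measure)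
    qed
    show "range (\<lambda>_::nat. UNIV) \<subseteq> ?C" using gen(3) by auto
    show "sets \<mu> = sigma_sets UNIV ?C" "sets \<nu> = sigma_sets UNIV ?C" using gen(1) st by simp_all
  qed auto
qed

text \<open>Evaluates the definite description in \<open>gaussian\<close>: the characteristic
  function leaves no second candidate.\<close>

lemma gaussian_eqI:
  assumes "is_gaussian \<nu> m K"
  shows "gaussian m K = (\<nu> :: 'h::{real_inner,complete_space,second_countable_topology} measure)"
  unfolding gaussian_def
proof (rule the_equality[where P="\<lambda>\<nu>. is_gaussian \<nu> m K", OF assms])
  fix \<nu>' assume "is_gaussian \<nu>' m K"
  then show "\<nu>' = \<nu>" using assms
    by (intro cf_determines_measure) (auto simp: is_gaussian_cf is_gaussian_def gaussian_measure_def)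
qed

section \<open>Powers of the covariance operator\<close>

lemma form_cauchy_schwarz:
  fixes P :: "'h::real_inner \<Rightarrow>\<^sub>L 'h"
  assumes "self_adjoint P" "strictly_positive P"
  shows "(x \<bullet> P y)\<^sup>2 \<le> (x \<bullet> P x) * (y \<bullet> P y)"
proof (cases "y = 0")
  case False
  define b c where "b = x \<bullet> P y" and "c = y \<bullet> P y"
  have c: "0 < c" using assms(2) False by (simp add: strictly_positive_def c_def)
  have yx: "y \<bullet> P x = b" using assms(1) by (metis b_def inner_commute self_adjoint_def)
  have psd: "0 \<le> z \<bullet> P z" for z
    using assms(2) by (cases "z = 0") (auto simp: strictly_positive_def less_imp_le)
  \<comment> \<open>The coefficient \<open>b / c\<close> minimises the form along the line through
    \<open>x\<close> in direction \<open>y\<close>.\<close>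
  have "0 \<le> (x - (b / c) *\<^sub>R y) \<bullet> P (x - (b / c) *\<^sub>R y)" by (rule psd)
  also have "\<dots> = x \<bullet> P x - (b / c) * b - (b / c) * b + (b / c) * ((b / c) * c)"
    by (simp add: blinfun.diff_right blinfun.scaleR_right inner_diff_left inner_diff_right yx
        algebra_simps flip: b_def c_def)
  also have "\<dots> = x \<bullet> P x - b\<^sup>2 / c" using c by (simp add: power2_eq_square)
  finally have "b\<^sup>2 / c \<le> x \<bullet> P x" by simp
  then show ?thesis using c by (simp add: divide_simps mult.commute flip: b_def c_def)
qed simp

text \<open>Makes \<open>spectral_theorem\<close> applicable to \<open>C\<close>. Cauchy-Schwarz for
  the form of \<open>C\<close>, applied to \<open>x\<close> and \<open>C x\<close>, bounds
  \<open>(norm (C x))\<^sup>2\<close> by a multiple of \<open>x \<bullet> C x\<close>, and the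
  latter is summable over a basis.\<close>

lemma covariance_operator_hilbert_schmidt:
  assumes "covariance_operator C" shows "hilbert_schmidt (blinfun_apply C)"
proof -
  have sa: "self_adjoint C" and sp: "strictly_positive C" and tc: "trace_class_nonneg C"
    using assms by (auto simp: covariance_operator_def)
  have le: "(norm (C x))\<^sup>2 \<le> norm C * (x \<bullet> C x)" for x
  proof (cases "C x = 0")
    case True
    then show ?thesis by simp
  next
    case False
    define q where "q = (norm (C x))\<^sup>2"
    have q: "0 < q" using False by (simp add: q_def)
    have "(x \<bullet> C (C x))\<^sup>2 \<le> (x \<bullet> C x) * (C x \<bullet> C (C x))" by (rule form_cauchy_schwarz[OF sa sp])
    moreover have "x \<bullet> C (C x) = q" using sa by (simp add: q_def power2_norm_eq_inner self_adjoint_def)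
    moreover have "C x \<bullet> C (C x) \<le> norm C * q"
    proof -
      have "C x \<bullet> C (C x) \<le> norm (C x) * norm (C (C x))" by (rule norm_cauchy_schwarz)
      also have "\<dots> \<le> norm (C x) * (norm C * norm (C x))" by (intro mult_left_mono norm_blinfun) simp
      finally show ?thesis by (simp add: q_def power2_eq_square mult_ac)
    qed
    moreover have "0 \<le> x \<bullet> C x" using sp by (cases "x = 0") (auto simp: strictly_positive_def less_imp_le)
    ultimately have "q\<^sup>2 \<le> (x \<bullet> C x) * (norm C * q)" by (meson mult_left_mono order_trans)
    then have "q * q \<le> (norm C * (x \<bullet> C x)) * q" by (simp add: power2_eq_square mult_ac)
    then show ?thesis using q mult_le_cancel_right_pos[OF q] unfolding q_def[symmetric] by blast
  qed
  have "(\<lambda>e. (norm (C e))\<^sup>2) summable_on E" if "orthonormal_basis E" for E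
  proof (rule summable_on_comparison_test)
    show "(\<lambda>e. norm C * (e \<bullet> C e)) summable_on E"
      using tc that by (intro summable_on_cmult_right) (simp add: trace_class_nonneg_def)
  qed (use le in auto)
  then show ?thesis by (simp add: hilbert_schmidt_def blinfun.bounded_linear_right)
qed

text \<open>\<open>l_eq\<close> fixes the value 0 at zero vectors of \<open>e\<close>, about which
  \<open>eigen\<close> says nothing.\<close>

locale covariance_spectrum =
  fixes C :: "'h::{real_inner,complete_space,second_countable_topology} \<Rightarrow>\<^sub>L 'h" and e :: "nat \<Rightarrow> 'h" and l :: "nat \<Rightarrow> real"
  assumes cov: "covariance_operator C" and onb: "onb e"
    and eigen: "\<And>i. C (e i) = l i *\<^sub>R e i" and l_eq: "\<And>i. l i = e i \<bullet> C (e i)" and l_summable: "summable l"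

lemma covariance_spectrum_exists:
  assumes "covariance_operator C"
  obtains e l where "covariance_spectrum C e l"
proof -
  have sa: "self_adjoint C" and tc: "trace_class_nonneg C"
    using assms by (auto simp: covariance_operator_def)
  obtain e E l where *: "onb e" "orthonormal_basis E" "e = set_to_seq E" "countable E"
    "\<And>i. C (e i) = l i *\<^sub>R e i" "\<And>i. l i = e i \<bullet> C (e i)"
    using spectral_theorem[OF sa covariance_operator_hilbert_schmidt[OF assms]] by metis
  have "(\<lambda>e. e \<bullet> C e) summable_on E" using tc *(2) by (simp add: trace_class_nonneg_def)
  then have "summable (\<lambda>i. e i \<bullet> C (e i))"
    unfolding *(3) by (rule summable_on_set_to_seq[OF *(4)]) simp
  then have "summable l" unfolding *(6)[symmetric] .
  then have "covariance_spectrum C e l" using * assms unfolding covariance_spectrum_def by blast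
  then show thesis by (rule that)
qed

section \<open>Functional calculus of the covariance operator\<close>

context covariance_spectrum
begin

lemma C_self_adjoint: "C x \<bullet> y = x \<bullet> C y"
  using cov by (simp add: covariance_operator_def self_adjoint_def)

lemma l_pos: "e i \<noteq> 0 \<Longrightarrow> 0 < l i"
  using cov unfolding l_eq by (auto simp: covariance_operator_def strictly_positive_def)

lemma l_nonneg: "0 \<le> l i"
  using l_pos[of i] l_eq[of i] by (cases "e i = 0") auto

lemma C_coord: "C x \<bullet> e i = l i * (x \<bullet> e i)"
  by (simp add: C_self_adjoint eigen)

lemma l_powr_bounded:
  assumes "0 \<le> r" obtains B where "\<And>i. \<bar>l i powr r\<bar> \<le> B" "0 \<le> B"
proof -
  have "Bseq l" using l_summable by (intro convergent_imp_Bseq convergentI[OF summable_LIMSEQ_zero])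
  then obtain B where B: "\<And>i. norm (l i) \<le> B" unfolding Bseq_def by blast
  have "\<bar>l i powr r\<bar> \<le> B powr r" for i using B[of i] assms l_nonneg[of i] by (auto intro: powr_mono2)
  moreover have "0 \<le> B powr r" by simp
  ultimately show thesis by (rule that)
qed

text \<open>The diagonal operator qualifies because an eigenvector for \<open>k\<close> has nonzero
  coordinates only where \<open>l i = k\<close>; it is the only candidate because the
  \<open>e i\<close> are eigenvectors and total.\<close>

lemma op_powr_eq:
  assumes r: "0 \<le> r" shows "op_powr C r = diag_op e (\<lambda>i. l i powr r)"
proof -
  obtain B where B: "\<And>i. \<bar>l i powr r\<bar> \<le> B" using l_powr_bounded[OF r] by blast
  note d = diag_op_apply[OF onb, of "\<lambda>i. l i powr r", OF B]
  show ?thesis unfolding op_powr_def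
  proof (rule the_equality)
    show "\<forall>k v. C v = k *\<^sub>R v \<longrightarrow> diag_op e (\<lambda>i. l i powr r) v = (k powr r) *\<^sub>R v"
    proof (intro allI impI)
      fix k v assume v: "C v = k *\<^sub>R v"
      show "diag_op e (\<lambda>i. l i powr r) v = (k powr r) *\<^sub>R v"
      proof (rule onb_eqI[OF onb])
        fix i
        have "C v \<bullet> e i = k * (v \<bullet> e i)" by (simp add: v)
        then have "l i * (v \<bullet> e i) = k * (v \<bullet> e i)" unfolding C_coord .
        then have "v \<bullet> e i = 0 \<or> k = l i" unfolding mult_cancel_right by metis
        then have "(l i powr r) * (v \<bullet> e i) = (k powr r) * (v \<bullet> e i)" by auto
        then show "diag_op e (\<lambda>i. l i powr r) v \<bullet> e i = ((k powr r) *\<^sub>R v) \<bullet> e i"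
          by (simp add: d(2))
      qed
    qed
  next
    fix T :: "'h \<Rightarrow>\<^sub>L 'h"
    assume T: "\<forall>k v. C v = k *\<^sub>R v \<longrightarrow> T v = (k powr r) *\<^sub>R v"
    have "T x = diag_op e (\<lambda>i. l i powr r) x" for x
    proof -
      have "(\<lambda>i. T ((x \<bullet> e i) *\<^sub>R e i)) sums T x"
        by (rule bounded_linear.sums[OF blinfun.bounded_linear_right onb_sums[OF onb]])
      moreover have "T ((x \<bullet> e i) *\<^sub>R e i) = (l i powr r * (x \<bullet> e i)) *\<^sub>R e i" for i
        using T[rule_format, OF eigen[of i]] by (simp add: blinfun.scaleR_right mult.commute)
      ultimately show ?thesis unfolding d(1) by (simp add: sums_iff)
    qed
    then show "T = diag_op e (\<lambda>i. l i powr r)" by (rule blinfun_eqI)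
  qed
qed

lemma op_powr_coord:
  assumes r: "0 \<le> r" shows "op_powr C r x \<bullet> e i = l i powr r * (x \<bullet> e i)"
proof -
  obtain B where B: "\<And>i. \<bar>l i powr r\<bar> \<le> B" using l_powr_bounded[OF r] by blast
  show ?thesis unfolding op_powr_eq[OF r] by (rule diag_op_apply(2)[OF onb, of "\<lambda>i. l i powr r", OF B])
qed

lemma op_powr_add:
  assumes "0 \<le> r" "0 \<le> s" shows "op_powr C (r + s) x = op_powr C r (op_powr C s x)"
  by (rule onb_eqI[OF onb]) (simp add: op_powr_coord assms powr_add)

lemma op_powr_one: "op_powr C 1 x = C x"
  by (rule onb_eqI[OF onb]) (simp add: op_powr_coord C_coord l_nonneg)

lemma op_powr_self_adjoint:
  assumes r: "0 \<le> r" shows "op_powr C r x \<bullet> y = x \<bullet> op_powr C r y"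
proof -
  have "(\<lambda>i. (op_powr C r x \<bullet> e i) * (y \<bullet> e i)) = (\<lambda>i. (x \<bullet> e i) * (op_powr C r y \<bullet> e i))"
    by (simp add: op_powr_coord r mult_ac)
  then show ?thesis
    using onb_inner_sums[OF onb, of "op_powr C r x" y] onb_inner_sums[OF onb, of x "op_powr C r y"]
    by (metis sums_unique2)
qed

lemma inj_op_powr:
  assumes r: "0 \<le> r" shows "inj (blinfun_apply (op_powr C r))"
proof (rule injI)
  fix x y assume eq: "op_powr C r x = op_powr C r y"
  show "x = y"
  proof (rule onb_eqI[OF onb])
    fix i
    have "l i powr r * (x \<bullet> e i) = l i powr r * (y \<bullet> e i)" using eq by (metis op_powr_coord r)
    then show "x \<bullet> e i = y \<bullet> e i" using l_pos[of i] by (cases "e i = 0") auto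
  qed
qed

lemma op_neg_powr_op_powr: "0 \<le> r \<Longrightarrow> op_neg_powr C r (op_powr C r x) = x"
  unfolding op_neg_powr_def by (rule inv_f_f[OF inj_op_powr])

abbreviation half :: "'h \<Rightarrow> 'h" where "half \<equiv> blinfun_apply (op_powr C (1/2))"

lemma half_self_adjoint: "half x \<bullet> y = x \<bullet> half y"
  by (rule op_powr_self_adjoint) simp

lemma half_half: "half (half x) = C x"
  using op_powr_add[of "1/2" "1/2" x] op_powr_one by simp

lemma half_eq_iff: "half x = half y \<longleftrightarrow> x = y"
  using inj_op_powr[of "1/2"] by (auto dest: injD)

lemma half_eq_0_iff: "half x = 0 \<longleftrightarrow> x = 0"
  using half_eq_iff[of x 0] by simp

lemma half_orthogonal_imp_0:
  assumes "\<And>u. half u \<bullet> k = 0" shows "k = 0"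
  using assms[of "half k"] unfolding half_half
  using cov by (auto simp: covariance_operator_def strictly_positive_def inner_commute dest!: spec[of _ k])

text \<open>Every \<open>e i\<close> lies in the range, hence so do the partial sums of the
  expansion of \<open>y\<close>.\<close>

lemma half_range_dense: "\<exists>w. (\<lambda>n. half (w n)) \<longlonglongrightarrow> y"
proof -
  have "half ((1 / l i powr (1/2)) *\<^sub>R e i) = e i" for i
  proof (cases "e i = 0")
    case False
    then have "l i powr (1/2) \<noteq> 0" using l_pos[of i] by simp
    moreover have "half (e i) = l i powr (1/2) *\<^sub>R e i"
    proof (rule onb_eqI[OF onb])
      fix k
      show "half (e i) \<bullet> e k = (l i powr (1/2) *\<^sub>R e i) \<bullet> e k"
        using onb_orthosys[OF onb] by (cases "k = i") (simp_all add: op_powr_coord orthosys_def)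
    qed
    ultimately show ?thesis by (simp add: blinfun.scaleR_right)
  qed simp
  then have "half (\<Sum>i<n. (y \<bullet> e i) *\<^sub>R ((1 / l i powr (1/2)) *\<^sub>R e i)) = (\<Sum>i<n. (y \<bullet> e i) *\<^sub>R e i)" for n
    by (simp only: blinfun.sum_right blinfun.scaleR_right)
  then have "(\<lambda>n. half (\<Sum>i<n. (y \<bullet> e i) *\<^sub>R ((1 / l i powr (1/2)) *\<^sub>R e i))) \<longlonglongrightarrow> y"
    using onb_sums[OF onb, of y] by (simp add: sums_def)
  then show ?thesis by (rule exI[of _ "\<lambda>n. \<Sum>i<n. (y \<bullet> e i) *\<^sub>R ((1 / l i powr (1/2)) *\<^sub>R e i)"])
qed

section \<open>Norms and bounded operators on the scale of spaces\<close>

lemma Hs_norm_op_powr: "0 \<le> s \<Longrightarrow> Hs_norm C s (op_powr C (s / 2) x) = norm x"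
  by (simp add: Hs_norm_def Hs_inner_def op_neg_powr_op_powr norm_eq_sqrt_inner)

lemma Hs_1: "Hs C 1 = range half"
  by (simp add: Hs_def)

lemma half_in_Hs_1: "half x \<in> Hs C 1"
  by (simp add: Hs_1)

text \<open>The embedding of H^1 into H^s: C^(1/2) splits as C^(s/2) times the bounded operator
  C^((1-s)/2).\<close>

lemma half_in_Hs:
  assumes "0 \<le> s" "s \<le> 1"
  shows "half x \<in> Hs C s" "Hs_norm C s (half x) \<le> norm (op_powr C ((1 - s) / 2)) * norm x"
proof -
  have eq: "half x = op_powr C (s / 2) (op_powr C ((1 - s) / 2) x)"
    using op_powr_add[of "s / 2" "(1 - s) / 2" x] assms by (simp add: field_simps)
  show "half x \<in> Hs C s" unfolding eq by (simp add: Hs_def)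
  show "Hs_norm C s (half x) \<le> norm (op_powr C ((1 - s) / 2)) * norm x"
    unfolding eq using assms by (simp add: Hs_norm_op_powr norm_blinfun)
qed

lemma Hs_scale:
  assumes "0 \<le> s" "u \<in> Hs C s"
  shows "a *\<^sub>R u \<in> Hs C s" "Hs_norm C s (a *\<^sub>R u) = \<bar>a\<bar> * Hs_norm C s u"
proof -
  obtain x where x: "u = op_powr C (s / 2) x" using assms(2) by (auto simp: Hs_def)
  have eq: "a *\<^sub>R u = op_powr C (s / 2) (a *\<^sub>R x)" by (simp add: x blinfun.scaleR_right)
  show "a *\<^sub>R u \<in> Hs C s" unfolding eq by (simp add: Hs_def)
  show "Hs_norm C s (a *\<^sub>R u) = \<bar>a\<bar> * Hs_norm C s u"
    unfolding eq using assms(1) by (simp add: x Hs_norm_op_powr)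
qed

lemma Hs_norm_nonneg: "0 \<le> s \<Longrightarrow> u \<in> Hs C s \<Longrightarrow> 0 \<le> Hs_norm C s u"
  by (auto simp: Hs_def Hs_norm_op_powr)

lemma zero_in_Hs: "0 \<in> Hs C s"
  unfolding Hs_def by (rule range_eqI[of _ _ 0]) simp

text \<open>A real supremum says something only for a set that is bounded above, so membership in
  \<open>Hs_dual\<close> is first used for boundedness and then, by scaling, for the
  estimate.\<close>

lemma Hs_dual_norm_bound:
  assumes s: "0 \<le> s" and f: "f \<in> Hs_dual C s" and u: "u \<in> Hs C s"
  shows "\<bar>f u\<bar> \<le> Hs_dual_norm C s f * Hs_norm C s u"
proof -
  obtain K where K: "\<And>u. u \<in> Hs C s \<Longrightarrow> \<bar>f u\<bar> \<le> K * Hs_norm C s u" using f unfolding Hs_dual_def by blast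
  have sc: "f (a *\<^sub>R u) = a * f u" for a using f u by (auto simp: Hs_dual_def)
  have bdd: "bdd_above ((\<lambda>u. \<bar>f u\<bar>) ` {u \<in> Hs C s. Hs_norm C s u \<le> 1})"
  proof (rule bdd_aboveI2[where M="\<bar>K\<bar>"])
    fix v assume v: "v \<in> {u \<in> Hs C s. Hs_norm C s u \<le> 1}"
    then have "\<bar>f v\<bar> \<le> K * Hs_norm C s v" using K by simp
    also have "\<dots> \<le> \<bar>K\<bar> * Hs_norm C s v" using Hs_norm_nonneg[OF s] v by (intro mult_right_mono) auto
    also have "\<dots> \<le> \<bar>K\<bar> * 1" using v by (intro mult_left_mono) auto
    finally show "\<bar>f v\<bar> \<le> \<bar>K\<bar>" by simp
  qed
  show ?thesis
  proof (cases "Hs_norm C s u = 0")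
    case True
    then show ?thesis using K[OF u] by simp
  next
    case False
    then have p: "0 < Hs_norm C s u" using Hs_norm_nonneg[OF s u] by simp
    have "\<bar>f ((1 / Hs_norm C s u) *\<^sub>R u)\<bar> \<le> Hs_dual_norm C s f" unfolding Hs_dual_norm_def
      by (rule cSUP_upper[OF _ bdd]) (use Hs_scale[OF s u, of "1 / Hs_norm C s u"] p in auto)
    then show ?thesis using p by (simp add: sc abs_mult field_simps)
  qed
qed

lemma bounded_ops_bilinear_bound:
  assumes s: "0 \<le> s" and G: "\<Gamma> \<in> bounded_ops C s"
  obtains K where "\<And>u v. u \<in> Hs C s \<Longrightarrow> v \<in> Hs C s \<Longrightarrow> \<bar>\<Gamma> v u\<bar> \<le> K * Hs_norm C s v * Hs_norm C s u"
proof -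
  obtain K where K: "\<And>v. v \<in> Hs C s \<Longrightarrow> Hs_dual_norm C s (\<Gamma> v) \<le> K * Hs_norm C s v"
    and d: "\<And>v. v \<in> Hs C s \<Longrightarrow> \<Gamma> v \<in> Hs_dual C s"
    using G unfolding bounded_ops_def by blast
  have "\<bar>\<Gamma> v u\<bar> \<le> K * Hs_norm C s v * Hs_norm C s u" if "u \<in> Hs C s" "v \<in> Hs C s" for u v
    using Hs_dual_norm_bound[OF s d[OF that(2)] that(1)] mult_right_mono[OF K[OF that(2)] Hs_norm_nonneg[OF s that(1)]]
    by linarith
  then show thesis using that by blast
qed

text \<open>Stated for functions with a bilinear bound and homogeneity, because it is applied to a
  pointwise difference of two operators. \<open>K\<close> serves to make both nested suprema finite
  and disappears from the conclusion.\<close>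

lemma bounded_ops_norm_bound:
  assumes s: "0 \<le> s" and D: "\<And>u v. u \<in> Hs C s \<Longrightarrow> v \<in> Hs C s \<Longrightarrow> \<bar>D v u\<bar> \<le> K * Hs_norm C s v * Hs_norm C s u"
    and sc: "\<And>a u v. u \<in> Hs C s \<Longrightarrow> v \<in> Hs C s \<Longrightarrow> D v (a *\<^sub>R u) = a * D v u"
      "\<And>a u v. u \<in> Hs C s \<Longrightarrow> v \<in> Hs C s \<Longrightarrow> D (a *\<^sub>R v) u = a * D v u"
    and u: "u \<in> Hs C s" and v: "v \<in> Hs C s"
  shows "\<bar>D v u\<bar> \<le> bounded_ops_norm C s D * Hs_norm C s v * Hs_norm C s u"
proof -
  let ?B = "{u \<in> Hs C s. Hs_norm C s u \<le> 1}"
  have le: "\<bar>D v u\<bar> \<le> \<bar>K\<bar>" if "u \<in> ?B" "v \<in> ?B" for u v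
  proof -
    have 1: "0 \<le> Hs_norm C s u" "0 \<le> Hs_norm C s v" using that Hs_norm_nonneg[OF s] by auto
    have "\<bar>D v u\<bar> \<le> K * Hs_norm C s v * Hs_norm C s u" using D that by auto
    also have "\<dots> \<le> \<bar>K\<bar> * (Hs_norm C s v * Hs_norm C s u)" using 1
      by (metis abs_ge_self mult.assoc mult_nonneg_nonneg mult_right_mono)
    also have "\<dots> \<le> \<bar>K\<bar> * (1 * 1)" using 1 that by (intro mult_left_mono mult_mono) auto
    finally show ?thesis by simp
  qed
  have z: "0 \<in> ?B" using zero_in_Hs Hs_norm_op_powr[OF s, of 0] by simp
  have bdd1: "bdd_above ((\<lambda>u. \<bar>D v u\<bar>) ` ?B)" if "v \<in> ?B" for v
    using le that by (intro bdd_aboveI2[where M="\<bar>K\<bar>"]) auto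
  have bdd2: "bdd_above ((\<lambda>v. Hs_dual_norm C s (D v)) ` ?B)"
  proof (rule bdd_aboveI2[where M="\<bar>K\<bar>"])
    fix v assume v: "v \<in> ?B"
    show "Hs_dual_norm C s (D v) \<le> \<bar>K\<bar>" unfolding Hs_dual_norm_def
      by (rule cSUP_least) (use z le v in blast)+
  qed
  have unit: "\<bar>D v u\<bar> \<le> bounded_ops_norm C s D" if "u \<in> ?B" "v \<in> ?B" for u v
  proof -
    have "\<bar>D v u\<bar> \<le> Hs_dual_norm C s (D v)" unfolding Hs_dual_norm_def
      by (rule cSUP_upper[OF that(1) bdd1[OF that(2)]])
    also have "\<dots> \<le> bounded_ops_norm C s D" unfolding bounded_ops_norm_def
      by (rule cSUP_upper[OF that(2) bdd2])
    finally show ?thesis .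
  qed
  show ?thesis
  proof (cases "Hs_norm C s u = 0 \<or> Hs_norm C s v = 0")
    case True
    then show ?thesis using D[OF u v] by auto
  next
    case False
    then have p: "0 < Hs_norm C s u" "0 < Hs_norm C s v" using Hs_norm_nonneg[OF s] u v by (simp_all add: less_le)
    let ?u = "(1 / Hs_norm C s u) *\<^sub>R u" and ?v = "(1 / Hs_norm C s v) *\<^sub>R v"
    have 1: "?u \<in> ?B" "?v \<in> ?B"
      using Hs_scale[OF s u, of "1 / Hs_norm C s u"] Hs_scale[OF s v, of "1 / Hs_norm C s v"] p by auto
    have "\<bar>D ?v ?u\<bar> = \<bar>D v u\<bar> / (Hs_norm C s v * Hs_norm C s u)"
      using sc(2)[of ?u v] sc(1)[OF u v] 1 v p by (simp add: abs_mult)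
    then have "\<bar>D v u\<bar> / (Hs_norm C s v * Hs_norm C s u) \<le> bounded_ops_norm C s D" using unit[OF 1] by simp
    then show ?thesis using p by (simp add: divide_le_eq mult.assoc)
  qed
qed

lemma bounded_ops_scale:
  assumes "\<Gamma> \<in> bounded_ops C s" "u \<in> Hs C s" "v \<in> Hs C s"
  shows "\<Gamma> v (a *\<^sub>R u) = a * \<Gamma> v u" "\<Gamma> (a *\<^sub>R v) u = a * \<Gamma> v u"
  using assms unfolding bounded_ops_def Hs_dual_def by blast+

lemma bounded_ops_diff_bound:
  assumes s: "0 \<le> s" and G: "\<Gamma> \<in> bounded_ops C s" "L \<in> bounded_ops C s"
    and u: "u \<in> Hs C s" and v: "v \<in> Hs C s"
  shows "\<bar>\<Gamma> v u - L v u\<bar> \<le> bounded_ops_norm C s (\<lambda>v u. \<Gamma> v u - L v u) * Hs_norm C s v * Hs_norm C s u"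
proof -
  obtain K1 where K1: "\<And>u v. u \<in> Hs C s \<Longrightarrow> v \<in> Hs C s \<Longrightarrow> \<bar>\<Gamma> v u\<bar> \<le> K1 * Hs_norm C s v * Hs_norm C s u"
    using bounded_ops_bilinear_bound[OF s G(1)] by blast
  obtain K2 where K2: "\<And>u v. u \<in> Hs C s \<Longrightarrow> v \<in> Hs C s \<Longrightarrow> \<bar>L v u\<bar> \<le> K2 * Hs_norm C s v * Hs_norm C s u"
    using bounded_ops_bilinear_bound[OF s G(2)] by blast
  show ?thesis
  proof (rule bounded_ops_norm_bound[OF s _ _ _ u v, where K="K1 + K2"])
    fix u v assume uv: "u \<in> Hs C s" "v \<in> Hs C s"
    show "\<bar>\<Gamma> v u - L v u\<bar> \<le> (K1 + K2) * Hs_norm C s v * Hs_norm C s u"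
      using K1[OF uv] K2[OF uv] by (simp add: distrib_right)
    show "\<Gamma> v (a *\<^sub>R u) - L v (a *\<^sub>R u) = a * (\<Gamma> v u - L v u)" for a
      by (simp add: bounded_ops_scale[OF G(1) uv] bounded_ops_scale[OF G(2) uv] right_diff_distrib)
    show "\<Gamma> (a *\<^sub>R v) u - L (a *\<^sub>R v) u = a * (\<Gamma> v u - L v u)" for a
      by (simp add: bounded_ops_scale[OF G(1) uv] bounded_ops_scale[OF G(2) uv] right_diff_distrib)
  qed
qed

section \<open>The precision operator\<close>

text \<open>The operator S of the overview as a bounded operator; \<open>Blinfun\<close> returns it
  as intended for members of \<open>HS_ops C\<close>.\<close>

definition pert :: "('h \<Rightarrow> 'h \<Rightarrow> real) \<Rightarrow> 'h \<Rightarrow>\<^sub>L 'h" where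
  "pert \<Gamma> = Blinfun (half_conj C \<Gamma>)"

text \<open>\<open>half\<close> is an isometry from H onto H^1, so \<open>\<Gamma>\<close> becomes a
  bounded form on H; Riesz representation then evaluates the description in
  \<open>half_conj\<close>.\<close>

lemma pert_HS:
  assumes "\<Gamma> \<in> HS_ops C"
  shows "hilbert_schmidt (blinfun_apply (pert \<Gamma>))" "z \<bullet> pert \<Gamma> x = \<Gamma> (half x) (half z)"
proof -
  have b: "\<Gamma> \<in> bounded_ops C 1" and hs: "hilbert_schmidt (half_conj C \<Gamma>)" using assms by (auto simp: HS_ops_def)
  have ap: "blinfun_apply (pert \<Gamma>) = half_conj C \<Gamma>"
    unfolding pert_def using hs by (intro bounded_linear_Blinfun_apply) (simp add: hilbert_schmidt_def)
  show "hilbert_schmidt (blinfun_apply (pert \<Gamma>))" unfolding ap by (rule hs)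
  obtain K where K: "\<And>u v. u \<in> Hs C 1 \<Longrightarrow> v \<in> Hs C 1 \<Longrightarrow> \<bar>\<Gamma> v u\<bar> \<le> K * Hs_norm C 1 v * Hs_norm C 1 u"
    using bounded_ops_bilinear_bound[OF _ b] by auto
  have d: "\<Gamma> (half x) \<in> Hs_dual C 1" for x using b half_in_Hs_1 by (auto simp: bounded_ops_def)
  have bl: "bounded_linear (\<lambda>z. \<Gamma> (half x) (half z))" for x
  proof (rule bounded_linear_intro[where K="K * norm x"])
    fix y z a
    show "\<Gamma> (half x) (half (y + z)) = \<Gamma> (half x) (half y) + \<Gamma> (half x) (half z)"
      using d[of x] half_in_Hs_1 by (simp add: blinfun.add_right Hs_dual_def)
    show "\<Gamma> (half x) (half (a *\<^sub>R z)) = a *\<^sub>R \<Gamma> (half x) (half z)"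
      using d[of x] half_in_Hs_1 by (simp add: blinfun.scaleR_right Hs_dual_def)
    show "norm (\<Gamma> (half x) (half z)) \<le> norm z * (K * norm x)"
      using K[OF half_in_Hs_1[of z] half_in_Hs_1[of x]] Hs_norm_op_powr[of 1] by (simp add: mult_ac)
  qed
  have "\<forall>z. z \<bullet> half_conj C \<Gamma> x = \<Gamma> (half x) (half z)"
    unfolding half_conj_def by (rule theI'[OF riesz_representation[OF bl]])
  then show "z \<bullet> pert \<Gamma> x = \<Gamma> (half x) (half z)" unfolding ap by blast
qed

lemma pert_self_adjoint:
  assumes "\<Gamma> \<in> HS_ops C" "symmetric_op C \<Gamma>"
  shows "self_adjoint (pert \<Gamma>)"
  unfolding self_adjoint_def
proof (intro allI)
  fix x y
  have "pert \<Gamma> x \<bullet> y = \<Gamma> (half x) (half y)" using pert_HS(2)[OF assms(1), of y x] by (simp add: inner_commute)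
  also have "\<dots> = \<Gamma> (half y) (half x)" using assms(2) half_in_Hs_1 by (simp add: symmetric_op_def)
  also have "\<dots> = x \<bullet> pert \<Gamma> y" by (rule pert_HS(2)[OF assms(1), symmetric])
  finally show "pert \<Gamma> x \<bullet> y = x \<bullet> pert \<Gamma> y" .
qed

text \<open>The factorisation C^(-1) + Gamma = C^(-1/2) (1 + S) C^(-1/2): substituting
  \<open>u = half x\<close> turns the form into that of 1 + S, and the unbounded factors survive
  only as the condition that \<open>half w\<close> is attained.\<close>

lemma precision_op_iff:
  assumes G: "\<Gamma> \<in> HS_ops C" "symmetric_op C \<Gamma>"
  shows "(u, w) \<in> precision_op C \<Gamma> \<longleftrightarrow> (\<exists>x. u = half x \<and> x + pert \<Gamma> x = half w)"
proof -
  have q: "quad_form C \<Gamma> (half x) (half z) = z \<bullet> (x + pert \<Gamma> x)" for x z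
  proof -
    have "\<Gamma> (half z) (half x) = \<Gamma> (half x) (half z)" using G(2) half_in_Hs_1 by (simp add: symmetric_op_def)
    then show ?thesis
      by (simp add: quad_form_def op_neg_powr_op_powr inner_add_right pert_HS(2)[OF G(1)] inner_commute)
  qed
  have "(\<forall>v\<in>Hs C 1. quad_form C \<Gamma> (half x) v = w \<bullet> v) \<longleftrightarrow> x + pert \<Gamma> x = half w" for x
  proof -
    have "(\<forall>v\<in>Hs C 1. quad_form C \<Gamma> (half x) v = w \<bullet> v) \<longleftrightarrow> (\<forall>z. z \<bullet> (x + pert \<Gamma> x) = z \<bullet> half w)"
      by (simp add: Hs_1 q inner_commute[of w] half_self_adjoint)
    then show ?thesis by (simp add: vector_eq_ldot)
  qed
  then show ?thesis unfolding precision_op_def by (auto simp: Hs_1)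
qed

end

section \<open>Invertible compact perturbations of the identity\<close>

lemma blinfun_id_plus: "blinfun_apply (id_blinfun + S) x = x + blinfun_apply S x"
  by (simp add: blinfun.add_left)

text \<open>The eigenvalues of \<open>S\<close> tend to 0, so the reciprocals tend to 1; with none
  of the denominators zero they are bounded.\<close>

lemma compact_perturbation_spectrum:
  fixes S :: "'h::{real_inner,complete_space,second_countable_topology} \<Rightarrow>\<^sub>L 'h"
  assumes S: "self_adjoint S" "hilbert_schmidt S" and inj: "\<And>x. x + S x = 0 \<Longrightarrow> x = 0"
  obtains f s B where "onb f" "\<And>i. S (f i) = s i *\<^sub>R f i" "\<And>i. s i = f i \<bullet> S (f i)"
    "\<And>i. 1 + s i \<noteq> 0" "\<And>i. \<bar>1 / (1 + s i)\<bar> \<le> B"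
proof -
  obtain f E s where f0: "onb f" "orthonormal_basis E" "f = set_to_seq E" "countable E"
      "\<And>i. S (f i) = s i *\<^sub>R f i" "\<And>i. s i = f i \<bullet> S (f i)" "summable (\<lambda>i. (s i)\<^sup>2)"
    by (rule spectral_theorem[OF S]) (rule that)
  note f = f0(1,5,6,7)
  have nz: "1 + s i \<noteq> 0" for i
  proof
    \<comment> \<open>For a zero vector \<open>f i\<close> the eigenvalue is 0 and the denominator
      is 1, so injectivity is needed only for genuine eigenvectors.\<close>
    assume z: "1 + s i = 0"
    have "f i + S (f i) = (1 + s i) *\<^sub>R f i" unfolding f(2) by (simp add: scaleR_add_left)
    also have "\<dots> = 0" unfolding z by simp
    finally have "f i = 0" by (rule inj)
    then have "s i = 0" using f(3)[of i] by simp
    then show False using z by simp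
  qed
  have "(\<lambda>i. (s i)\<^sup>2) \<longlonglongrightarrow> 0" by (rule summable_LIMSEQ_zero[OF f(4)])
  then have "(\<lambda>i. sqrt ((s i)\<^sup>2)) \<longlonglongrightarrow> sqrt 0" by (rule tendsto_real_sqrt)
  then have "(\<lambda>i. \<bar>s i\<bar>) \<longlonglongrightarrow> 0" by simp
  then have "s \<longlonglongrightarrow> 0" by (rule tendsto_rabs_zero_cancel)
  then have "(\<lambda>i. 1 / (1 + s i)) \<longlonglongrightarrow> 1 / (1 + 0)" by (intro tendsto_intros) auto
  then have "Bseq (\<lambda>i. 1 / (1 + s i))" by (intro convergent_imp_Bseq convergentI)
  then obtain B where "\<And>i. norm (1 / (1 + s i)) \<le> B" unfolding Bseq_def by blast
  then have "\<And>i. \<bar>1 / (1 + s i)\<bar> \<le> B" unfolding real_norm_def .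
  then show thesis by (rule that[OF f(1,2,3) nz])
qed

text \<open>The square root of the inverse is what the construction of a Gaussian measure in
  \<open>exists_gaussian\<close> takes as input.\<close>

lemma compact_perturbation_inverse:
  fixes S :: "'h::{real_inner,complete_space,second_countable_topology} \<Rightarrow>\<^sub>L 'h"
  assumes S: "self_adjoint S" "hilbert_schmidt S" and inj: "\<And>x. x + S x = 0 \<Longrightarrow> x = 0"
  obtains R :: "'h \<Rightarrow>\<^sub>L 'h" where "self_adjoint R" "\<And>x. R x + S (R x) = x" "\<And>x. R (x + S x) = x"
    "strictly_positive (id_blinfun + S) \<Longrightarrow> \<exists>Q. self_adjoint Q \<and> (\<forall>x. Q (Q x) = R x)"
proof -
  obtain f s B where f: "onb f" "\<And>i. S (f i) = s i *\<^sub>R f i" "\<And>i. s i = f i \<bullet> S (f i)"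
    and nz: "\<And>i. 1 + s i \<noteq> 0" and B: "\<And>i. \<bar>1 / (1 + s i)\<bar> \<le> B"
    by (rule compact_perturbation_spectrum[OF assms], assumption) (rule that)
  define R where "R = diag_op f (\<lambda>i. 1 / (1 + s i))"
  have Rc: "R x \<bullet> f i = (x \<bullet> f i) / (1 + s i)" for x i
    unfolding R_def using diag_op_apply(2)[OF f(1), of "\<lambda>i. 1 / (1 + s i)", OF B] by simp
  have Sc: "S x \<bullet> f i = s i * (x \<bullet> f i)" for x i using S(1) f(2) by (simp add: self_adjoint_def)
  have diag_sa: "self_adjoint T" if "\<And>x i. blinfun_apply T x \<bullet> f i = a i * (x \<bullet> f i)" for T :: "'h \<Rightarrow>\<^sub>L 'h" and a
    unfolding self_adjoint_def
  proof (intro allI)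
    fix x y
    have "(\<lambda>i. (T x \<bullet> f i) * (y \<bullet> f i)) = (\<lambda>i. (x \<bullet> f i) * (T y \<bullet> f i))" by (simp add: that mult_ac)
    then show "T x \<bullet> y = x \<bullet> T y"
      using onb_inner_sums[OF f(1), of "T x" y] onb_inner_sums[OF f(1), of x "T y"] by (metis sums_unique2)
  qed
  show thesis
  proof (rule that)
    show "self_adjoint R" by (rule diag_sa[of _ "\<lambda>i. 1 / (1 + s i)"]) (simp add: Rc)
    show "R x + S (R x) = x" for x
    proof (rule onb_eqI[OF f(1)])
      fix i
      have "(R x + S (R x)) \<bullet> f i = (1 + s i) * ((x \<bullet> f i) / (1 + s i))"
        unfolding inner_add_left Sc Rc distrib_right by simp
      then show "(R x + S (R x)) \<bullet> f i = x \<bullet> f i" using nz[of i] by simp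
    qed
    show "R (x + S x) = x" for x
    proof (rule onb_eqI[OF f(1)])
      fix i
      have "R (x + S x) \<bullet> f i = ((1 + s i) * (x \<bullet> f i)) / (1 + s i)"
        unfolding inner_add_left Sc Rc distrib_right by simp
      then show "R (x + S x) \<bullet> f i = x \<bullet> f i" using nz[of i] by simp
    qed
    assume sp: "strictly_positive (id_blinfun + S)"
    have pos: "0 < 1 + s i" for i
    proof (cases "f i = 0")
      case False
      then have "0 < f i \<bullet> (f i + S (f i))" using sp by (simp add: strictly_positive_def blinfun_id_plus)
      moreover have "f i \<bullet> f i = 1" using onb_orthosys[OF f(1)] False unfolding orthosys_def by (metis inner_eq_zero_iff)
      ultimately show ?thesis by (simp add: f(2) inner_add_right)
    qed (simp add: f(3))
    define Q where "Q = diag_op f (\<lambda>i. sqrt (1 / (1 + s i)))"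
    have "\<bar>sqrt (1 / (1 + s i))\<bar> \<le> sqrt B" for i using B[of i] pos[of i] by (simp add: real_sqrt_abs2)
    note Qc = diag_op_apply(2)[OF f(1), of "\<lambda>i. sqrt (1 / (1 + s i))", OF this, folded Q_def]
    have "Q (Q x) = R x" for x
    proof (rule onb_eqI[OF f(1)])
      fix i
      have "sqrt (1 / (1 + s i)) * sqrt (1 / (1 + s i)) = 1 / (1 + s i)"
        using pos[of i] by (intro real_sqrt_mult_self[THEN trans]) simp
      then show "Q (Q x) \<bullet> f i = R x \<bullet> f i" unfolding Qc Rc mult.assoc[symmetric] by simp
    qed
    moreover have "self_adjoint Q" by (rule diag_sa[OF Qc])
    ultimately show "\<exists>Q. self_adjoint Q \<and> (\<forall>x. Q (Q x) = R x)" by blast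
  qed
qed

lemma strictly_positive_inj: "strictly_positive (id_blinfun + S) \<Longrightarrow> x + blinfun_apply S x = 0 \<Longrightarrow> x = 0"
  unfolding strictly_positive_def blinfun_id_plus by (metis inner_zero_right less_irrefl)

section \<open>Positivity and inverse of the precision operator\<close>

context covariance_spectrum
begin

text \<open>The graph contains only those \<open>half x\<close> for which
  \<open>x + pert \<Gamma> x\<close> lies in the range of \<open>half\<close>, so positivity on the
  graph says less at first sight. It excludes a kernel of 1 + S, hence the inverse exists; density
  of the range extends nonnegativity to all vectors, and a nonnegative spectrum without 0 is
  positive.\<close>

lemma graph_strictly_positive_iff:
  assumes G: "\<Gamma> \<in> HS_ops C" "symmetric_op C \<Gamma>"
  shows "graph_strictly_positive (precision_op C \<Gamma>) \<longleftrightarrow> strictly_positive (id_blinfun + pert \<Gamma>)"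
proof
  assume sp: "strictly_positive (id_blinfun + pert \<Gamma>)"
  show "graph_strictly_positive (precision_op C \<Gamma>)"
    unfolding graph_strictly_positive_def
  proof (intro ballI, clarify)
    fix u w assume "(u, w) \<in> precision_op C \<Gamma>" "u \<noteq> 0"
    then obtain x where x: "u = half x" "x + pert \<Gamma> x = half w" by (auto simp: precision_op_iff[OF G])
    then have "x \<noteq> 0" using \<open>u \<noteq> 0\<close> by auto
    then have "0 < x \<bullet> half w" using sp unfolding strictly_positive_def blinfun_id_plus x(2)[symmetric] by blast
    then show "0 < u \<bullet> w" by (simp add: x(1) half_self_adjoint)
  qed
next
  assume gp: "graph_strictly_positive (precision_op C \<Gamma>)"
  have pos: "0 < x \<bullet> half w" if "x + pert \<Gamma> x = half w" "x \<noteq> 0" for x w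
  proof -
    have "(half x, w) \<in> precision_op C \<Gamma>" using that(1) precision_op_iff[OF G] by blast
    then have "0 < half x \<bullet> w" using gp that(2) by (auto simp: graph_strictly_positive_def half_eq_0_iff)
    then show ?thesis by (simp add: half_self_adjoint)
  qed
  have inj: "x = 0" if "x + pert \<Gamma> x = 0" for x
    using pos[of x 0] that by auto
  note S = pert_self_adjoint[OF G] pert_HS(1)[OF G(1)]
  obtain R :: "'h \<Rightarrow>\<^sub>L 'h" where R0: "self_adjoint R" "\<And>x. R x + pert \<Gamma> (R x) = x" "\<And>x. R (x + pert \<Gamma> x) = x"
      "strictly_positive (id_blinfun + pert \<Gamma>) \<Longrightarrow> \<exists>Q. self_adjoint Q \<and> (\<forall>x. Q (Q x) = R x)"
    by (rule compact_perturbation_inverse[OF S inj], assumption) (rule that)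
  note R = R0(2,3)
  \<comment> \<open>Approximate \<open>x + pert \<Gamma> x\<close> by vectors
    \<open>half (w n)\<close>. Their preimages under 1 + S belong to the graph, and continuity of
    \<open>R\<close> passes the inequality to \<open>x\<close>.\<close>
  have psd: "0 \<le> x \<bullet> (x + pert \<Gamma> x)" for x
  proof -
    obtain w where w: "(\<lambda>n. half (w n)) \<longlonglongrightarrow> x + pert \<Gamma> x" using half_range_dense by blast
    have "(\<lambda>n. R (half (w n)) \<bullet> half (w n)) \<longlonglongrightarrow> R (x + pert \<Gamma> x) \<bullet> (x + pert \<Gamma> x)"
      by (intro tendsto_intros blinfun.tendsto w)
    moreover have "0 \<le> R (half (w n)) \<bullet> half (w n)" for n
      using pos[OF R(1)[of "half (w n)"]] by (cases "R (half (w n)) = 0") auto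
    ultimately show ?thesis unfolding R(2) by (intro LIMSEQ_le_const) auto
  qed
  obtain f s B where f: "onb f" "\<And>i. pert \<Gamma> (f i) = s i *\<^sub>R f i" "\<And>i. s i = f i \<bullet> pert \<Gamma> (f i)"
    and nz: "\<And>i. 1 + s i \<noteq> 0" and "\<And>i. \<bar>1 / (1 + s i)\<bar> \<le> B"
    by (rule compact_perturbation_spectrum[OF S inj], assumption) (rule that)
  have spos: "0 < 1 + s i" for i
  proof (cases "f i = 0")
    case False
    then have "f i \<bullet> f i = 1" using onb_orthosys[OF f(1)] unfolding orthosys_def by (metis inner_eq_zero_iff)
    then have "0 \<le> 1 + s i" using psd[of "f i"] by (simp add: inner_add_right flip: f(3))
    then show ?thesis using nz[of i] by simp
  qed (simp add: f(3))
  show "strictly_positive (id_blinfun + pert \<Gamma>)"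
    unfolding strictly_positive_def blinfun_id_plus
  proof (intro allI impI)
    fix x :: 'h assume "x \<noteq> 0"
    then obtain k where k: "x \<bullet> f k \<noteq> 0" using f(1) unfolding onb_def by blast
    have Sc: "pert \<Gamma> x \<bullet> f i = s i * (x \<bullet> f i)" for i using S(1) f(2) by (simp add: self_adjoint_def)
    have "(\<lambda>i. (x \<bullet> f i) * ((x + pert \<Gamma> x) \<bullet> f i)) sums (x \<bullet> (x + pert \<Gamma> x))" by (rule onb_inner_sums[OF f(1)])
    moreover have "(x \<bullet> f i) * ((x + pert \<Gamma> x) \<bullet> f i) = (1 + s i) * (x \<bullet> f i)\<^sup>2" for i
      by (simp add: inner_add_left Sc power2_eq_square algebra_simps)
    ultimately have sm: "(\<lambda>i. (1 + s i) * (x \<bullet> f i)\<^sup>2) sums (x \<bullet> (x + pert \<Gamma> x))" by simp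
    show "0 < x \<bullet> (x + pert \<Gamma> x)"
      using suminf_pos2[OF sums_summable[OF sm], of k] spos k sm by (simp add: sums_iff less_imp_le)
  qed
qed

lemma graph_inverse_eq:
  fixes R :: "'h \<Rightarrow>\<^sub>L 'h"
  assumes G: "\<Gamma> \<in> HS_ops C" "symmetric_op C \<Gamma>"
    and R: "\<And>x. R x + pert \<Gamma> (R x) = x" "\<And>x. R (x + pert \<Gamma> x) = x"
  shows "graph_inverse (precision_op C \<Gamma>) = op_powr C (1/2) o\<^sub>L R o\<^sub>L op_powr C (1/2)"
  unfolding graph_inverse_def
proof (rule the_equality)
  show "\<forall>x. (blinfun_apply (op_powr C (1/2) o\<^sub>L R o\<^sub>L op_powr C (1/2)) x, x) \<in> precision_op C \<Gamma>"
    unfolding precision_op_iff[OF G] using R(1) by auto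
  fix K :: "'h \<Rightarrow>\<^sub>L 'h" assume K: "\<forall>x. (blinfun_apply K x, x) \<in> precision_op C \<Gamma>"
  show "K = op_powr C (1/2) o\<^sub>L R o\<^sub>L op_powr C (1/2)"
  proof (rule blinfun_eqI)
    fix x
    obtain y where "K x = half y" "y + pert \<Gamma> y = half x" using K precision_op_iff[OF G] by blast
    then show "K x = (op_powr C (1/2) o\<^sub>L R o\<^sub>L op_powr C (1/2)) x" using R(2)[of y] by simp
  qed
qed

end

section \<open>Existence of Gaussian measures\<close>

lemma summable_dist_imp_Cauchy:
  fixes a :: "nat \<Rightarrow> 'a::metric_space"
  assumes s: "summable (\<lambda>k. dist (a k) (a (Suc k)))"
  shows "Cauchy a"
proof (rule metric_CauchyI)
  fix d :: real assume "0 < d"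
  then obtain N where N: "\<And>m n. m \<ge> N \<Longrightarrow> norm (\<Sum>k=m..<n. dist (a k) (a (Suc k))) < d"
    using s[unfolded summable_Cauchy] by blast
  have le: "dist (a m) (a n) \<le> (\<Sum>k=m..<n. dist (a k) (a (Suc k)))" if "m \<le> n" for m n
    using that
  proof (induction n rule: dec_induct)
    case (step n)
    then show ?case using dist_triangle[of "a m" "a (Suc n)" "a n"] by simp
  qed simp
  have main: "dist (a m) (a n) < d" if "N \<le> m" "m \<le> n" for m n
    using le[OF that(2)] N[OF that(1), of n] by simp
  have "dist (a m) (a n) < d" if "m \<ge> N" "n \<ge> N" for m n
    using main[of m n] main[of n m] that by (cases "m \<le> n") (auto simp: dist_commute)
  then show "\<exists>M. \<forall>m\<ge>M. \<forall>n\<ge>M. dist (a m) (a n) < d" by blast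
qed

text \<open>Completeness of L1 expressed by distances, so that it serves vector-valued random
  variables and real densities alike.\<close>

lemma mean_Cauchy_AE_limit:
  fixes u :: "nat \<Rightarrow> 'a \<Rightarrow> 'b::{complete_space, second_countable_topology}"
  assumes u[measurable]: "\<And>n. u n \<in> borel_measurable M"
    and C: "\<And>\<epsilon>::real. 0 < \<epsilon> \<Longrightarrow> \<exists>N. \<forall>m\<ge>N. \<forall>n\<ge>N. (\<integral>\<^sup>+x. dist (u m x) (u n x) \<partial>M) \<le> ennreal \<epsilon>"
  obtains r v where "strict_mono (r :: nat \<Rightarrow> nat)" "v \<in> borel_measurable M" "AE x in M. (\<lambda>n. u (r n) x) \<longlonglongrightarrow> v x"
    "\<And>\<epsilon>::real. 0 < \<epsilon> \<Longrightarrow> \<exists>N. \<forall>n\<ge>N. (\<integral>\<^sup>+x. dist (u n x) (v x) \<partial>M) \<le> ennreal \<epsilon>"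
proof -
  have "\<forall>k. \<exists>N. \<forall>m\<ge>N. \<forall>n\<ge>N. (\<integral>\<^sup>+x. dist (u m x) (u n x) \<partial>M) \<le> ennreal ((1/2)^k)"
    using C by simp
  then obtain N where N: "\<And>k m n. m \<ge> N k \<Longrightarrow> n \<ge> N k \<Longrightarrow> (\<integral>\<^sup>+x. dist (u m x) (u n x) \<partial>M) \<le> ennreal ((1/2)^k)"
    by metis
  \<comment> \<open>Beyond \<open>N (Suc k)\<close> consecutive distances are summable in the mean;
    \<open>Suc s\<close> makes \<open>r\<close> strictly increasing.\<close>
  define r where "r = rec_nat (N 0) (\<lambda>k s. max (Suc s) (N (Suc k)))"
  have rS: "r (Suc k) = max (Suc (r k)) (N (Suc k))" and r0: "r 0 = N 0" for k by (simp_all add: r_def)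
  have sm: "strict_mono r" unfolding strict_mono_Suc_iff rS by (simp add: less_max_iff_disj)
  have rN: "N k \<le> r k" for k by (cases k) (simp_all add: r0 rS)
  have rle: "r k \<le> r (Suc k)" for k by (simp add: rS)
  have "(\<integral>\<^sup>+x. (\<Sum>k. ennreal (dist (u (r k) x) (u (r (Suc k)) x))) \<partial>M)
      = (\<Sum>k. \<integral>\<^sup>+x. dist (u (r k) x) (u (r (Suc k)) x) \<partial>M)"
    by (rule nn_integral_suminf) measurable
  also have "\<dots> \<le> (\<Sum>k. ennreal ((1/2)^k))"
    by (intro suminf_le N) (use rN rle order_trans in \<open>blast+\<close>)
  also have "\<dots> = ennreal (\<Sum>k. (1/2)^k)"
    by (rule suminf_ennreal2) (auto intro: summable_geometric)
  also have "\<dots> < \<infinity>" by simp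
  finally have fin: "(\<integral>\<^sup>+x. (\<Sum>k. ennreal (dist (u (r k) x) (u (r (Suc k)) x))) \<partial>M) \<noteq> \<infinity>" by simp
  have "AE x in M. (\<Sum>k. ennreal (dist (u (r k) x) (u (r (Suc k)) x))) \<noteq> \<infinity>"
    by (rule nn_integral_noteq_infinite[OF _ fin]) measurable
  then have cau: "AE x in M. Cauchy (\<lambda>n. u (r n) x)"
  proof eventually_elim
    fix x assume "(\<Sum>k. ennreal (dist (u (r k) x) (u (r (Suc k)) x))) \<noteq> \<infinity>"
    then have "summable (\<lambda>k. dist (u (r k) x) (u (r (Suc k)) x))"
      by (intro summable_suminf_not_top) (auto simp: infinity_ennreal_def)
    then show "Cauchy (\<lambda>n. u (r n) x)" by (rule summable_dist_imp_Cauchy)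
  qed
  define A where "A = {x \<in> space M. Cauchy (\<lambda>n. u (r n) x)}"
  have A[measurable]: "A \<in> sets M" unfolding A_def by measurable
  \<comment> \<open>A metric space has no distinguished point, so the default value off the
    convergence set is an arbitrary one.\<close>
  obtain c :: 'b where True by blast
  define v where "v x = (if x \<in> A then lim (\<lambda>n. u (r n) x) else c)" for x
  have vl: "(\<lambda>n. u (r n) x) \<longlonglongrightarrow> v x" if "x \<in> A" for x
    using that by (simp add: v_def A_def Cauchy_convergent_iff convergent_LIMSEQ_iff)
  have v[measurable]: "v \<in> borel_measurable M"
  proof (rule borel_measurable_LIMSEQ_metric)
    show "(\<lambda>x. if x \<in> A then u (r n) x else c) \<in> borel_measurable M" for n by measurable
    show "(\<lambda>n. if x \<in> A then u (r n) x else c) \<longlonglongrightarrow> v x" for x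
      using vl[of x] by (cases "x \<in> A") (auto simp: v_def)
  qed
  have ae: "AE x in M. (\<lambda>n. u (r n) x) \<longlonglongrightarrow> v x"
    using cau AE_space by eventually_elim (auto intro: vl simp: A_def)
  show thesis
  proof (rule that[OF sm v ae])
    fix \<epsilon> :: real assume "0 < \<epsilon>"
    \<comment> \<open>The Cauchy estimate between \<open>u n\<close> and \<open>u (r k)\<close>
      passes to \<open>v\<close> by Fatou's lemma as \<open>k\<close> grows.\<close>
    then obtain K where K: "\<forall>m\<ge>K. \<forall>n\<ge>K. (\<integral>\<^sup>+x. dist (u m x) (u n x) \<partial>M) \<le> ennreal \<epsilon>" using C by blast
    have "(\<integral>\<^sup>+x. dist (u n x) (v x) \<partial>M) \<le> ennreal \<epsilon>" if n: "n \<ge> K" for n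
    proof -
      have "(\<integral>\<^sup>+x. dist (u n x) (v x) \<partial>M) = (\<integral>\<^sup>+x. liminf (\<lambda>k. ennreal (dist (u n x) (u (r k) x))) \<partial>M)"
      proof (rule nn_integral_cong_AE)
        show "AE x in M. ennreal (dist (u n x) (v x)) = liminf (\<lambda>k. ennreal (dist (u n x) (u (r k) x)))"
          using ae
        proof eventually_elim
          fix x assume "(\<lambda>n. u (r n) x) \<longlonglongrightarrow> v x"
          then have "(\<lambda>k. ennreal (dist (u n x) (u (r k) x))) \<longlonglongrightarrow> ennreal (dist (u n x) (v x))"
            by (intro tendsto_ennrealI tendsto_intros)
          then show "ennreal (dist (u n x) (v x)) = liminf (\<lambda>k. ennreal (dist (u n x) (u (r k) x)))"
            by (intro lim_imp_Liminf[symmetric]) auto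
        qed
      qed
      also have "\<dots> \<le> liminf (\<lambda>k. \<integral>\<^sup>+x. dist (u n x) (u (r k) x) \<partial>M)"
        by (rule nn_integral_liminf) measurable
      also have "\<dots> \<le> ennreal \<epsilon>"
      proof (rule Liminf_le)
        show "\<forall>\<^sub>F k in sequentially. (\<integral>\<^sup>+x. dist (u n x) (u (r k) x) \<partial>M) \<le> ennreal \<epsilon>"
          by (rule eventually_sequentiallyI[of K]) (use K n seq_suble[OF sm] order_trans in blast)
      qed simp
      finally show ?thesis .
    qed
    then show "\<exists>N. \<forall>n\<ge>N. (\<integral>\<^sup>+x. dist (u n x) (v x) \<partial>M) \<le> ennreal \<epsilon>" by blast
  qed
qed

context covariance_spectrum
begin

text \<open>C^(1/2) Q is Hilbert-Schmidt: exchanging the two summations replaces it by its adjoint,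
  and the squared norms of \<open>Q (half (e j))\<close> are bounded by
  \<open>(norm Q)\<^sup>2 * l j\<close>.\<close>

lemma half_norm_summable:
  fixes Q :: "'h \<Rightarrow>\<^sub>L 'h"
  assumes Q: "self_adjoint Q"
  shows "summable (\<lambda>i. (norm (half (Q (e i))))\<^sup>2)"
proof (rule bounded_imp_summable)
  fix n
  note o = onb_orthosys[OF onb]
  have sw: "half (Q (e i)) \<bullet> e j = Q (half (e j)) \<bullet> e i" for i j
    using Q by (metis half_self_adjoint inner_commute self_adjoint_def)
  have hl: "(norm (half (e j)))\<^sup>2 = l j" for j
    by (simp add: power2_norm_eq_inner half_self_adjoint half_half l_eq)
  have b: "(norm (Q (half (e j))))\<^sup>2 \<le> (norm Q)\<^sup>2 * l j" for j
    using power_mono[OF norm_blinfun[of Q "half (e j)"], of 2] by (simp add: power_mult_distrib hl)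
  have s1: "summable (\<lambda>j. (half (Q (e i)) \<bullet> e j)\<^sup>2)" for i by (rule bessel_summable[OF o])
  have "(\<Sum>i\<le>n. (norm (half (Q (e i))))\<^sup>2) = (\<Sum>i\<le>n. \<Sum>j. (half (Q (e i)) \<bullet> e j)\<^sup>2)"
    by (simp only: onb_norm_suminf[OF onb])
  also have "\<dots> = (\<Sum>j. \<Sum>i\<le>n. (half (Q (e i)) \<bullet> e j)\<^sup>2)"
    by (rule suminf_sum[symmetric]) (rule s1)
  also have "\<dots> \<le> (\<Sum>j. (norm Q)\<^sup>2 * l j)"
  proof (rule suminf_le)
    fix j
    have "(\<Sum>i\<le>n. (half (Q (e i)) \<bullet> e j)\<^sup>2) = (\<Sum>i\<le>n. (Q (half (e j)) \<bullet> e i)\<^sup>2)" by (simp only: sw)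
    also have "\<dots> \<le> (norm (Q (half (e j))))\<^sup>2" by (rule bessel[OF o]) simp
    finally show "(\<Sum>i\<le>n. (half (Q (e i)) \<bullet> e j)\<^sup>2) \<le> (norm Q)\<^sup>2 * l j" using b[of j] by linarith
  qed (use s1 l_summable in \<open>auto intro!: summable_sum summable_mult\<close>)
  finally show "(\<Sum>i\<le>n. (norm (half (Q (e i))))\<^sup>2) \<le> (\<Sum>j. (norm Q)\<^sup>2 * l j)" .
qed simp

text \<open>The measure is the law of \<open>m + \<Sum>\<^sub>i \<xi>\<^sub>i C\<^sup>1\<^sup>/\<^sup>2 Q e\<^sub>i\<close>, where \<open>\<xi>\<^sub>i\<close> are the normalised coordinates of the given
  Gaussian measure. Its partial sums are affine functions of the coordinates, so their marginals are
  known without proving that the \<open>\<xi>\<^sub>i\<close> are independent.\<close>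

lemma exists_gaussian:
  fixes Q :: "'h \<Rightarrow>\<^sub>L 'h"
  assumes g: "is_gaussian \<mu>0 m0 C" and Q: "self_adjoint Q"
  shows "\<exists>\<nu>. is_gaussian \<nu> m (op_powr C (1/2) o\<^sub>L (Q o\<^sub>L Q) o\<^sub>L op_powr C (1/2))"
proof -
  have pr: "prob_space \<mu>0" and st: "sets \<mu>0 = sets borel" using g by (auto simp: is_gaussian_def gaussian_measure_def)
  interpret prob_space \<mu>0 by (rule pr)
  note [measurable_cong] = st
  note o = onb_orthosys[OF onb]
  define v where "v i = half (Q (e i))" for i
  define \<xi> where "\<xi> i x = ((x - m0) \<bullet> e i) / sqrt (l i)" for i x
  define X where "X n x = m + (\<Sum>i<n. \<xi> i x *\<^sub>R v i)" for n :: nat and x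
  have \<xi>m[measurable]: "\<xi> i \<in> borel_measurable \<mu>0" for i unfolding \<xi>_def by measurable
  have Xm[measurable]: "X n \<in> borel_measurable \<mu>0" for n unfolding X_def by measurable
  have vs: "summable (\<lambda>i. (norm (v i))\<^sup>2)" unfolding v_def by (rule half_norm_summable[OF Q])
  \<comment> \<open>The nonzero normalised coordinates are orthonormal in L2, so mixed terms
    disappear from second moments.\<close>
  have \<xi>\<xi>: "has_bochner_integral \<mu>0 (\<lambda>x. \<xi> i x * \<xi> j x) (if i = j \<and> e i \<noteq> 0 then 1 else 0)" for i j
  proof -
    have "has_bochner_integral \<mu>0 (\<lambda>x. ((x - m0) \<bullet> e i) * ((x - m0) \<bullet> e j)) (e i \<bullet> C (e j))"
      using g by (simp add: is_gaussian_def has_covariance_def)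
    then have "has_bochner_integral \<mu>0 (\<lambda>x. ((x - m0) \<bullet> e i) * ((x - m0) \<bullet> e j) / (sqrt (l i) * sqrt (l j)))
        ((e i \<bullet> C (e j)) / (sqrt (l i) * sqrt (l j)))"
      by (rule has_bochner_integral_divide_zero)
    moreover have "(e i \<bullet> C (e j)) / (sqrt (l i) * sqrt (l j)) = (if i = j \<and> e i \<noteq> 0 then 1 else 0)"
    proof (cases "i = j \<and> e i \<noteq> 0")
      case True
      then have *: "0 < l i" "j = i" "e i \<noteq> 0" using l_pos[of i] by auto
      show ?thesis unfolding *(2) l_eq[symmetric] using *(1,3) by simp
    next
      case False
      then have "e i \<bullet> C (e j) = 0" using o by (cases "i = j") (auto simp: eigen orthosys_def)
      then show ?thesis using False by simp
    qed
    ultimately show ?thesis by (simp add: \<xi>_def mult_ac)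
  qed
  have diffX: "dist (X a x) (X b x) = norm (\<Sum>i=a..<b. \<xi> i x *\<^sub>R v i)" if "a \<le> b" for a b x
  proof -
    have "X b x - X a x = (\<Sum>i=a..<b. \<xi> i x *\<^sub>R v i)"
      using that unfolding X_def by (simp add: atLeast0LessThan[symmetric] sum_diff_nat_ivl)
    then show ?thesis by (metis dist_commute dist_norm)
  qed
  have second: "has_bochner_integral \<mu>0 (\<lambda>x. (norm (\<Sum>i=a..<b. \<xi> i x *\<^sub>R v i))\<^sup>2)
      (\<Sum>i=a..<b. \<Sum>j=a..<b. (if i = j \<and> e i \<noteq> 0 then 1 else 0) * (v i \<bullet> v j))" for a b
  proof -
    have "(norm (\<Sum>i=a..<b. \<xi> i x *\<^sub>R v i))\<^sup>2 = (\<Sum>i=a..<b. \<Sum>j=a..<b. (\<xi> i x * \<xi> j x) * (v i \<bullet> v j))" for x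
      unfolding power2_norm_eq_inner inner_sum_left inner_sum_right
      by (simp only: inner_scaleR_left inner_scaleR_right mult_ac inner_commute)
    then show ?thesis
      by (simp only:) (intro has_bochner_integral_sum has_bochner_integral_mult_left \<xi>\<xi>)
  qed
  have second_le: "(\<Sum>i=a..<b. \<Sum>j=a..<b. (if i = j \<and> e i \<noteq> 0 then 1 else 0) * (v i \<bullet> v j)) \<le> (\<Sum>i=a..<b. (norm (v i))\<^sup>2)" for a b
  proof (rule sum_mono)
    fix i assume i: "i \<in> {a..<b}"
    have "(\<Sum>j=a..<b. (if i = j \<and> e i \<noteq> 0 then 1 else 0) * (v i \<bullet> v j)) = (\<Sum>j=a..<b. if i = j then (if e i \<noteq> 0 then v i \<bullet> v i else 0) else 0)"
      by (intro sum.cong refl) auto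
    also have "\<dots> \<le> (norm (v i))\<^sup>2" using i by (simp add: power2_norm_eq_inner)
    finally show "(\<Sum>j=a..<b. (if i = j \<and> e i \<noteq> 0 then 1 else 0) * (v i \<bullet> v j)) \<le> (norm (v i))\<^sup>2" .
  qed
  have first: "(\<integral>\<^sup>+x. dist (X a x) (X b x) \<partial>\<mu>0) \<le> ennreal \<epsilon>"
    if ab: "a \<le> b" and eps: "0 < \<epsilon>" and le: "(\<Sum>i=a..<b. (norm (v i))\<^sup>2) \<le> \<epsilon>\<^sup>2" for a b \<epsilon>
  proof -
    let ?S = "\<lambda>x. norm (\<Sum>i=a..<b. \<xi> i x *\<^sub>R v i)"
    have int: "integrable \<mu>0 (\<lambda>x. (?S x)\<^sup>2)" and val: "(LINT x|\<mu>0. (?S x)\<^sup>2) \<le> \<epsilon>\<^sup>2"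
      using second[of a b] second_le[of a b] le by (auto simp: has_bochner_integral_iff)
    have "(\<integral>\<^sup>+x. dist (X a x) (X b x) \<partial>\<mu>0) \<le> (\<integral>\<^sup>+x. ennreal ((\<epsilon> + (?S x)\<^sup>2 / \<epsilon>) / 2) \<partial>\<mu>0)"
    proof (intro nn_integral_mono ennreal_leI)
      fix x
      \<comment> \<open>The inequality of arithmetic and geometric means converts the bound on the
        second moment into one on the first.\<close>
      have "0 \<le> (\<epsilon> - ?S x)\<^sup>2" by simp
      then have "2 * ?S x * \<epsilon> \<le> \<epsilon> * \<epsilon> + (?S x)\<^sup>2" by (simp add: power2_eq_square algebra_simps)
      then show "dist (X a x) (X b x) \<le> (\<epsilon> + (?S x)\<^sup>2 / \<epsilon>) / 2"
        unfolding diffX[OF ab] using eps by (simp add: field_simps)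
    qed
    also have "\<dots> = ennreal (LINT x|\<mu>0. (\<epsilon> + (?S x)\<^sup>2 / \<epsilon>) / 2)"
      by (rule nn_integral_eq_integral) (use int eps in auto)
    also have "(LINT x|\<mu>0. (\<epsilon> + (?S x)\<^sup>2 / \<epsilon>) / 2) = (\<epsilon> + (LINT x|\<mu>0. (?S x)\<^sup>2) / \<epsilon>) / 2"
      using int by (simp add: prob_space)
    also have "ennreal \<dots> \<le> ennreal \<epsilon>"
      using val eps by (intro ennreal_leI) (simp add: field_simps power2_eq_square)
    finally show ?thesis .
  qed
  obtain r Y where r: "strict_mono (r :: nat \<Rightarrow> nat)" and Y[measurable]: "Y \<in> borel_measurable \<mu>0"
    and ae: "AE x in \<mu>0. (\<lambda>n. X (r n) x) \<longlonglongrightarrow> Y x"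
  proof (rule mean_Cauchy_AE_limit[OF Xm])
    fix \<epsilon> :: real assume eps: "0 < \<epsilon>"
    then obtain N where N: "\<And>m n. m \<ge> N \<Longrightarrow> norm (\<Sum>i=m..<n. (norm (v i))\<^sup>2) < \<epsilon>\<^sup>2"
      using vs[unfolded summable_Cauchy] by (meson zero_less_power)
    have *: "(\<integral>\<^sup>+x. dist (X m x) (X n x) \<partial>\<mu>0) \<le> ennreal \<epsilon>" if "m \<ge> N" "m \<le> n" for m n
      by (rule first[OF that(2) eps]) (use N[OF that(1), of n] in simp)
    have "(\<integral>\<^sup>+x. dist (X m x) (X n x) \<partial>\<mu>0) \<le> ennreal \<epsilon>" if "m \<ge> N" "n \<ge> N" for m n
      using *[of m n] *[of n m] that by (cases "m \<le> n") (auto simp: dist_commute)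
    then show "\<exists>N. \<forall>m\<ge>N. \<forall>n\<ge>N. (\<integral>\<^sup>+x. dist (X m x) (X n x) \<partial>\<mu>0) \<le> ennreal \<epsilon>" by blast
  qed (rule that)
  define K where "K = op_powr C (1/2) o\<^sub>L (Q o\<^sub>L Q) o\<^sub>L op_powr C (1/2)"
  have Kap: "K x = half (Q (Q (half x)))" for x by (simp add: K_def)
  have Qsa: "Q x \<bullet> y = x \<bullet> Q y" for x y using Q by (simp add: self_adjoint_def)
  have KK: "x \<bullet> K y = Q (half x) \<bullet> Q (half y)" for x y
    unfolding Kap by (simp flip: half_self_adjoint Qsa)
  have cfX: "(CLINT x|\<mu>0. iexp (X n x \<bullet> h)) = iexp (m \<bullet> h) * exp (- (\<Sum>i<n. (v i \<bullet> h)\<^sup>2) / 2)" for n h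
  proof -
    \<comment> \<open>Chosen so that the marginal of \<open>X n\<close> in direction
      \<open>h\<close> is a shift of the marginal of the given measure in direction
      \<open>w\<close>; its variance is \<open>w \<bullet> C w\<close>.\<close>
    define w where "w = (\<Sum>i<n. ((v i \<bullet> h) / sqrt (l i)) *\<^sub>R e i)"
    have Xw: "X n x \<bullet> h = (m \<bullet> h - m0 \<bullet> w) + x \<bullet> w" for x
    proof -
      have "X n x \<bullet> h = m \<bullet> h + (x - m0) \<bullet> w"
        by (simp add: X_def w_def inner_add_left inner_sum_left inner_sum_right \<xi>_def mult_ac)
      then show ?thesis by (simp add: inner_diff_left)
    qed
    have v0: "v i = 0" if "e i = 0" for i using that by (simp add: v_def)
    have wCw: "w \<bullet> C w = (\<Sum>i<n. (v i \<bullet> h)\<^sup>2)"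
    proof -
      have "w \<bullet> C w = (\<Sum>i<n. ((v i \<bullet> h) / sqrt (l i)) * (w \<bullet> C (e i)))"
        by (simp add: w_def blinfun.sum_right blinfun.scaleR_right inner_sum_right)
      also have "\<dots> = (\<Sum>i<n. (v i \<bullet> h)\<^sup>2)"
      proof (rule sum.cong[OF refl])
        fix i assume i: "i \<in> {..<n}"
        have "w \<bullet> C (e i) = l i * (((v i \<bullet> h) / sqrt (l i)) * (e i \<bullet> e i))"
          unfolding w_def eigen using i by (simp add: orthosys_inner_sum[OF o])
        then show "((v i \<bullet> h) / sqrt (l i)) * (w \<bullet> C (e i)) = (v i \<bullet> h)\<^sup>2"
        proof (cases "e i = 0")
          case False
          then have "e i \<bullet> e i = 1" using o unfolding orthosys_def by (metis inner_eq_zero_iff)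
          moreover obtain q where q: "sqrt (l i) = q" "l i = q * q" "q \<noteq> 0"
            using l_pos[OF False] by (metis less_irrefl real_sqrt_eq_zero_cancel_iff real_sqrt_mult_self abs_of_pos)
          ultimately have "w \<bullet> C (e i) = (q * q) * ((v i \<bullet> h) / q)" using \<open>w \<bullet> C (e i) = _\<close> by simp
          then show ?thesis unfolding q(1) using q(3) by (simp add: power2_eq_square)
        qed (simp add: v0)
      qed
      finally show ?thesis .
    qed
    have "(CLINT x|\<mu>0. iexp (X n x \<bullet> h)) = (CLINT x|\<mu>0. iexp (m \<bullet> h - m0 \<bullet> w) * iexp (x \<bullet> w))"
      unfolding Xw by (simp add: distrib_left exp_add)
    also have "\<dots> = iexp (m \<bullet> h - m0 \<bullet> w) * cf \<mu>0 w" unfolding cf_def by (rule integral_mult_right_zero)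
    also have "\<dots> = (iexp (m \<bullet> h - m0 \<bullet> w) * iexp (m0 \<bullet> w)) * exp (- (w \<bullet> C w) / 2)"
      by (simp add: is_gaussian_cf[OF g])
    also have "iexp (m \<bullet> h - m0 \<bullet> w) * iexp (m0 \<bullet> w) = iexp (m \<bullet> h)"
      by (simp flip: exp_add add: algebra_simps)
    finally show ?thesis unfolding wCw .
  qed
  have pY: "prob_space (distr \<mu>0 borel Y)" by (rule prob_space_distr) measurable
  have cfY: "cf (distr \<mu>0 borel Y) h = iexp (m \<bullet> h) * exp (- (h \<bullet> K h) / 2)" for h
  proof -
    have 1: "cf (distr \<mu>0 borel Y) h = (CLINT x|\<mu>0. iexp (Y x \<bullet> h))"
      unfolding cf_def by (rule integral_distr) auto
    have A: "(\<lambda>n. CLINT x|\<mu>0. iexp (X (r n) x \<bullet> h)) \<longlonglongrightarrow> (CLINT x|\<mu>0. iexp (Y x \<bullet> h))"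
    proof (rule integral_dominated_convergence[where w="\<lambda>_. 1"])
      show "AE x in \<mu>0. (\<lambda>n. iexp (X (r n) x \<bullet> h)) \<longlonglongrightarrow> iexp (Y x \<bullet> h)"
        using ae by eventually_elim (intro tendsto_intros)
    qed auto
    have "(\<lambda>n. \<Sum>i<r n. (v i \<bullet> h)\<^sup>2) \<longlonglongrightarrow> h \<bullet> K h"
    proof -
      have "(\<lambda>i. (Q (half h) \<bullet> e i)\<^sup>2) sums (norm (Q (half h)))\<^sup>2" by (rule onb_norm_sums[OF onb])
      moreover have "Q (half h) \<bullet> e i = v i \<bullet> h" for i by (metis Qsa half_self_adjoint inner_commute v_def)
      ultimately have "(\<lambda>n. \<Sum>i<n. (v i \<bullet> h)\<^sup>2) \<longlonglongrightarrow> h \<bullet> K h"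
        by (simp add: KK power2_norm_eq_inner sums_def)
      from LIMSEQ_subseq_LIMSEQ[OF this r] show ?thesis by (simp add: o_def)
    qed
    then have "(\<lambda>n. iexp (m \<bullet> h) * exp (- (\<Sum>i<r n. (v i \<bullet> h)\<^sup>2) / 2))
        \<longlonglongrightarrow> iexp (m \<bullet> h) * exp (- (h \<bullet> K h) / 2)"
      by (intro tendsto_intros) auto
    from LIMSEQ_unique[OF A[unfolded cfX] this] show ?thesis unfolding 1 .
  qed
  have "is_gaussian (distr \<mu>0 borel Y) m K"
  proof (rule cf_imp_is_gaussian[OF pY _ _ _ cfY])
    show "self_adjoint K" unfolding self_adjoint_def using KK by (metis inner_commute)
  qed (simp_all add: KK)
  then show ?thesis unfolding K_def by blast
qed

text \<open>\<open>R\<close> is a parameter characterised as two-sided inverse, so that callers can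
  keep the inverse they have chosen; it coincides with the diagonal one, which has a self-adjoint
  square root.\<close>

lemma gaussian_P0_is_gaussian:
  assumes g: "is_gaussian \<mu>0 m0 C" and G: "\<Gamma> \<in> HS_ops C" "symmetric_op C \<Gamma>"
    and sp: "strictly_positive (id_blinfun + pert \<Gamma>)"
    and R: "\<And>x. blinfun_apply R x + pert \<Gamma> (R x) = x" "\<And>x. blinfun_apply R (x + pert \<Gamma> x) = x"
  shows "is_gaussian (gaussian_P0 C m \<Gamma>) m (op_powr C (1/2) o\<^sub>L R o\<^sub>L op_powr C (1/2))"
    and "self_adjoint R" and "0 \<le> x \<bullet> R x"
proof -
  note S = pert_self_adjoint[OF G] pert_HS(1)[OF G(1)]
  note inj = strictly_positive_inj[OF sp]
  obtain R' :: "'h \<Rightarrow>\<^sub>L 'h" where R': "self_adjoint R'" "\<And>x. R' x + pert \<Gamma> (R' x) = x" "\<And>x. R' (x + pert \<Gamma> x) = x"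
      "strictly_positive (id_blinfun + pert \<Gamma>) \<Longrightarrow> \<exists>Q. self_adjoint Q \<and> (\<forall>x. Q (Q x) = R' x)"
    by (rule compact_perturbation_inverse[OF S inj], assumption) (rule that)
  have RR: "R' = R" by (rule blinfun_eqI) (metis R(1) R'(3))
  then obtain Q where Q: "self_adjoint Q" "\<And>x. Q (Q x) = R x" using R'(4)[OF sp] by blast
  have QQ: "Q o\<^sub>L Q = R" by (rule blinfun_eqI) (simp add: Q)
  have gsp: "graph_strictly_positive (precision_op C \<Gamma>)" using sp graph_strictly_positive_iff[OF G] by simp
  obtain \<nu> where \<nu>: "is_gaussian \<nu> m (op_powr C (1/2) o\<^sub>L R o\<^sub>L op_powr C (1/2))"
    using exists_gaussian[OF g Q(1), of m] unfolding QQ by blast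
  have "gaussian_P0 C m \<Gamma> = \<nu>"
    unfolding gaussian_P0_def using gsp gaussian_eqI[OF \<nu>] by (simp add: graph_inverse_eq[OF G R])
  then show "is_gaussian (gaussian_P0 C m \<Gamma>) m (op_powr C (1/2) o\<^sub>L R o\<^sub>L op_powr C (1/2))" using \<nu> by simp
  show "self_adjoint R" using R'(1) RR by simp
  show "0 \<le> x \<bullet> R x" using Q unfolding self_adjoint_def by (metis inner_ge_zero)
qed

end

section \<open>Uniform convexity of the relative entropy\<close>

definition xlnx :: "real \<Rightarrow> real" where "xlnx t = t * ln t"

lemma xlnx_0 [simp]: "xlnx 0 = 0"
  by (simp add: xlnx_def)

lemma borel_measurable_xlnx [measurable]: "xlnx \<in> borel_measurable borel"
  unfolding xlnx_def by measurable

lemma xlnx_ge: "0 \<le> t \<Longrightarrow> t - 1 \<le> xlnx t"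
proof (cases "t = 0")
  case False
  assume "0 \<le> t"
  then have t: "0 < t" using False by simp
  have "ln (1 / t) \<le> 1 / t - 1" using t by (intro ln_le_minus_one) simp
  then have "1 - 1 / t \<le> ln t" using t by (simp add: ln_div)
  then have "t * (1 - 1 / t) \<le> t * ln t" using t by (intro mult_left_mono) auto
  then show ?thesis using t by (simp add: xlnx_def right_diff_distrib)
qed simp

lemma xlnx_ge_minus_one: "0 \<le> t \<Longrightarrow> - 1 \<le> xlnx t"
  using xlnx_ge[of t] by simp

text \<open>Gives continuity at 0. The square root comes from
  \<open>ln t = - 2 * ln (1 / sqrt t)\<close> and \<open>ln_le_minus_one\<close>.\<close>

lemma abs_xlnx_le: "0 \<le> t \<Longrightarrow> \<bar>xlnx t\<bar> \<le> 2 * sqrt t + t\<^sup>2"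
proof (cases "t = 0")
  case False
  assume "0 \<le> t"
  then have t: "0 < t" "0 < sqrt t" using False by simp_all
  have "ln (1 / sqrt t) \<le> 1 / sqrt t - 1" using t by (intro ln_le_minus_one) simp
  moreover have "ln (1 / sqrt t) = - ln t / 2" using t by (simp add: ln_div ln_sqrt)
  ultimately have "- ln t \<le> 2 * (1 / sqrt t)" by simp
  then have "t * (- ln t) \<le> t * (2 * (1 / sqrt t))" using t by (intro mult_left_mono) auto
  also have "t * (2 * (1 / sqrt t)) = 2 * sqrt t" using real_div_sqrt[of t] t(1) by (simp add: mult.commute[of t] flip: times_divide_eq_right)
  finally have 1: "- xlnx t \<le> 2 * sqrt t" by (simp add: xlnx_def)
  have "t * ln t \<le> t * (t - 1)" using t by (intro mult_left_mono ln_le_minus_one) auto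
  moreover have "t * (t - 1) \<le> t\<^sup>2" using t by (simp add: power2_eq_square right_diff_distrib)
  ultimately have 2: "xlnx t \<le> t\<^sup>2" unfolding xlnx_def by linarith
  show ?thesis using 1 2 t(2) zero_le_power2[of t] by (intro abs_leI) linarith+
qed simp

lemma isCont_xlnx_nonneg:
  assumes "\<And>n. 0 \<le> a n" "a \<longlonglongrightarrow> t"
  shows "(\<lambda>n. xlnx (a n)) \<longlonglongrightarrow> xlnx t"
proof (cases "t = 0")
  case True
  have "(\<lambda>n. 2 * sqrt (a n) + (a n)\<^sup>2) \<longlonglongrightarrow> 2 * sqrt t + t\<^sup>2" by (intro tendsto_intros assms)
  then have "(\<lambda>n. 2 * sqrt (a n) + (a n)\<^sup>2) \<longlonglongrightarrow> 0" using True by simp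
  then have "(\<lambda>n. xlnx (a n)) \<longlonglongrightarrow> 0"
    by (rule Lim_null_comparison[rotated]) (simp add: abs_xlnx_le assms(1))
  then show ?thesis using True by simp
next
  case False
  then show ?thesis unfolding xlnx_def by (intro tendsto_intros assms)
qed

text \<open>The difference of both sides vanishes at 0 together with its derivative, and the second
  derivative \<open>1 / (1 + x) + 1 / (1 - x) - 2\<close> is nonnegative.\<close>

lemma entropy_gap_nonneg_arg:
  fixes x :: real
  assumes x: "0 \<le> x" "x < 1"
  shows "x\<^sup>2 \<le> (1 + x) * ln (1 + x) + (1 - x) * ln (1 - x)"
proof -
  have d: "2 * y \<le> ln (1 + y) - ln (1 - y)" if y: "0 \<le> y" "y < 1" for y :: real
  proof -
    let ?g = "\<lambda>y::real. ln (1 + y) - ln (1 - y) - 2 * y"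
    have "?g 0 \<le> ?g y"
    proof (rule DERIV_nonneg_imp_nondecreasing[OF y(1)])
      fix z assume z: "0 \<le> z" "z \<le> y"
      then have p: "0 < 1 + z" "0 < 1 - z" using y by auto
      have "((\<lambda>y. ln (1 + y) - ln (1 - y) - 2 * y) has_real_derivative (1 / (1 + z) + 1 / (1 - z) - 2)) (at z)"
        using p by (auto intro!: derivative_eq_intros)
      moreover have "0 \<le> 1 / (1 + z) + 1 / (1 - z) - 2"
      proof -
        have "1 / (1 + z) + 1 / (1 - z) = 2 / ((1 + z) * (1 - z))"
          using p by (simp add: add_frac_eq)
        moreover have "2 \<le> 2 / ((1 + z) * (1 - z))"
          using mult_pos_pos[OF p] by (subst pos_le_divide_eq) (simp_all add: algebra_simps)
        ultimately show ?thesis by simp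
      qed
      ultimately show "\<exists>D. (?g has_real_derivative D) (at z) \<and> 0 \<le> D" by blast
    qed
    then show ?thesis by simp
  qed
  let ?h = "\<lambda>y::real. (1 + y) * ln (1 + y) + (1 - y) * ln (1 - y) - y\<^sup>2"
  have "?h 0 \<le> ?h x"
  proof (rule DERIV_nonneg_imp_nondecreasing[OF x(1)])
    fix z assume z: "0 \<le> z" "z \<le> x"
    then have p: "0 < 1 + z" "0 < 1 - z" using x by auto
    have "(?h has_real_derivative (ln (1 + z) - ln (1 - z) - 2 * z)) (at z)"
      using p by (auto intro!: derivative_eq_intros)
    moreover have "0 \<le> ln (1 + z) - ln (1 - z) - 2 * z" using d[of z] z x by simp
    ultimately show "\<exists>D. (?h has_real_derivative D) (at z) \<and> 0 \<le> D" by blast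
  qed
  then show ?thesis by simp
qed

text \<open>The natural gap \<open>(a - b)\<^sup>2 / (4 * (a + b))\<close> is replaced by its
  tangents, indexed by \<open>s\<close>: they are linear in \<open>\<bar>a - b\<bar>\<close> and
  \<open>a + b\<close>, so that they can be integrated first and optimised in \<open>s\<close>
  afterwards.\<close>

lemma xlnx_midpoint_gap:
  assumes "0 \<le> a" "0 \<le> b"
  shows "xlnx ((a + b) / 2) + (s * \<bar>a - b\<bar> / 2 - s\<^sup>2 * (a + b) / 4) \<le> (xlnx a + xlnx b) / 2"
proof -
  \<comment> \<open>Completing the square; equality holds for
    \<open>s = \<bar>a - b\<bar> / (a + b)\<close>.\<close>
  have quad: "s * \<bar>a - b\<bar> / 2 - s\<^sup>2 * (a + b) / 4 \<le> (a - b)\<^sup>2 / (4 * (a + b))" if "0 < a + b" for a b :: real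
  proof -
    have "0 \<le> (\<bar>a - b\<bar> - s * (a + b))\<^sup>2" by simp
    then have "2 * s * \<bar>a - b\<bar> * (a + b) - s\<^sup>2 * (a + b) * (a + b) \<le> (a - b)\<^sup>2"
      by (simp add: power2_diff power_mult_distrib power2_eq_square algebra_simps)
    then show ?thesis using that by (simp add: field_simps)
  qed
  have half: "1 / 2 \<le> ln (2::real)"
    using ln_le_minus_one[of "1/2::real"] by (simp add: ln_div)
  have main: "xlnx ((a + b) / 2) + (a - b)\<^sup>2 / (4 * (a + b)) \<le> (xlnx a + xlnx b) / 2"
    if ab: "0 \<le> b" "b \<le> a" "0 < a" for a b :: real
  proof (cases "b = 0")
    case True
    \<comment> \<open>With \<open>b = 0\<close> the relative deviation \<open>x\<close> used below
      would be 1, where \<open>ln (1 - x)\<close> is singular; the claim reduces to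
      \<open>ln 2 \<ge> 1/2\<close>.\<close>
    have "a * (1 / 2) \<le> a * ln 2" using half ab by (intro mult_left_mono) auto
    then show ?thesis using ab True
      by (simp add: xlnx_def ln_div power2_eq_square) (simp add: field_simps)
  next
    case False
    then have b: "0 < b" using ab by simp
    define c x where "c = (a + b) / 2" and "x = (a - b) / (a + b)"
    have c: "0 < c" using ab b by (simp add: c_def)
    have x: "0 \<le> x" "x < 1" using ab b by (simp_all add: x_def field_simps)
    have a_eq: "a = c * (1 + x)" and b_eq: "b = c * (1 - x)"
      using ab b by (simp_all add: c_def x_def field_simps)
    have p: "0 < 1 + x" "0 < 1 - x" using x by auto
    have "xlnx a + xlnx b - 2 * xlnx c = c * ((1 + x) * ln (1 + x) + (1 - x) * ln (1 - x))"
    proof -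
      have "ln (c * (1 + x)) = ln c + ln (1 + x)" "ln (c * (1 - x)) = ln c + ln (1 - x)"
        using c p by (simp_all add: ln_mult)
      then show ?thesis unfolding a_eq b_eq xlnx_def by (simp only:) (simp add: algebra_simps)
    qed
    also have "\<dots> \<ge> c * x\<^sup>2" using entropy_gap_nonneg_arg[OF x] c by (intro mult_left_mono) auto
    finally have "c * x\<^sup>2 \<le> xlnx a + xlnx b - 2 * xlnx c" .
    moreover have "c * x\<^sup>2 = (a - b)\<^sup>2 / (2 * (a + b))"
      using ab b by (simp add: c_def x_def power_divide power2_eq_square)
    ultimately have "(a - b)\<^sup>2 / (2 * (a + b)) \<le> xlnx a + xlnx b - 2 * xlnx c" by simp
    moreover have "X + G / 2 \<le> Y / 2" if "G \<le> Y - 2 * X" for X Y G :: real using that by linarith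
    ultimately have "xlnx c + (a - b)\<^sup>2 / (2 * (a + b)) / 2 \<le> (xlnx a + xlnx b) / 2" by blast
    moreover have "(a - b)\<^sup>2 / (2 * (a + b)) / 2 = (a - b)\<^sup>2 / (4 * (a + b))" by simp
    ultimately show ?thesis unfolding c_def[symmetric] by simp
  qed
  show ?thesis
  proof (cases "a = 0 \<and> b = 0")
    case False
    then have "0 < a + b" using assms by linarith
    note q = quad[OF this]
    have add_le: "X + Y \<le> Z" if "X + V \<le> Z" "Y \<le> V" for X Y Z V :: real using that by linarith
    show ?thesis
    proof (cases "b \<le> a")
      case True
      then have "0 < a" using \<open>0 < a + b\<close> by linarith
      then have "xlnx ((a + b) / 2) + (a - b)\<^sup>2 / (4 * (a + b)) \<le> (xlnx a + xlnx b) / 2"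
        using main[of b a] assms True by blast
      then show ?thesis using q by (rule add_le)
    next
      case *: False
      then have "xlnx ((b + a) / 2) + (b - a)\<^sup>2 / (4 * (b + a)) \<le> (xlnx b + xlnx a) / 2"
        using main[of a b] assms by auto
      then have "xlnx ((a + b) / 2) + (a - b)\<^sup>2 / (4 * (a + b)) \<le> (xlnx a + xlnx b) / 2"
        by (simp only: power2_commute[of b a] add.commute)
      then show ?thesis using q by (rule add_le)
    qed
  qed simp
qed

subsection \<open>Probability densities of finite entropy\<close>

text \<open>Nonnegativity holds everywhere rather than almost everywhere, so that pointwise
  inequalities for \<open>xlnx\<close> apply directly.\<close>

definition entropy_dens :: "'a measure \<Rightarrow> ('a \<Rightarrow> real) \<Rightarrow> bool" where
  "entropy_dens M f \<longleftrightarrow> (\<forall>x. 0 \<le> f x) \<and> has_bochner_integral M f 1 \<and> integrable M (\<lambda>x. xlnx (f x))"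

lemma entropy_densD:
  assumes "entropy_dens M f"
  shows "0 \<le> f x" "integrable M f" "(LINT x|M. f x) = 1" "integrable M (\<lambda>x. xlnx (f x))" "f \<in> borel_measurable M"
  using assms by (auto simp: entropy_dens_def has_bochner_integral_iff)

lemma entropy_dens_midpoint:
  assumes M: "prob_space M" and f: "entropy_dens M f" and g: "entropy_dens M g"
  shows "entropy_dens M (\<lambda>x. (f x + g x) / 2)"
    and "(LINT x|M. xlnx ((f x + g x) / 2)) + (LINT x|M. \<bar>f x - g x\<bar>)\<^sup>2 / 8
      \<le> ((LINT x|M. xlnx (f x)) + (LINT x|M. xlnx (g x))) / 2"
proof -
  interpret prob_space M by (rule M)
  note F = entropy_densD[OF f] and G = entropy_densD[OF g]
  note [measurable] = F(5) G(5)
  have gap: "xlnx ((f x + g x) / 2) + (s * \<bar>f x - g x\<bar> / 2 - s\<^sup>2 * (f x + g x) / 4) \<le> (xlnx (f x) + xlnx (g x)) / 2" for s x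
    by (rule xlnx_midpoint_gap[OF F(1) G(1)])
  \<comment> \<open>The function is at least -1 and, by the case \<open>s = 0\<close> of the gap, at
    most the mean of two integrable functions.\<close>
  have int: "integrable M (\<lambda>x. xlnx ((f x + g x) / 2))"
  proof (rule Bochner_Integration.integrable_bound)
    show "integrable M (\<lambda>x. 1 + \<bar>xlnx (f x)\<bar> + \<bar>xlnx (g x)\<bar>)" using F(4) G(4) by auto
    show "AE x in M. norm (xlnx ((f x + g x) / 2)) \<le> norm (1 + \<bar>xlnx (f x)\<bar> + \<bar>xlnx (g x)\<bar>)"
    proof (rule AE_I2)
      fix x
      have aux: "norm X \<le> norm (1 + \<bar>F\<bar> + \<bar>G\<bar>)" if "X \<le> (F + G) / 2" "- 1 \<le> X" for X F G :: real
        using that by auto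
      have "xlnx ((f x + g x) / 2) \<le> (xlnx (f x) + xlnx (g x)) / 2" using gap[of x 0] by simp
      moreover have "- 1 \<le> xlnx ((f x + g x) / 2)" using F(1)[of x] G(1)[of x] by (intro xlnx_ge_minus_one) simp
      ultimately show "norm (xlnx ((f x + g x) / 2)) \<le> norm (1 + \<bar>xlnx (f x)\<bar> + \<bar>xlnx (g x)\<bar>)"
        using aux by blast
    qed
  qed measurable
  show "entropy_dens M (\<lambda>x. (f x + g x) / 2)"
    unfolding entropy_dens_def using F G int by (auto simp: has_bochner_integral_iff)
  define L where "L = (LINT x|M. \<bar>f x - g x\<bar>)"
  \<comment> \<open>Both densities have mass 1, so the integrated gap is
    \<open>s * L / 2 - s\<^sup>2 / 2\<close>; it is maximal at \<open>s = L / 2\<close> with value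
    \<open>L\<^sup>2 / 8\<close>.\<close>
  have "(LINT x|M. xlnx ((f x + g x) / 2) + ((L / 2) * \<bar>f x - g x\<bar> / 2 - (L / 2)\<^sup>2 * (f x + g x) / 4))
      \<le> (LINT x|M. (xlnx (f x) + xlnx (g x)) / 2)"
  proof (rule integral_mono)
    show "integrable M (\<lambda>x. xlnx ((f x + g x) / 2) + ((L / 2) * \<bar>f x - g x\<bar> / 2 - (L / 2)\<^sup>2 * (f x + g x) / 4))"
      using int F G by auto
    show "integrable M (\<lambda>x. (xlnx (f x) + xlnx (g x)) / 2)" using F G by auto
  qed (rule gap)
  also have "\<dots> = ((LINT x|M. xlnx (f x)) + (LINT x|M. xlnx (g x))) / 2" using F G by simp
  also have "(LINT x|M. xlnx ((f x + g x) / 2) + ((L / 2) * \<bar>f x - g x\<bar> / 2 - (L / 2)\<^sup>2 * (f x + g x) / 4))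
      = (LINT x|M. xlnx ((f x + g x) / 2)) + ((L / 2) * L / 2 - (L / 2)\<^sup>2 * (1 + 1) / 4)"
    using int F G by (simp add: L_def)
  finally show "(LINT x|M. xlnx ((f x + g x) / 2)) + (LINT x|M. \<bar>f x - g x\<bar>)\<^sup>2 / 8
      \<le> ((LINT x|M. xlnx (f x)) + (LINT x|M. xlnx (g x))) / 2"
    unfolding L_def[symmetric] by (simp add: power2_eq_square field_simps)
qed

lemma entropy_ge_minus_one:
  assumes "prob_space M" "entropy_dens M f" shows "- 1 \<le> (LINT x|M. xlnx (f x))"
proof -
  interpret prob_space M by fact
  have "(LINT x|M. - 1) \<le> (LINT x|M. xlnx (f x))"
    using entropy_densD[OF assms(2)] by (intro integral_mono) (auto intro: xlnx_ge_minus_one)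
  then show ?thesis by (simp add: prob_space)
qed

text \<open>Split at the level \<open>R\<close>: above it \<open>f\<close> is at most
  \<open>xlnx f / ln R\<close>. Adding 1 makes the entropy term nonnegative, so that it may be kept
  below the level as well.\<close>

lemma entropy_uniform_integrability:
  assumes M: "prob_space M" and f: "entropy_dens M f" and B: "(LINT x|M. xlnx (f x)) \<le> B"
    and R: "1 < R" and A[measurable]: "A \<in> sets M"
  shows "(LINT x|M. f x * indicator A x) \<le> R * measure M A + (B + 1) / ln R"
proof -
  interpret prob_space M by (rule M)
  note F = entropy_densD[OF f]
  note [measurable] = F(5)
  have lR: "0 < ln R" using R by simp
  have le: "f x * indicator A x \<le> R * indicator A x + (xlnx (f x) + 1) / ln R" for x
  proof (cases "f x \<le> R")
    case True
    have "0 \<le> (xlnx (f x) + 1) / ln R" using xlnx_ge_minus_one[OF F(1)[of x]] lR by simp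
    moreover have "f x * indicator A x \<le> R * indicator A x" using True by (auto simp: indicator_def)
    ultimately show ?thesis by linarith
  next
    case False
    then have fx: "0 < f x" "ln R \<le> ln (f x)" using R by auto
    have "f x * ln R \<le> xlnx (f x)" unfolding xlnx_def using fx by (intro mult_left_mono) auto
    then have "f x \<le> xlnx (f x) / ln R" using lR by (simp add: field_simps)
    also have "\<dots> \<le> (xlnx (f x) + 1) / ln R" using lR by (simp add: divide_right_mono)
    finally have "f x \<le> (xlnx (f x) + 1) / ln R" .
    moreover have "f x * indicator A x \<le> f x" using fx by (auto simp: indicator_def)
    moreover have "0 \<le> R * indicator A x" using R by (auto simp: indicator_def)
    ultimately show ?thesis by linarith
  qed
  have i1: "integrable M (\<lambda>x. R * indicator A x)"
    by (intro integrable_mult_right integrable_real_indicator A) (simp add: less_top[symmetric])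
  have i2: "integrable M (\<lambda>x. (xlnx (f x) + 1) / ln R)"
    by (intro integrable_divide_zero Bochner_Integration.integrable_add integrable_const F)
  have "(LINT x|M. f x * indicator A x) \<le> (LINT x|M. R * indicator A x + (xlnx (f x) + 1) / ln R)"
  proof (rule integral_mono)
    show "integrable M (\<lambda>x. f x * indicator A x)" by (rule integrable_real_mult_indicator[OF A F(2)])
    show "integrable M (\<lambda>x. R * indicator A x + (xlnx (f x) + 1) / ln R)"
      by (intro Bochner_Integration.integrable_add i1 i2)
  qed (rule le)
  also have "\<dots> = R * measure M A + ((LINT x|M. xlnx (f x)) + 1) / ln R"
  proof -
    have "(LINT x|M. (xlnx (f x) + 1) / ln R) = ((LINT x|M. xlnx (f x)) + 1) / ln R"
      using F(4) by (simp add: prob_space)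
    then show ?thesis using Bochner_Integration.integral_add[OF i1 i2] by simp
  qed
  also have "\<dots> \<le> R * measure M A + (B + 1) / ln R" using B lR by (simp add: divide_right_mono)
  finally show ?thesis .
qed

section \<open>Midpoint convexity and minimising sequences\<close>

text \<open>Dyadic convex combinations of the tail from index \<open>n\<close>, with
  \<open>mid\<close> abstract so that the pairs need no vector space structure. Midpoints suffice
  because every estimate compares just two elements.\<close>

inductive_set midpoint_hull :: "('p \<Rightarrow> 'p \<Rightarrow> 'p) \<Rightarrow> (nat \<Rightarrow> 'p) \<Rightarrow> nat \<Rightarrow> 'p set"
  for mid p n where
  base: "n \<le> k \<Longrightarrow> p k \<in> midpoint_hull mid p n"
| mid: "x \<in> midpoint_hull mid p n \<Longrightarrow> y \<in> midpoint_hull mid p n \<Longrightarrow> mid x y \<in> midpoint_hull mid p n"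

lemma midpoint_hull_mono:
  assumes "m \<le> n" "x \<in> midpoint_hull mid p n" shows "x \<in> midpoint_hull mid p m"
  using assms(2) by induction (use assms(1) in \<open>auto intro: midpoint_hull.intros\<close>)

lemma midpoint_hull_invariant:
  assumes "x \<in> midpoint_hull mid p n" "\<And>k. P (p k)" "\<And>x y. P x \<Longrightarrow> P y \<Longrightarrow> P (mid x y)"
  shows "P x"
  using assms(1) by induction (use assms(2,3) in auto)

text \<open>Balls are convex, so a quantity affine on \<open>P\<close> that converges along
  \<open>p\<close> has the same limit along any choice from the tail hulls. This is the way back
  from mixtures to the sequence.\<close>

lemma midpoint_hull_tendsto:
  fixes T :: "'p \<Rightarrow> 'v::real_normed_vector"
  assumes q: "\<And>n. q n \<in> midpoint_hull mid p n" and P: "\<And>k. P (p k)" "\<And>x y. P x \<Longrightarrow> P y \<Longrightarrow> P (mid x y)"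
    and T: "\<And>x y. P x \<Longrightarrow> P y \<Longrightarrow> T (mid x y) = (1/2) *\<^sub>R (T x + T y)" and lim: "(\<lambda>k. T (p k)) \<longlonglongrightarrow> c"
  shows "(\<lambda>n. T (q n)) \<longlonglongrightarrow> c"
proof (rule LIMSEQ_I)
  fix \<epsilon> :: real assume e: "0 < \<epsilon>"
  then obtain N where N: "\<And>k. k \<ge> N \<Longrightarrow> norm (T (p k) - c) < \<epsilon>" using LIMSEQ_D[OF lim e] by blast
  have "P x \<and> norm (T x - c) < \<epsilon>" if "x \<in> midpoint_hull mid p n" "n \<ge> N" for x n
    using that(1)
  proof induction
    case (base k)
    then show ?case using N[of k] that(2) P(1) by simp
  next
    case (mid x y)
    have "T (mid x y) - c = (1/2) *\<^sub>R ((T x - c) + (T y - c))"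
    proof -
      have "T (mid x y) - c = (1/2) *\<^sub>R (T x + T y) - (1/2) *\<^sub>R (c + c)"
        using T mid.IH by (simp only: scaleR_half_double)
      then show ?thesis by (simp only: scaleR_right_diff_distrib[symmetric] add_diff_add)
    qed
    then have "norm (T (mid x y) - c) \<le> (norm (T x - c) + norm (T y - c)) / 2"
      using norm_triangle_ineq[of "T x - c" "T y - c"] by simp
    then show ?case using mid.IH P(2) by simp
  qed
  then show "\<exists>no. \<forall>n\<ge>no. norm (T (q n) - c) < \<epsilon>" using q by blast
qed

text \<open>The elements \<open>q n\<close> are almost minimal in the midpoint hulls of the tails, whose infima increase to \<open>d\<close>.
  If \<open>d\<close> is also the limit along the sequence itself, then the members of the sequence are almost
  minimal, too, and the gap \<open>D\<close> forces them to approach the \<open>q n\<close>.\<close>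

lemma midpoint_convex_minimising:
  fixes \<Psi> :: "'p \<Rightarrow> real" and D :: "'p \<Rightarrow> 'p \<Rightarrow> real"
  assumes P: "\<And>k. P (p k)" "\<And>x y. P x \<Longrightarrow> P y \<Longrightarrow> P (mid x y)"
    and gap: "\<And>x y. P x \<Longrightarrow> P y \<Longrightarrow> \<Psi> (mid x y) + D x y \<le> (\<Psi> x + \<Psi> y) / 2"
    and below: "\<And>x. P x \<Longrightarrow> b \<le> \<Psi> x"
    and lim: "(\<lambda>k. \<Psi> (p k)) \<longlonglongrightarrow> I"
  obtains q d where "\<And>n. q n \<in> midpoint_hull mid p n" "(\<lambda>n. \<Psi> (q n)) \<longlonglongrightarrow> d" "d \<le> I"
    "\<And>\<epsilon>. 0 < \<epsilon> \<Longrightarrow> \<exists>N. \<forall>m\<ge>N. \<forall>n\<ge>N. D (q m) (q n) < \<epsilon>"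
    "\<And>\<epsilon>. I \<le> d \<Longrightarrow> 0 < \<epsilon> \<Longrightarrow> \<exists>N. \<forall>n\<ge>N. D (p n) (q n) < \<epsilon>"
proof -
  define H where "H n = midpoint_hull mid p n" for n
  have HP: "P x" if "x \<in> H n" for x n using midpoint_hull_invariant[of x mid p n P] that P by (auto simp: H_def)
  have pH: "p k \<in> H n" if "n \<le> k" for n k using that by (auto simp: H_def intro: midpoint_hull.base)
  have Hmono: "H n \<subseteq> H m" if "m \<le> n" for m n using midpoint_hull_mono[OF that] by (auto simp: H_def)
  define d where "d n = (INF x\<in>H n. \<Psi> x)" for n
  have bdd: "bdd_below (\<Psi> ` H n)" for n using below HP by (intro bdd_belowI2[where m=b]) auto
  have ne: "H n \<noteq> {}" for n using pH[of n n] by auto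
  have dle: "d n \<le> \<Psi> x" if "x \<in> H n" for n x unfolding d_def by (rule cINF_lower[OF bdd that])
  have dmono: "d m \<le> d n" if "m \<le> n" for m n
    unfolding d_def by (rule cINF_superset_mono[OF ne bdd Hmono[OF that]]) simp
  have "\<exists>x. x \<in> H n \<and> \<Psi> x < d n + 1 / real (Suc n)" for n
  proof -
    have "(INF x\<in>H n. \<Psi> x) < d n + 1 / real (Suc n)" by (simp add: d_def)
    then show ?thesis using cINF_less_iff[OF ne bdd] by blast
  qed
  then obtain q where q: "\<And>n. q n \<in> H n" "\<And>n. \<Psi> (q n) < d n + 1 / real (Suc n)" by metis
  have dI: "d n \<le> I" for n
    by (rule LIMSEQ_le_const[OF lim]) (use dle pH in blast)
  have "incseq d" using dmono by (auto simp: incseq_def)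
  then obtain d' where d': "d \<longlonglongrightarrow> d'" "\<And>n. d n \<le> d'" by (rule incseq_convergent[of d I]) (use dI in auto)
  have inv: "(\<lambda>n. 1 / real (Suc n)) \<longlonglongrightarrow> 0" using LIMSEQ_inverse_real_of_nat by (simp add: divide_inverse)
  have qlim: "(\<lambda>n. \<Psi> (q n)) \<longlonglongrightarrow> d'"
  proof (rule tendsto_sandwich[OF _ _ d'(1)])
    show "(\<lambda>n. d n + 1 / real (Suc n)) \<longlonglongrightarrow> d'" using tendsto_add[OF d'(1) inv] by simp
  qed (use dle[OF q(1)] less_imp_le[OF q(2)] in auto)
  \<comment> \<open>The midpoint stays in the hull of the same tail, so its value is at least
    \<open>d n\<close>; the gap is thus bounded by the mean excess of the two values over
    \<open>d n\<close>.\<close>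
  have key: "D x y \<le> (\<Psi> x + \<Psi> y) / 2 - d n" if "x \<in> H n" "y \<in> H n" for x y n
  proof -
    have "mid x y \<in> H n" using that by (auto simp: H_def intro: midpoint_hull.mid)
    then show ?thesis using gap[OF HP[OF that(1)] HP[OF that(2)]] dle[of "mid x y" n] by linarith
  qed
  have arith: "G < \<epsilon>" if "G \<le> (X + Y) / 2 - Z" "\<bar>X - d'\<bar> < \<epsilon> / 2" "\<bar>Y - d'\<bar> < \<epsilon> / 2" "\<bar>Z - d'\<bar> < \<epsilon> / 2"
    for G X Y Z \<epsilon> :: real
    using that unfolding abs_less_iff by (simp add: field_simps)
  show thesis
  proof (rule that)
    show "q n \<in> midpoint_hull mid p n" for n using q(1) by (simp add: H_def)
    show "(\<lambda>n. \<Psi> (q n)) \<longlonglongrightarrow> d'" by (rule qlim)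
    show "d' \<le> I" by (rule LIMSEQ_le_const2[OF d'(1)]) (use dI in auto)
    show "\<exists>N. \<forall>m\<ge>N. \<forall>n\<ge>N. D (q m) (q n) < \<epsilon>" if e: "0 < \<epsilon>" for \<epsilon>
    proof -
      obtain N1 where N1: "\<And>n. n \<ge> N1 \<Longrightarrow> \<bar>\<Psi> (q n) - d'\<bar> < \<epsilon> / 2" using LIMSEQ_D[OF qlim half_gt_zero[OF e]] unfolding real_norm_def by blast
      obtain N2 where N2: "\<And>n. n \<ge> N2 \<Longrightarrow> \<bar>d n - d'\<bar> < \<epsilon> / 2" using LIMSEQ_D[OF d'(1) half_gt_zero[OF e]] unfolding real_norm_def by blast
      define N where "N = max N1 N2"
      have "D (q m) (q n) < \<epsilon>" if "m \<ge> N" "n \<ge> N" for m n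
      proof -
        have "q m \<in> H N" "q n \<in> H N" using q(1) Hmono that by blast+
        then have "D (q m) (q n) \<le> (\<Psi> (q m) + \<Psi> (q n)) / 2 - d N" by (rule key)
        moreover have "N1 \<le> m" "N1 \<le> n" "N2 \<le> N" using that by (auto simp: N_def)
        ultimately show ?thesis using arith N1[of m] N1[of n] N2[of N] by blast
      qed
      then show ?thesis by blast
    qed
    show "\<exists>N. \<forall>n\<ge>N. D (p n) (q n) < \<epsilon>" if Id': "I \<le> d'" and e: "0 < \<epsilon>" for \<epsilon>
    proof -
      have Id: "I = d'" using Id' \<open>d' \<le> I\<close> by simp
      obtain N1 where N1: "\<And>n. n \<ge> N1 \<Longrightarrow> \<bar>\<Psi> (q n) - d'\<bar> < \<epsilon> / 2" using LIMSEQ_D[OF qlim half_gt_zero[OF e]] unfolding real_norm_def by blast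
      obtain N2 where N2: "\<And>n. n \<ge> N2 \<Longrightarrow> \<bar>d n - d'\<bar> < \<epsilon> / 2" using LIMSEQ_D[OF d'(1) half_gt_zero[OF e]] unfolding real_norm_def by blast
      obtain N3 where N3: "\<And>n. n \<ge> N3 \<Longrightarrow> \<bar>\<Psi> (p n) - d'\<bar> < \<epsilon> / 2" using LIMSEQ_D[OF lim[unfolded Id] half_gt_zero[OF e]] unfolding real_norm_def by blast
      have "D (p n) (q n) < \<epsilon>" if "n \<ge> max N1 (max N2 N3)" for n
      proof -
        have "D (p n) (q n) \<le> (\<Psi> (p n) + \<Psi> (q n)) / 2 - d n" by (rule key[OF pH[OF order_refl] q(1)])
        moreover have "N1 \<le> n" "N2 \<le> n" "N3 \<le> n" using that by auto
        ultimately show ?thesis using arith N1[of n] N2[of n] N3[of n] by blast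
      qed
      then show ?thesis by blast
    qed
  qed
qed

section \<open>Compactness for entropy plus squared norm\<close>

definition pair_mid :: "('a \<Rightarrow> real) \<times> 'g::real_vector \<Rightarrow> ('a \<Rightarrow> real) \<times> 'g \<Rightarrow> ('a \<Rightarrow> real) \<times> 'g" where
  "pair_mid p q = ((\<lambda>x. (fst p x + fst q x) / 2), (1/2) *\<^sub>R (snd p + snd q))"

lemma norm_midpoint:
  fixes a b :: "'g::real_inner"
  shows "(norm ((1/2) *\<^sub>R (a + b)))\<^sup>2 + (norm (a - b))\<^sup>2 / 4 = ((norm a)\<^sup>2 + (norm b)\<^sup>2) / 2"
  by (simp add: power2_norm_eq_inner inner_add_left inner_add_right inner_diff_left inner_diff_right inner_commute field_simps)

text \<open>Lower semicontinuity of the entropy: Fatou's lemma for the nonnegative functions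
  \<open>xlnx (a n x) + 1\<close> along an almost everywhere convergent subsequence.\<close>

lemma entropy_dens_L1_limit:
  assumes M: "prob_space M" and a: "\<And>n. entropy_dens M (a n)"
    and C: "\<And>\<epsilon>::real. 0 < \<epsilon> \<Longrightarrow> \<exists>N. \<forall>m\<ge>N. \<forall>n\<ge>N. (LINT x|M. \<bar>a m x - a n x\<bar>) < \<epsilon>"
    and ent: "(\<lambda>n. LINT x|M. xlnx (a n x)) \<longlonglongrightarrow> E"
  obtains h where "entropy_dens M h" "(LINT x|M. xlnx (h x)) \<le> E" "(\<lambda>n. LINT x|M. \<bar>a n x - h x\<bar>) \<longlonglongrightarrow> 0"
proof -
  interpret prob_space M by (rule M)
  note A = entropy_densD[OF a]
  note [measurable] = A(5)
  have nn: "(\<integral>\<^sup>+x. dist (a m x) (a n x) \<partial>M) = ennreal (LINT x|M. \<bar>a m x - a n x\<bar>)" for m n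
    using A by (subst nn_integral_eq_integral[symmetric]) (auto simp: dist_real_def)
  obtain r v where r: "strict_mono (r :: nat \<Rightarrow> nat)" and v[measurable]: "v \<in> borel_measurable M"
    and ae: "AE x in M. (\<lambda>n. a (r n) x) \<longlonglongrightarrow> v x"
    and cl: "\<And>\<epsilon>::real. 0 < \<epsilon> \<Longrightarrow> \<exists>N. \<forall>n\<ge>N. (\<integral>\<^sup>+x. dist (a n x) (v x) \<partial>M) \<le> ennreal \<epsilon>"
  proof (rule mean_Cauchy_AE_limit[of a M])
    fix \<epsilon> :: real assume "0 < \<epsilon>"
    then show "\<exists>N. \<forall>m\<ge>N. \<forall>n\<ge>N. (\<integral>\<^sup>+x. dist (a m x) (a n x) \<partial>M) \<le> ennreal \<epsilon>"
      unfolding nn using C[of \<epsilon>] by (meson ennreal_leI less_imp_le)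
  next
    show "a n \<in> borel_measurable M" for n by (rule A(5))
  qed (rule that)
  \<comment> \<open>Truncation makes the limit nonnegative everywhere and does not increase its
    distance from the nonnegative \<open>a n\<close>.\<close>
  define h where "h x = max 0 (v x)" for x
  have hm[measurable]: "h \<in> borel_measurable M" unfolding h_def by measurable
  have h0: "0 \<le> h x" for x by (simp add: h_def)
  have hle: "\<bar>a n x - h x\<bar> \<le> dist (a n x) (v x)" for n x using A(1)[of n x] by (auto simp: h_def dist_real_def)
  have cl': "\<exists>N. \<forall>n\<ge>N. (\<integral>\<^sup>+x. \<bar>a n x - h x\<bar> \<partial>M) \<le> ennreal \<epsilon>" if e: "0 < \<epsilon>" for \<epsilon>
  proof -
    obtain N where N: "\<forall>n\<ge>N. (\<integral>\<^sup>+x. dist (a n x) (v x) \<partial>M) \<le> ennreal \<epsilon>" using cl[OF e] by blast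
    have "(\<integral>\<^sup>+x. \<bar>a n x - h x\<bar> \<partial>M) \<le> (\<integral>\<^sup>+x. dist (a n x) (v x) \<partial>M)" for n
      by (intro nn_integral_mono ennreal_leI hle)
    then show ?thesis using N order_trans by blast
  qed
  obtain N1 where N1: "\<forall>n\<ge>N1. (\<integral>\<^sup>+x. \<bar>a n x - h x\<bar> \<partial>M) \<le> ennreal 1" using cl'[of 1] by auto
  have dint1: "integrable M (\<lambda>x. a N1 x - h x)"
  proof (rule integrableI_bounded)
    have "(\<integral>\<^sup>+x. \<bar>a N1 x - h x\<bar> \<partial>M) \<le> ennreal 1" using N1 by simp
    also have "ennreal 1 < \<infinity>" by simp
    finally show "(\<integral>\<^sup>+x. norm (a N1 x - h x) \<partial>M) < \<infinity>" unfolding real_norm_def .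
  qed measurable
  have hint: "integrable M h" using Bochner_Integration.integrable_diff[OF A(2)[of N1] dint1] by simp
  have dnn: "(\<integral>\<^sup>+x. \<bar>a n x - h x\<bar> \<partial>M) = ennreal (LINT x|M. \<bar>a n x - h x\<bar>)" for n
    using A hint by (intro nn_integral_eq_integral) auto
  have L1: "(\<lambda>n. LINT x|M. \<bar>a n x - h x\<bar>) \<longlonglongrightarrow> 0"
  proof (rule LIMSEQ_I)
    fix \<epsilon> :: real assume e: "0 < \<epsilon>"
    obtain N where N: "\<forall>n\<ge>N. (\<integral>\<^sup>+x. \<bar>a n x - h x\<bar> \<partial>M) \<le> ennreal (\<epsilon>/2)" using cl'[of "\<epsilon>/2"] e by auto
    have "norm ((LINT x|M. \<bar>a n x - h x\<bar>) - 0) < \<epsilon>" if "n \<ge> N" for n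
    proof -
      have "(LINT x|M. \<bar>a n x - h x\<bar>) \<le> \<epsilon> / 2" using N that e unfolding dnn by (simp add: ennreal_le_iff)
      then show ?thesis using e by simp
    qed
    then show "\<exists>no. \<forall>n\<ge>no. norm ((LINT x|M. \<bar>a n x - h x\<bar>) - 0) < \<epsilon>" by blast
  qed
  have "\<bar>1 - (LINT x|M. h x)\<bar> \<le> (LINT x|M. \<bar>a n x - h x\<bar>)" for n
  proof -
    have "1 - (LINT x|M. h x) = (LINT x|M. a n x - h x)" using A hint by simp
    also have "\<bar>\<dots>\<bar> \<le> (LINT x|M. \<bar>a n x - h x\<bar>)" by (rule integral_abs_bound)
    finally show ?thesis .
  qed
  then have "\<bar>1 - (LINT x|M. h x)\<bar> \<le> 0" by (intro LIMSEQ_le_const[OF L1]) blast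
  then have h1: "(LINT x|M. h x) = 1" by simp
  define G where "G n = (LINT x|M. xlnx (a n x)) + 1" for n
  have xa: "0 \<le> xlnx (a n x) + 1" for n x using xlnx_ge_minus_one[OF A(1)[of n x]] by linarith
  have Gnn: "(\<integral>\<^sup>+x. ennreal (xlnx (a n x) + 1) \<partial>M) = ennreal (G n)" for n
  proof -
    have "(\<integral>\<^sup>+x. ennreal (xlnx (a n x) + 1) \<partial>M) = ennreal (LINT x|M. xlnx (a n x) + 1)"
      by (rule nn_integral_eq_integral) (use A(4) xa in auto)
    then show ?thesis using A by (simp add: G_def prob_space)
  qed
  have Glim: "(\<lambda>n. G (r n)) \<longlonglongrightarrow> E + 1"
    unfolding G_def using LIMSEQ_subseq_LIMSEQ[OF ent r] by (intro tendsto_add tendsto_const) (simp add: o_def)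
  have G0: "0 \<le> G n" for n unfolding G_def using entropy_ge_minus_one[OF M a[of n]] by simp
  have E0: "0 \<le> E + 1" by (rule LIMSEQ_le_const[OF Glim]) (use G0 in auto)
  have fat: "(\<integral>\<^sup>+x. ennreal (xlnx (h x) + 1) \<partial>M) \<le> ennreal (E + 1)"
  proof -
    have "(\<integral>\<^sup>+x. ennreal (xlnx (h x) + 1) \<partial>M) = (\<integral>\<^sup>+x. liminf (\<lambda>n. ennreal (xlnx (a (r n) x) + 1)) \<partial>M)"
    proof (rule nn_integral_cong_AE)
      show "AE x in M. ennreal (xlnx (h x) + 1) = liminf (\<lambda>n. ennreal (xlnx (a (r n) x) + 1))"
        using ae
      proof eventually_elim
        fix x assume x: "(\<lambda>n. a (r n) x) \<longlonglongrightarrow> v x"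
        have "0 \<le> v x" by (rule LIMSEQ_le_const[OF x]) (use A(1) in auto)
        then have "(\<lambda>n. a (r n) x) \<longlonglongrightarrow> h x" using x by (simp add: h_def)
        then have "(\<lambda>n. xlnx (a (r n) x)) \<longlonglongrightarrow> xlnx (h x)" by (rule isCont_xlnx_nonneg[rotated]) (rule A(1))
        then have "(\<lambda>n. ennreal (xlnx (a (r n) x) + 1)) \<longlonglongrightarrow> ennreal (xlnx (h x) + 1)"
          by (intro tendsto_ennrealI tendsto_intros)
        then show "ennreal (xlnx (h x) + 1) = liminf (\<lambda>n. ennreal (xlnx (a (r n) x) + 1))"
          by (intro lim_imp_Liminf[symmetric]) auto
      qed
    qed
    also have "\<dots> \<le> liminf (\<lambda>n. \<integral>\<^sup>+x. ennreal (xlnx (a (r n) x) + 1) \<partial>M)"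
      by (rule nn_integral_liminf) measurable
    also have "\<dots> = ennreal (E + 1)"
      unfolding Gnn by (intro lim_imp_Liminf tendsto_ennrealI Glim) auto
    finally show ?thesis .
  qed
  have xh: "0 \<le> xlnx (h x) + 1" for x using xlnx_ge_minus_one[OF h0[of x]] by linarith
  have int1: "integrable M (\<lambda>x. xlnx (h x) + 1)"
  proof (rule integrableI_nonneg)
    show "(\<integral>\<^sup>+x. ennreal (xlnx (h x) + 1) \<partial>M) < \<infinity>" by (rule order_le_less_trans[OF fat]) simp
  qed (use xh in auto)
  have int2: "integrable M (\<lambda>x. xlnx (h x))"
    using Bochner_Integration.integrable_diff[OF int1 integrable_const[of 1]] by simp
  have "ennreal (LINT x|M. xlnx (h x) + 1) \<le> ennreal (E + 1)"
    using fat by (subst nn_integral_eq_integral[symmetric]) (use int1 xh in auto)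
  then have "(LINT x|M. xlnx (h x) + 1) \<le> E + 1" using E0 by (simp add: ennreal_le_iff)
  then have le: "(LINT x|M. xlnx (h x)) \<le> E" using int2 by (simp add: prob_space)
  have "entropy_dens M h" using h0 hint h1 int2 by (simp add: entropy_dens_def has_bochner_integral_iff)
  then show thesis by (rule that[OF _ le L1])
qed

text \<open>The last conclusion is conditional because the reverse inequality becomes available only
  after \<open>h\<close> has been recognised as the density of an admissible measure.\<close>

lemma entropy_minimising_compactness:
  fixes f :: "nat \<Rightarrow> 'a \<Rightarrow> real" and g :: "nat \<Rightarrow> 'g::{real_inner,complete_space}"
  assumes M: "prob_space M" and f: "\<And>k. entropy_dens M (f k)" and \<delta>: "0 < \<delta>"
    and lim: "(\<lambda>k. (LINT x|M. xlnx (f k x)) + \<delta> * (norm (g k))\<^sup>2) \<longlonglongrightarrow> I"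
  obtains h gs q where "entropy_dens M h" "(LINT x|M. xlnx (h x)) + \<delta> * (norm gs)\<^sup>2 \<le> I"
    "\<And>n. q n \<in> midpoint_hull pair_mid (\<lambda>k. (f k, g k)) n" "\<And>n. entropy_dens M (fst (q n))"
    "(\<lambda>n. LINT x|M. \<bar>fst (q n) x - h x\<bar>) \<longlonglongrightarrow> 0" "(\<lambda>n. snd (q n)) \<longlonglongrightarrow> gs"
    "I \<le> (LINT x|M. xlnx (h x)) + \<delta> * (norm gs)\<^sup>2 \<Longrightarrow> (\<lambda>k. LINT x|M. \<bar>f k x - h x\<bar>) \<longlonglongrightarrow> 0 \<and> g \<longlonglongrightarrow> gs"
proof -
  interpret prob_space M by (rule M)
  define \<Psi> where "\<Psi> p = (LINT x|M. xlnx (fst p x)) + \<delta> * (norm (snd p))\<^sup>2" for p :: "('a \<Rightarrow> real) \<times> 'g"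
  \<comment> \<open>The weights 1/8 and 1/4 are the gaps in \<open>entropy_dens_midpoint\<close> and
    \<open>norm_midpoint\<close>.\<close>
  define D where "D p q = (LINT x|M. \<bar>fst p x - fst q x\<bar>)\<^sup>2 / 8 + \<delta> * ((norm (snd p - snd q))\<^sup>2 / 4)" for p q :: "('a \<Rightarrow> real) \<times> 'g"
  define P where "P p = entropy_dens M (fst p)" for p :: "('a \<Rightarrow> real) \<times> 'g"
  let ?p = "\<lambda>k. (f k, g k)"
  have Pp: "P (?p k)" for k using f by (simp add: P_def)
  have Pm: "P (pair_mid x y)" if "P x" "P y" for x y
    using entropy_dens_midpoint(1)[OF M] that by (simp add: P_def pair_mid_def)
  have gap: "\<Psi> (pair_mid x y) + D x y \<le> (\<Psi> x + \<Psi> y) / 2" if "P x" "P y" for x y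
  proof -
    have 1: "(LINT t|M. xlnx ((fst x t + fst y t) / 2)) + (LINT t|M. \<bar>fst x t - fst y t\<bar>)\<^sup>2 / 8
      \<le> ((LINT t|M. xlnx (fst x t)) + (LINT t|M. xlnx (fst y t))) / 2"
      using entropy_dens_midpoint(2)[OF M] that by (simp add: P_def)
    have 2: "\<delta> * (norm ((1/2) *\<^sub>R (snd x + snd y)))\<^sup>2 + \<delta> * ((norm (snd x - snd y))\<^sup>2 / 4)
        = (\<delta> * (norm (snd x))\<^sup>2 + \<delta> * (norm (snd y))\<^sup>2) / 2"
      unfolding distrib_left[symmetric] norm_midpoint by simp
    have comb: "(A + G) + (B + H) \<le> ((a + a') + (b + b')) / 2" if "A + B \<le> (a + b) / 2" "G + H = (a' + b') / 2"
      for A B G H a b a' b' :: real using that by (simp add: field_simps)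
    show ?thesis unfolding \<Psi>_def D_def pair_mid_def fst_conv snd_conv by (rule comb[OF 1 2])
  qed
  have below: "- 1 \<le> \<Psi> x" if "P x" for x
  proof -
    have "- 1 \<le> (LINT t|M. xlnx (fst x t))" using entropy_ge_minus_one[OF M] that by (simp add: P_def)
    moreover have "0 \<le> \<delta> * (norm (snd x))\<^sup>2" using \<delta> by simp
    ultimately show ?thesis unfolding \<Psi>_def by linarith
  qed
  have lim': "(\<lambda>k. \<Psi> (?p k)) \<longlonglongrightarrow> I" using lim by (simp add: \<Psi>_def)
  obtain q d where q: "\<And>n. q n \<in> midpoint_hull pair_mid ?p n" and qd: "(\<lambda>n. \<Psi> (q n)) \<longlonglongrightarrow> d" and dI: "d \<le> I"
    and cau: "\<And>\<epsilon>. 0 < \<epsilon> \<Longrightarrow> \<exists>N. \<forall>m\<ge>N. \<forall>n\<ge>N. D (q m) (q n) < \<epsilon>"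
    and app: "\<And>\<epsilon>. I \<le> d \<Longrightarrow> 0 < \<epsilon> \<Longrightarrow> \<exists>N. \<forall>n\<ge>N. D (?p n) (q n) < \<epsilon>"
  proof (rule midpoint_convex_minimising[where P=P and p="?p" and mid=pair_mid and \<Psi>=\<Psi> and D=D and b="- 1" and I=I])
    show "P (?p k)" for k by (rule Pp)
    show "P (pair_mid x y)" if "P x" "P y" for x y by (rule Pm[OF that])
    show "\<Psi> (pair_mid x y) + D x y \<le> (\<Psi> x + \<Psi> y) / 2" if "P x" "P y" for x y by (rule gap[OF that])
    show "- 1 \<le> \<Psi> x" if "P x" for x by (rule below[OF that])
    show "(\<lambda>k. \<Psi> (?p k)) \<longlonglongrightarrow> I" by (rule lim')
  qed (rule that)
  have Pq: "entropy_dens M (fst (q n))" for n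
    using midpoint_hull_invariant[OF q, of P] Pp Pm by (auto simp: P_def)
  have D1: "(LINT x|M. \<bar>fst p x - fst p' x\<bar>) < \<epsilon>" and D2: "norm (snd p - snd p') < \<epsilon>"
    if e: "0 < \<epsilon>" and d: "D p p' < min (\<epsilon>\<^sup>2 / 8) (\<delta> * (\<epsilon>\<^sup>2 / 4))" for p p' \<epsilon>
  proof -
    have "(LINT x|M. \<bar>fst p x - fst p' x\<bar>)\<^sup>2 / 8 \<le> D p p'" using \<delta> by (simp add: D_def)
    then have "(LINT x|M. \<bar>fst p x - fst p' x\<bar>)\<^sup>2 < \<epsilon>\<^sup>2" using d by simp
    then show "(LINT x|M. \<bar>fst p x - fst p' x\<bar>) < \<epsilon>" using e by (meson less_imp_le power2_less_imp_less)
    have "\<delta> * ((norm (snd p - snd p'))\<^sup>2 / 4) \<le> D p p'" by (simp add: D_def)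
    then have "\<delta> * ((norm (snd p - snd p'))\<^sup>2 / 4) < \<delta> * (\<epsilon>\<^sup>2 / 4)" using d by simp
    then have "(norm (snd p - snd p'))\<^sup>2 < \<epsilon>\<^sup>2" using \<delta> by simp
    then show "norm (snd p - snd p') < \<epsilon>" using e by (meson less_imp_le power2_less_imp_less)
  qed
  have mpos: "0 < min (\<epsilon>\<^sup>2 / 8) (\<delta> * (\<epsilon>\<^sup>2 / 4))" if "0 < \<epsilon>" for \<epsilon> using that \<delta> by simp
  have "Cauchy (\<lambda>n. snd (q n))"
  proof (rule metric_CauchyI)
    fix \<epsilon> :: real assume e: "0 < \<epsilon>"
    show "\<exists>N. \<forall>m\<ge>N. \<forall>n\<ge>N. dist (snd (q m)) (snd (q n)) < \<epsilon>"
      using cau[OF mpos[OF e]] D2[OF e] unfolding dist_norm by blast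
  qed
  then obtain gs where gs: "(\<lambda>n. snd (q n)) \<longlonglongrightarrow> gs" using Cauchy_convergent convergentD by blast
  \<comment> \<open>Only the sum of both terms is known to converge; norm convergence of
    \<open>snd (q n)\<close> separates them.\<close>
  have ent: "(\<lambda>n. LINT x|M. xlnx (fst (q n) x)) \<longlonglongrightarrow> d - \<delta> * (norm gs)\<^sup>2"
  proof -
    have "(\<lambda>n. \<Psi> (q n) - \<delta> * (norm (snd (q n)))\<^sup>2) \<longlonglongrightarrow> d - \<delta> * (norm gs)\<^sup>2"
      by (intro tendsto_intros qd gs)
    then show ?thesis by (simp add: \<Psi>_def)
  qed
  have C: "\<exists>N. \<forall>m\<ge>N. \<forall>n\<ge>N. (LINT x|M. \<bar>fst (q m) x - fst (q n) x\<bar>) < \<epsilon>" if e: "0 < \<epsilon>" for \<epsilon> :: real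
    using cau[OF mpos[OF e]] D1[OF e] by blast
  obtain h where h: "entropy_dens M h" "(LINT x|M. xlnx (h x)) \<le> d - \<delta> * (norm gs)\<^sup>2"
    "(\<lambda>n. LINT x|M. \<bar>fst (q n) x - h x\<bar>) \<longlonglongrightarrow> 0"
    using entropy_dens_L1_limit[OF M Pq C ent] by blast
  show thesis
  proof (rule that[OF h(1) _ q Pq h(3) gs])
    show "(LINT x|M. xlnx (h x)) + \<delta> * (norm gs)\<^sup>2 \<le> I" using h(2) dI by linarith
    assume "I \<le> (LINT x|M. xlnx (h x)) + \<delta> * (norm gs)\<^sup>2"
    then have Id: "I \<le> d" using h(2) by linarith
    have gq: "(\<lambda>n. g n - snd (q n)) \<longlonglongrightarrow> 0"
    proof (rule LIMSEQ_I)
      fix \<epsilon> :: real assume e: "0 < \<epsilon>"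
      obtain N where N: "\<forall>n\<ge>N. D (?p n) (q n) < min (\<epsilon>\<^sup>2 / 8) (\<delta> * (\<epsilon>\<^sup>2 / 4))" using app[OF Id mpos[OF e]] by blast
      have "norm (g n - snd (q n) - 0) < \<epsilon>" if "n \<ge> N" for n
        using D2[OF e, of "?p n" "q n"] N that by simp
      then show "\<exists>no. \<forall>n\<ge>no. norm (g n - snd (q n) - 0) < \<epsilon>" by blast
    qed
    have fq: "(\<lambda>n. LINT x|M. \<bar>f n x - fst (q n) x\<bar>) \<longlonglongrightarrow> 0"
    proof (rule LIMSEQ_I)
      fix \<epsilon> :: real assume e: "0 < \<epsilon>"
      obtain N where N: "\<forall>n\<ge>N. D (?p n) (q n) < min (\<epsilon>\<^sup>2 / 8) (\<delta> * (\<epsilon>\<^sup>2 / 4))" using app[OF Id mpos[OF e]] by blast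
      have "norm ((LINT x|M. \<bar>f n x - fst (q n) x\<bar>) - 0) < \<epsilon>" if "n \<ge> N" for n
        using D1[OF e, of "?p n" "q n"] N that by simp
      then show "\<exists>no. \<forall>n\<ge>no. norm ((LINT x|M. \<bar>f n x - fst (q n) x\<bar>) - 0) < \<epsilon>" by blast
    qed
    have "g \<longlonglongrightarrow> gs" using tendsto_add[OF gq gs] by simp
    moreover have "(\<lambda>k. LINT x|M. \<bar>f k x - h x\<bar>) \<longlonglongrightarrow> 0"
    proof (rule tendsto_sandwich[OF _ _ tendsto_const])
      show "(\<lambda>n. (LINT x|M. \<bar>f n x - fst (q n) x\<bar>) + (LINT x|M. \<bar>fst (q n) x - h x\<bar>)) \<longlonglongrightarrow> 0"
        using tendsto_add[OF fq h(3)] by simp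
      have "(LINT x|M. \<bar>f n x - h x\<bar>) \<le> (LINT x|M. \<bar>f n x - fst (q n) x\<bar>) + (LINT x|M. \<bar>fst (q n) x - h x\<bar>)" for n
      proof -
        have i: "integrable M (f n)" "integrable M (fst (q n))" "integrable M h"
          using entropy_densD(2) f Pq h(1) by blast+
        have "(LINT x|M. \<bar>f n x - h x\<bar>) \<le> (LINT x|M. \<bar>f n x - fst (q n) x\<bar> + \<bar>fst (q n) x - h x\<bar>)"
          by (rule integral_mono) (use i in auto)
        then show ?thesis using i by simp
      qed
      then show "\<forall>\<^sub>F n in sequentially. (LINT x|M. \<bar>f n x - h x\<bar>) \<le> (LINT x|M. \<bar>f n x - fst (q n) x\<bar>) + (LINT x|M. \<bar>fst (q n) x - h x\<bar>)"
        by simp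
    qed simp
    ultimately show "(\<lambda>k. LINT x|M. \<bar>f k x - h x\<bar>) \<longlonglongrightarrow> 0 \<and> g \<longlonglongrightarrow> gs" by blast
  qed
qed

section \<open>Divergence and total variation of densities\<close>

lemma prob_space_density:
  assumes "\<And>x. 0 \<le> f x" "has_bochner_integral M f (1::real)"
  shows "prob_space (density M (\<lambda>x. ennreal (f x)))"
proof (rule prob_spaceI)
  have [measurable]: "f \<in> borel_measurable M" using assms(2) by (auto simp: has_bochner_integral_iff)
  have "emeasure (density M (\<lambda>x. ennreal (f x))) (space (density M (\<lambda>x. ennreal (f x)))) = (\<integral>\<^sup>+x. ennreal (f x) \<partial>M)"
    by (simp add: emeasure_density cong: nn_integral_cong)
  also have "\<dots> = ennreal (LINT x|M. f x)"
    by (rule nn_integral_eq_integral) (use assms in \<open>auto simp: has_bochner_integral_iff\<close>)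
  finally show "emeasure (density M (\<lambda>x. ennreal (f x))) (space (density M (\<lambda>x. ennreal (f x)))) = 1"
    using assms(2) by (simp add: has_bochner_integral_iff)
qed

lemma RN_deriv_density_real:
  assumes M: "prob_space M" and N: "prob_space N" "sets N = sets M" and ac: "absolutely_continuous M N"
  defines "f \<equiv> \<lambda>x. enn2real (RN_deriv M N x)"
  shows "N = density M (\<lambda>x. ennreal (f x))" "has_bochner_integral M f 1"
proof -
  interpret prob_space M by (rule M)
  interpret N: prob_space N by (rule N)
  have [measurable]: "f \<in> borel_measurable M" unfolding f_def by measurable
  have d: "density M (RN_deriv M N) = N" by (rule density_RN_deriv[OF ac N(2)])
  have "AE x in M. RN_deriv M N x \<noteq> \<infinity>"
    by (rule RN_deriv_finite) (use ac N N.sigma_finite_measure_axioms in auto)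
  then have ae: "AE x in M. RN_deriv M N x = ennreal (f x)"
    by eventually_elim (simp add: f_def less_top)
  have "density M (RN_deriv M N) = density M (\<lambda>x. ennreal (f x))"
    by (rule density_cong) (use ae in auto)
  then show eq: "N = density M (\<lambda>x. ennreal (f x))" using d by simp
  have "(\<integral>\<^sup>+x. ennreal (f x) \<partial>M) = emeasure N (space M)"
    by (subst eq) (simp add: emeasure_density cong: nn_integral_cong)
  also have "\<dots> = 1" using N.emeasure_space_1 sets_eq_imp_space_eq[OF N(2)] by simp
  finally have nn: "(\<integral>\<^sup>+x. ennreal (f x) \<partial>M) = ennreal 1" by simp
  show "has_bochner_integral M f 1"
    by (rule has_bochner_integral_nn_integral[OF _ _ _ nn]) (auto simp: f_def)
qed

text \<open>Integration against the measure with density \<open>f\<close> weights the log-density by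
  \<open>f\<close>; the base \<open>exp 1\<close> makes \<open>log\<close> natural.\<close>

lemma kl_div_density_iff:
  assumes M: "prob_space M" and f[measurable]: "f \<in> borel_measurable M" and f0: "\<And>x. 0 \<le> f x"
  shows "integrable (density M (\<lambda>x. ennreal (f x))) (entropy_density (exp 1) M (density M (\<lambda>x. ennreal (f x))))
      \<longleftrightarrow> integrable M (\<lambda>x. xlnx (f x))"
    and "KL_divergence (exp 1) M (density M (\<lambda>x. ennreal (f x))) = (LINT x|M. xlnx (f x))"
proof -
  interpret prob_space M by (rule M)
  have e1: "(1::real) < exp 1" by simp
  have lg: "log (exp 1) = ln" by (simp add: fun_eq_iff log_def)
  show "KL_divergence (exp 1) M (density M (\<lambda>x. ennreal (f x))) = (LINT x|M. xlnx (f x))"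
    using KL_density[OF e1 f] f0 by (simp add: lg xlnx_def)
  let ?N = "density M (\<lambda>x. ennreal (f x))"
  have "AE x in M. ennreal (f x) = RN_deriv M ?N x" by (rule RN_deriv_unique) auto
  then have ae: "AE x in M. f x * entropy_density (exp 1) M ?N x = xlnx (f x)"
  proof eventually_elim
    fix x assume r: "ennreal (f x) = RN_deriv M ?N x"
    have "enn2real (RN_deriv M ?N x) = f x" unfolding r[symmetric] using f0 by simp
    then show "f x * entropy_density (exp 1) M ?N x = xlnx (f x)" by (simp add: entropy_density_def lg xlnx_def)
  qed
  have m[measurable]: "entropy_density (exp 1) M ?N \<in> borel_measurable M" by (rule measurable_entropy_density)
  have "integrable ?N (entropy_density (exp 1) M ?N) \<longleftrightarrow> integrable M (\<lambda>x. f x *\<^sub>R entropy_density (exp 1) M ?N x)"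
    by (rule integrable_density) (use f0 in auto)
  also have "\<dots> \<longleftrightarrow> integrable M (\<lambda>x. xlnx (f x))"
    by (rule integrable_cong_AE) (use ae in auto)
  finally show "integrable ?N (entropy_density (exp 1) M ?N) \<longleftrightarrow> integrable M (\<lambda>x. xlnx (f x))" .
qed

lemma kl_div_density:
  assumes M: "prob_space M" and f: "entropy_dens M f"
  shows "kl_div (density M (\<lambda>x. ennreal (f x))) M = ereal (LINT x|M. xlnx (f x))"
proof -
  note F = entropy_densD[OF f]
  note k = kl_div_density_iff[OF M F(5) F(1)]
  have "absolutely_continuous M (density M (\<lambda>x. ennreal (f x)))"
    by (rule absolutely_continuousI_density) (use F(5) in auto)
  then show ?thesis using k F(4) by (simp add: kl_div_def)
qed

lemma kl_div_finite_imp_density: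
  assumes M: "prob_space M" and N: "prob_space N" "sets N = sets M" and fin: "kl_div N M < \<infinity>"
  obtains f where "entropy_dens M f" "N = density M (\<lambda>x. ennreal (f x))" "kl_div N M = ereal (LINT x|M. xlnx (f x))"
proof -
  have ac: "absolutely_continuous M N" and int: "integrable N (entropy_density (exp 1) M N)"
    using fin by (auto simp: kl_div_def split: if_splits)
  define f where "f x = enn2real (RN_deriv M N x)" for x
  note rn = RN_deriv_density_real[OF M N ac, folded f_def]
  have fm: "f \<in> borel_measurable M" and f0: "\<And>x. 0 \<le> f x" by (simp_all add: f_def[abs_def])
  have "integrable M (\<lambda>x. xlnx (f x))" using int kl_div_density_iff(1)[OF M fm f0] unfolding rn(1)[symmetric] by simp
  then have e: "entropy_dens M f" using rn(2) f0 by (simp add: entropy_dens_def)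
  show thesis using that[OF e rn(1)] kl_div_density[OF M e] unfolding rn(1)[symmetric] by simp
qed

text \<open>\<open>tv_dist\<close> selects its dominating measure by \<open>SOME\<close>.
  Integrating the sign \<open>s\<close> of \<open>a - b\<close> against both measures expresses the
  distance independently of that choice, and the densities with respect to \<open>M\<close> can take
  over; the factor 1/2 is given away.\<close>

lemma tv_dist_density_le:
  assumes M: "prob_space M" and f: "entropy_dens M f" and g: "entropy_dens M g"
  shows "0 \<le> tv_dist (density M (\<lambda>x. ennreal (f x))) (density M (\<lambda>x. ennreal (g x)))"
    and "tv_dist (density M (\<lambda>x. ennreal (f x))) (density M (\<lambda>x. ennreal (g x))) \<le> (LINT x|M. \<bar>f x - g x\<bar>)"
proof -
  interpret prob_space M by (rule M)
  note F = entropy_densD[OF f] and G = entropy_densD[OF g]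
  note [measurable] = F(5) G(5)
  let ?f = "density M (\<lambda>x. ennreal (f x))" and ?g = "density M (\<lambda>x. ennreal (g x))"
  define l where "l = (SOME l. prob_space l \<and> sets l = sets ?f \<and> absolutely_continuous l ?f \<and> absolutely_continuous l ?g)"
  \<comment> \<open>\<open>M\<close> witnesses that the choice is possible, so \<open>l\<close> does
    dominate both measures.\<close>
  have "prob_space M \<and> sets M = sets ?f \<and> absolutely_continuous M ?f \<and> absolutely_continuous M ?g"
    using M by (auto intro!: absolutely_continuousI_density)
  then have l: "prob_space l \<and> sets l = sets ?f \<and> absolutely_continuous l ?f \<and> absolutely_continuous l ?g"
    unfolding l_def by (rule someI)
  have lM[measurable_cong]: "sets l = sets M" using l by simp
  have pf: "prob_space ?f" and pg: "prob_space ?g"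
    using f g by (auto intro!: prob_space_density simp: entropy_dens_def)
  define a where "a = (\<lambda>x. enn2real (RN_deriv l ?f x))"
  define b where "b = (\<lambda>x. enn2real (RN_deriv l ?g x))"
  have a: "?f = density l (\<lambda>x. ennreal (a x))" "has_bochner_integral l a 1"
    using RN_deriv_density_real[of l ?f] l pf by (auto simp: a_def)
  have b: "?g = density l (\<lambda>x. ennreal (b x))" "has_bochner_integral l b 1"
    using RN_deriv_density_real[of l ?g] l pg by (auto simp: b_def)
  have a0: "0 \<le> a x" and b0: "0 \<le> b x" for x by (simp_all add: a_def b_def)
  have tv: "tv_dist ?f ?g = (1/2) * (LINT x|l. \<bar>a x - b x\<bar>)"
    by (simp add: tv_dist_def Let_def a_def b_def l_def)
  show "0 \<le> tv_dist ?f ?g" unfolding tv by simp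
  have am: "a \<in> borel_measurable l" and bm: "b \<in> borel_measurable l"
    using a(2) b(2) by (auto simp: has_bochner_integral_iff)
  have [measurable]: "a \<in> borel_measurable M" "b \<in> borel_measurable M"
    using am bm lM by (simp_all cong: measurable_cong_sets)
  define s :: "'a \<Rightarrow> real" where "s x = (if b x \<le> a x then 1 else - 1)" for x
  have sm[measurable]: "s \<in> borel_measurable M" unfolding s_def by measurable
  have sl: "s \<in> borel_measurable l" using sm lM by (simp cong: measurable_cong_sets)
  have sabs: "\<bar>s x\<bar> \<le> 1" for x by (simp add: s_def)
  have ia: "integrable l (\<lambda>x. a x * s x)"
    by (rule Bochner_Integration.integrable_bound[of l a]) (use a(2) a0 am sl in \<open>auto simp: has_bochner_integral_iff s_def\<close>)
  have ib: "integrable l (\<lambda>x. b x * s x)"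
    by (rule Bochner_Integration.integrable_bound[of l b]) (use b(2) b0 bm sl in \<open>auto simp: has_bochner_integral_iff s_def\<close>)
  have if': "integrable M (\<lambda>x. f x * s x)"
    by (rule Bochner_Integration.integrable_bound[of M f]) (use F in \<open>auto simp: s_def\<close>)
  have ig: "integrable M (\<lambda>x. g x * s x)"
    by (rule Bochner_Integration.integrable_bound[of M g]) (use G in \<open>auto simp: s_def\<close>)
  have "(LINT x|l. \<bar>a x - b x\<bar>) = (LINT x|l. a x * s x - b x * s x)"
    by (intro Bochner_Integration.integral_cong refl) (simp add: s_def)
  also have "\<dots> = (LINT x|l. a x * s x) - (LINT x|l. b x * s x)" using ia ib by simp
  also have "(LINT x|l. a x * s x) = (LINT x|?f. s x)"
    unfolding a(1) by (subst integral_density) (use am sl a0 in auto)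
  also have "(LINT x|?f. s x) = (LINT x|M. f x * s x)"
    by (subst integral_density) (use F in auto)
  also have "(LINT x|l. b x * s x) = (LINT x|?g. s x)"
    unfolding b(1) by (subst integral_density) (use bm sl b0 in auto)
  also have "(LINT x|?g. s x) = (LINT x|M. g x * s x)"
    by (subst integral_density) (use G in auto)
  also have "(LINT x|M. f x * s x) - (LINT x|M. g x * s x) = (LINT x|M. f x * s x - g x * s x)"
    using if' ig by simp
  also have "\<dots> \<le> (LINT x|M. \<bar>f x - g x\<bar>)"
    by (rule integral_mono) (use if' ig F G in \<open>auto simp: s_def\<close>)
  finally have "(LINT x|l. \<bar>a x - b x\<bar>) \<le> (LINT x|M. \<bar>f x - g x\<bar>)" .
  moreover have "0 \<le> (LINT x|M. \<bar>f x - g x\<bar>)" by simp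
  ultimately show "tv_dist ?f ?g \<le> (LINT x|M. \<bar>f x - g x\<bar>)" unfolding tv by linarith
qed

section \<open>Tightness of Gaussian measures\<close>

text \<open>The density is at most \<open>1 / (sqrt (2 * pi) * \<sigma>)\<close> and
  \<open>sqrt (2 * pi) \<ge> 2\<close>, so mass 1/2 on an interval of length \<open>2 * R\<close>
  forces \<open>\<sigma> \<le> 2 * R\<close>. If the mean exceeded \<open>5 * R\<close> in modulus,
  the whole interval would be at distance at least \<open>4 * R\<close> from it, and the variance
  would be at least \<open>8 * R\<^sup>2\<close>, more than \<open>(2 * R)\<^sup>2\<close>.\<close>

lemma normal_law_tight:
  assumes s: "0 \<le> \<sigma>" and R: "0 < R" and half: "1/2 \<le> measure (normal_law a \<sigma>) {- R..R}"
  shows "\<sigma> \<le> 2 * R \<and> \<bar>a\<bar> \<le> 5 * R"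
proof (cases "\<sigma> = 0")
  case True
  have "measure (normal_law a \<sigma>) {- R..R} = indicator {- R..R} a"
    using True by (simp add: normal_law_def measure_return)
  then have "a \<in> {- R..R}" using half by (cases "a \<in> {- R..R}") auto
  then show ?thesis using True R by auto
next
  case False
  then have sp: "0 < \<sigma>" using s by simp
  interpret N: real_distribution "normal_law a \<sigma>" by (rule real_distribution_normal_law[OF s])
  have nl: "normal_law a \<sigma> = density lborel (\<lambda>t. ennreal (normal_density a \<sigma> t))" using False by (simp add: normal_law_def)
  define c where "c = 1 / (sqrt (2 * pi) * \<sigma>)"
  have c0: "0 \<le> c" using sp by (simp add: c_def)
  have nd: "normal_density a \<sigma> t \<le> c" for t
  proof -
    have "normal_density a \<sigma> t = c * exp (- (t - a)\<^sup>2 / (2 * \<sigma>\<^sup>2))"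
      using sp by (simp add: normal_density_def c_def real_sqrt_mult)
    also have "\<dots> \<le> c * 1" using c0 by (intro mult_left_mono) auto
    finally show ?thesis by simp
  qed
  have "emeasure (normal_law a \<sigma>) {- R..R} = (\<integral>\<^sup>+t. ennreal (normal_density a \<sigma> t) * indicator {- R..R} t \<partial>lborel)"
    unfolding nl by (rule emeasure_density) auto
  also have "\<dots> \<le> (\<integral>\<^sup>+t. ennreal c * indicator {- R..R} t \<partial>lborel)"
    by (intro nn_integral_mono mult_right_mono ennreal_leI nd) auto
  also have "\<dots> = ennreal c * emeasure lborel {- R..R}" by (rule nn_integral_cmult_indicator) simp
  also have "\<dots> = ennreal (c * (2 * R))" using R c0 by (simp add: ennreal_mult')
  finally have "measure (normal_law a \<sigma>) {- R..R} \<le> c * (2 * R)"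
    using c0 R by (simp add: N.emeasure_eq_measure ennreal_le_iff)
  then have "1 / 2 \<le> c * (2 * R)" using half by linarith
  then have q: "sqrt (2 * pi) * \<sigma> \<le> 4 * R" using sp by (simp add: c_def field_simps)
  have "2 \<le> sqrt (2 * pi)" using pi_ge_two by (intro real_le_rsqrt) (simp add: power2_eq_square)
  then have "2 * \<sigma> \<le> sqrt (2 * pi) * \<sigma>" using sp by (intro mult_right_mono) auto
  then have \<sigma>R: "\<sigma> \<le> 2 * R" using q by linarith
  have "\<bar>a\<bar> \<le> 5 * R"
  proof (rule ccontr)
    assume big: "\<not> \<bar>a\<bar> \<le> 5 * R"
    have "16 * R\<^sup>2 * indicator {- R..R} t \<le> (t - a)\<^sup>2" for t
    proof (cases "t \<in> {- R..R}")
      case True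
      then have "4 * R \<le> \<bar>t - a\<bar>" using big by auto
      then have "(4 * R)\<^sup>2 \<le> \<bar>t - a\<bar>\<^sup>2" using R by (intro power_mono) auto
      then show ?thesis using True by (simp add: power_mult_distrib)
    qed simp
    then have "(LINT t|normal_law a \<sigma>. 16 * R\<^sup>2 * indicator {- R..R} t) \<le> (LINT t|normal_law a \<sigma>. (t - a)\<^sup>2)"
      using normal_law_moments(2)[OF s, of a]
      by (intro integral_mono) (auto simp: has_bochner_integral_iff less_top[symmetric])
    then have "16 * R\<^sup>2 * measure (normal_law a \<sigma>) {- R..R} \<le> \<sigma>\<^sup>2"
      using normal_law_moments(2)[OF s, of a] by (simp add: has_bochner_integral_iff)
    moreover have "16 * R\<^sup>2 * (1/2) \<le> 16 * R\<^sup>2 * measure (normal_law a \<sigma>) {- R..R}"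
      using half by (intro mult_left_mono) auto
    moreover have "\<sigma>\<^sup>2 \<le> (2 * R)\<^sup>2" using \<sigma>R s by (intro power_mono) auto
    ultimately have "16 * R\<^sup>2 * (1/2) \<le> (2 * R)\<^sup>2" by (meson order_trans)
    then have "8 * R\<^sup>2 \<le> 4 * R\<^sup>2" by (simp add: power_mult_distrib)
    then show False using R by simp
  qed
  then show ?thesis using \<sigma>R by simp
qed

text \<open>The ball projects into an interval of radius \<open>R * norm h\<close> for every
  direction \<open>h\<close>; the bound on the mean is the case \<open>h = m\<close>.\<close>

lemma gaussian_tight:
  fixes m :: "'h::{real_inner,second_countable_topology}"
  assumes g: "is_gaussian \<nu> m K" and R: "0 < R" and half: "1/2 \<le> measure \<nu> {x::'h. norm x \<le> R}"
  shows "norm m \<le> 5 * R" and "h \<bullet> K h \<le> (2 * R * norm h)\<^sup>2"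
proof -
  have pr: "prob_space \<nu>" and st: "sets \<nu> = sets borel" using g by (auto simp: is_gaussian_def gaussian_measure_def)
  interpret prob_space \<nu> by (rule pr)
  have [measurable]: "(\<lambda>x. x \<bullet> h) \<in> borel_measurable \<nu>" for h using st by (simp cong: measurable_cong_sets)
  have sp: "space \<nu> = UNIV" using sets_eq_imp_space_eq[OF st] by simp
  have main: "sqrt (h \<bullet> K h) \<le> 2 * (R * norm h) \<and> \<bar>m \<bullet> h\<bar> \<le> 5 * (R * norm h)" if h: "h \<noteq> 0" for h
  proof (rule normal_law_tight)
    show "0 \<le> sqrt (h \<bullet> K h)" using is_gaussian_marginal(1)[OF g] by simp
    show "0 < R * norm h" using R h by simp
    have "measure \<nu> {x. norm x \<le> R} \<le> measure \<nu> ((\<lambda>x. x \<bullet> h) -` {- (R * norm h)..R * norm h} \<inter> space \<nu>)"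
    proof (rule finite_measure_mono)
      show "{x. norm x \<le> R} \<subseteq> (\<lambda>x. x \<bullet> h) -` {- (R * norm h)..R * norm h} \<inter> space \<nu>"
      proof
        fix x :: 'h assume "x \<in> {x. norm x \<le> R}"
        then have "\<bar>x \<bullet> h\<bar> \<le> R * norm h"
          using Cauchy_Schwarz_ineq2[of x h] mult_right_mono[of "norm x" R "norm h"] by auto
        then show "x \<in> (\<lambda>x. x \<bullet> h) -` {- (R * norm h)..R * norm h} \<inter> space \<nu>" by (simp add: sp abs_le_iff minus_le_iff)
      qed
    qed (rule measurable_sets[where A=borel], auto)
    also have "\<dots> = measure (distr \<nu> borel (\<lambda>x. x \<bullet> h)) {- (R * norm h)..R * norm h}"
      by (rule measure_distr[symmetric]) auto
    finally show "1/2 \<le> measure (normal_law (m \<bullet> h) (sqrt (h \<bullet> K h))) {- (R * norm h)..R * norm h}"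
      unfolding is_gaussian_marginal(2)[OF g, symmetric] using half by linarith
  qed
  show "norm m \<le> 5 * R"
  proof (cases "m = 0")
    case False
    then have "norm m * norm m \<le> 5 * R * norm m"
      using main[OF False] by (simp add: power2_norm_eq_inner[symmetric] power2_eq_square mult_ac)
    then show ?thesis using False by simp
  qed (use R in simp)
  show "h \<bullet> K h \<le> (2 * R * norm h)\<^sup>2"
  proof (cases "h = 0")
    case False
    have "(sqrt (h \<bullet> K h))\<^sup>2 \<le> (2 * (R * norm h))\<^sup>2"
      using main[OF False] is_gaussian_marginal(1)[OF g, of h] by (intro power_mono) auto
    then show ?thesis using is_gaussian_marginal(1)[OF g, of h] by (simp add: mult_ac)
  qed simp
qed

text \<open>Bounded entropy makes the densities uniformly integrable, so one ball serves all of
  them.\<close>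

lemma entropy_bounded_tight:
  fixes M :: "'h::{real_normed_vector,second_countable_topology} measure"
  assumes M: "prob_space M" and st: "sets M = sets borel"
  obtains R where "0 < R" "\<And>f. entropy_dens M f \<Longrightarrow> (LINT x|M. xlnx (f x)) \<le> B \<Longrightarrow>
      1/2 \<le> measure (density M (\<lambda>x. ennreal (f x))) {x. norm x \<le> R}"
proof -
  interpret prob_space M by (rule M)
  note [measurable_cong] = st
  have sp: "space M = UNIV" using sets_eq_imp_space_eq[OF st] by simp
  define B' where "B' = \<bar>B\<bar> + 1"
  have B': "0 < B'" "B + 1 \<le> B'" by (auto simp: B'_def)
  \<comment> \<open>With \<open>ln Q = 4 * B'\<close> the entropy term is at most 1/4; a set of
    measure below \<open>1 / (4 * Q)\<close> contributes at most another 1/4.\<close>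
  define Q where "Q = exp (4 * B')"
  have Q: "1 < Q" using B' by (simp add: Q_def)
  let ?A = "\<lambda>n::nat. {x. real n < norm x} :: 'h set"
  have Am[measurable]: "?A n \<in> sets M" for n
  proof -
    have "{x \<in> space M. real n < norm x} \<in> sets M" by measurable
    then show ?thesis by (simp add: sp)
  qed
  have "(\<lambda>n. measure M (?A n)) \<longlonglongrightarrow> measure M (\<Inter>n. ?A n)"
    by (rule finite_Lim_measure_decseq) (auto simp: decseq_def)
  moreover have "(\<Inter>n. ?A n) = {}"
  proof -
    have "\<exists>n. \<not> real n < norm x" for x :: 'h using reals_Archimedean2[of "norm x"] by (metis less_asym)
    then show ?thesis by auto
  qed
  ultimately have "(\<lambda>n. measure M (?A n)) \<longlonglongrightarrow> 0" by simp
  then have "\<forall>\<^sub>F n in sequentially. measure M (?A n) < 1 / (4 * Q)"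
    by (rule order_tendstoD) (use Q in simp)
  then obtain N where N: "\<And>n. n \<ge> N \<Longrightarrow> measure M (?A n) < 1 / (4 * Q)"
    unfolding eventually_sequentially by blast
  define n where "n = Suc N"
  have small: "measure M (?A n) < 1 / (4 * Q)" using N[of n] by (simp add: n_def)
  show thesis
  proof (rule that[of "real n"])
    show "0 < real n" by (simp add: n_def)
    fix f assume f: "entropy_dens M f" and le: "(LINT x|M. xlnx (f x)) \<le> B"
    note F = entropy_densD[OF f]
    note [measurable] = F(5)
    let ?D = "density M (\<lambda>x. ennreal (f x))"
    have pD: "prob_space ?D" using f by (intro prob_space_density) (auto simp: entropy_dens_def)
    interpret D: prob_space ?D by (rule pD)
    have "measure ?D (?A n) = (LINT x|?D. indicator (?A n) x)" by (simp add: sp)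
    also have "\<dots> = (LINT x|M. f x * indicator (?A n) x)"
      by (subst integral_density) (use F in auto)
    also have "\<dots> \<le> Q * measure M (?A n) + (B + 1) / ln Q"
      by (rule entropy_uniform_integrability[OF M f le Q Am])
    also have "\<dots> \<le> Q * (1 / (4 * Q)) + B' / (4 * B')"
      using small Q B' by (intro add_mono mult_left_mono divide_right_mono) (auto simp: Q_def divide_right_mono)
    also have "\<dots> = 1/2" using Q B' by simp
    finally have "measure ?D (?A n) \<le> 1/2" .
    moreover have "measure ?D (space ?D - ?A n) = 1 - measure ?D (?A n)"
      by (rule D.prob_compl) simp
    moreover have "space ?D - ?A n = {x. norm x \<le> real n}" by (auto simp: sp)
    ultimately show "1/2 \<le> measure ?D {x. norm x \<le> real n}" by simp
  qed
qed

section \<open>The variational problem\<close>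

lemma cf_density:
  fixes M :: "'h::{real_inner,second_countable_topology} measure"
  assumes "f \<in> borel_measurable M" "\<And>x. 0 \<le> f x" "sets M = sets borel"
  shows "cf (density M (\<lambda>x. ennreal (f x))) u = (CLINT x|M. f x *\<^sub>R iexp (x \<bullet> u))"
proof -
  note [measurable_cong] = assms(3)
  show ?thesis unfolding cf_def by (rule integral_density) (use assms(1,2) in auto)
qed

lemma cf_density_L1:
  fixes M :: "'h::{real_inner,second_countable_topology} measure"
  assumes M: "prob_space M" and st: "sets M = sets borel" and a: "\<And>n. entropy_dens M (a n)" and h: "entropy_dens M h"
    and lim: "(\<lambda>n. LINT x|M. \<bar>a n x - h x\<bar>) \<longlonglongrightarrow> 0"
  shows "(\<lambda>n. cf (density M (\<lambda>x. ennreal (a n x))) u) \<longlonglongrightarrow> cf (density M (\<lambda>x. ennreal (h x))) u"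
proof -
  note A = entropy_densD[OF a] and H = entropy_densD[OF h]
  note [measurable_cong] = st
  note [measurable] = A(5) H(5)
  have int: "integrable M (\<lambda>x. f x *\<^sub>R iexp (x \<bullet> u))" if "integrable M f" for f :: "_ \<Rightarrow> real"
  proof (rule Bochner_Integration.integrable_bound[OF that])
    have "f \<in> borel_measurable M" using that by simp
    then show "(\<lambda>x. f x *\<^sub>R iexp (x \<bullet> u)) \<in> borel_measurable M" by measurable
  qed auto
  have le: "norm (cf (density M (\<lambda>x. ennreal (a n x))) u - cf (density M (\<lambda>x. ennreal (h x))) u) \<le> (LINT x|M. \<bar>a n x - h x\<bar>)" for n
  proof -
    have "cf (density M (\<lambda>x. ennreal (a n x))) u - cf (density M (\<lambda>x. ennreal (h x))) u
        = (CLINT x|M. (a n x - h x) *\<^sub>R iexp (x \<bullet> u))"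
      unfolding cf_density[OF A(5) A(1) st] cf_density[OF H(5) H(1) st]
      using int[OF A(2)[of n]] int[OF H(2)] by (simp add: scaleR_diff_left)
    also have "norm \<dots> \<le> (LINT x|M. norm ((a n x - h x) *\<^sub>R iexp (x \<bullet> u)))" by (rule integral_norm_bound)
    also have "\<dots> = (LINT x|M. \<bar>a n x - h x\<bar>)" by simp
    finally show ?thesis .
  qed
  have "(\<lambda>n. cf (density M (\<lambda>x. ennreal (a n x))) u - cf (density M (\<lambda>x. ennreal (h x))) u) \<longlonglongrightarrow> 0"
    by (rule Lim_null_comparison[OF _ lim]) (simp add: le)
  then show ?thesis by (simp add: LIM_zero_iff)
qed

text \<open>The weight is positive on \<open>range j\<close>, which has full measure; hence the
  normalising constant is positive.\<close>

lemma target_measure_prob: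
  fixes \<mu>0 :: "'h::topological_space measure"
  assumes pr: "prob_space \<mu>0" and st: "sets \<mu>0 = sets borel" and X: "range j \<in> sets borel" "measure \<mu>0 (range j) = 1"
    and int: "integrable \<mu>0 (exp_weight j \<Phi>)"
  shows "prob_space (target_measure \<mu>0 j \<Phi>)" "sets (target_measure \<mu>0 j \<Phi>) = sets borel"
    "absolutely_continuous \<mu>0 (target_measure \<mu>0 j \<Phi>)"
proof -
  interpret prob_space \<mu>0 by (rule pr)
  have w0: "0 \<le> exp_weight j \<Phi> y" for y by (simp add: exp_weight_def)
  define Z where "Z = partition_const \<mu>0 j \<Phi>"
  have Z: "Z = (LINT y|\<mu>0. exp_weight j \<Phi> y)" by (simp add: Z_def partition_const_def)
  have "Z \<noteq> 0"
  proof
    assume "Z = 0"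
    then have "AE y in \<mu>0. exp_weight j \<Phi> y = 0"
      using integral_nonneg_eq_0_iff_AE[OF int] w0 Z by simp
    moreover have "AE y in \<mu>0. y \<in> range j"
      using X by (subst AE_in_set_eq_1) (simp_all add: st)
    ultimately have "AE y in \<mu>0. False" by eventually_elim (simp add: exp_weight_def)
    then show False using AE_False prob_space by simp
  qed
  moreover have "0 \<le> Z" unfolding Z using w0 by simp
  ultimately have Zp: "0 < Z" by simp
  have "has_bochner_integral \<mu>0 (\<lambda>y. exp_weight j \<Phi> y / Z) 1"
    using int Zp Z by (simp add: has_bochner_integral_iff)
  then show "prob_space (target_measure \<mu>0 j \<Phi>)"
    unfolding target_measure_def Z_def[symmetric] using w0 Zp by (intro prob_space_density) auto
  show "sets (target_measure \<mu>0 j \<Phi>) = sets borel" by (simp add: target_measure_def st)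
  show "absolutely_continuous \<mu>0 (target_measure \<mu>0 j \<Phi>)"
    unfolding target_measure_def using int by (intro absolutely_continuousI_density) auto
qed

text \<open>\<open>s\<close> stands for \<open>1 - \<kappa>\<close>; the assumptions on
  \<open>\<mu>\<close> are those that \<open>target_measure_prob\<close> provides.\<close>

locale variational_problem = covariance_spectrum C e l
  for C :: "'h::{real_inner,complete_space,second_countable_topology} \<Rightarrow>\<^sub>L 'h" and e l +
  fixes m0 :: 'h and \<mu>0 \<mu> :: "'h measure" and \<iota> :: "'g::{real_inner,complete_space} \<Rightarrow> 'h \<Rightarrow> 'h \<Rightarrow> real"
    and s \<delta> :: real
  assumes \<mu>0: "is_gaussian \<mu>0 m0 C" and \<mu>: "prob_space \<mu>" "sets \<mu> = sets borel" "absolutely_continuous \<mu>0 \<mu>"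
    and \<iota>: "operator_space C \<iota>" and sym: "\<And>g. symmetric_op C (\<iota> g)"
    and s: "0 \<le> s" "s \<le> 1" and emb: "compactly_embedded C s \<iota>" and \<delta>: "0 < \<delta>"
    and fin: "kl_div \<mu>0 \<mu> < \<infinity>"
begin

abbreviation F :: "'h \<Rightarrow> 'g \<Rightarrow> ereal" where "F \<equiv> objective C \<iota> \<mu> \<delta>"

abbreviation S :: "'g \<Rightarrow> 'h \<Rightarrow>\<^sub>L 'h" where "S g \<equiv> pert (\<iota> g)"

lemma HS: "\<iota> g \<in> HS_ops C"
  using \<iota> by (simp add: operator_space_def)

lemma op_scale: "u \<in> Hs C 1 \<Longrightarrow> v \<in> Hs C 1 \<Longrightarrow> \<iota> (a *\<^sub>R g) v u = a * \<iota> g v u"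
  and op_add: "u \<in> Hs C 1 \<Longrightarrow> v \<in> Hs C 1 \<Longrightarrow> \<iota> (g + g') v u = \<iota> g v u + \<iota> g' v u"
  using \<iota> by (simp_all add: operator_space_def)

lemma inner_S: "z \<bullet> S g x = \<iota> g (half x) (half z)"
  by (rule pert_HS(2)[OF HS])

text \<open>A nonzero \<open>u\<close> gives a nondegenerate marginal of \<open>\<mu>0\<close>,
  which has no atoms; absolute continuity carries this to \<open>\<mu>\<close>.\<close>

lemma measure_singleton_0:
  assumes "u \<noteq> (0::'h)" shows "emeasure \<mu> {0} = 0"
proof -
  note * = is_gaussian_marginal[OF \<mu>0, of u]
  have pr: "prob_space \<mu>0" and st: "sets \<mu>0 = sets borel" using \<mu>0 by (auto simp: is_gaussian_def gaussian_measure_def)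
  have [measurable]: "(\<lambda>x. x \<bullet> u) \<in> borel_measurable \<mu>0" using st by (simp cong: measurable_cong_sets)
  have sp: "space \<mu>0 = UNIV" using sets_eq_imp_space_eq[OF st] by simp
  have "0 < sqrt (u \<bullet> C u)" using cov assms by (simp add: covariance_operator_def strictly_positive_def)
  then have "emeasure (normal_law (m0 \<bullet> u) (sqrt (u \<bullet> C u))) {0} = 0"
    by (simp add: normal_law_def emeasure_density nn_integral_null_set)
  then have "emeasure \<mu>0 ((\<lambda>x. x \<bullet> u) -` {0} \<inter> space \<mu>0) = 0"
    unfolding *(2)[symmetric] by (subst (asm) emeasure_distr) auto
  moreover have "emeasure \<mu>0 {0} \<le> emeasure \<mu>0 ((\<lambda>x. x \<bullet> u) -` {0} \<inter> space \<mu>0)"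
    using measurable_sets[of "\<lambda>x. x \<bullet> u" \<mu>0 borel "{0}"] by (intro emeasure_mono) (auto simp: sp)
  ultimately have "{0} \<in> null_sets \<mu>0" by (simp add: null_sets_def st)
  then show ?thesis using \<mu>(3) by (auto simp: absolutely_continuous_def null_sets_def)
qed

text \<open>Otherwise the measure is by convention the Dirac measure at 0, whose divergence is
  infinite. The failure of positivity itself supplies the nonzero vector for
  \<open>measure_singleton_0\<close>.\<close>

lemma finite_imp_strictly_positive:
  assumes "F m g < \<infinity>" shows "strictly_positive (id_blinfun + S g)"
proof (rule ccontr)
  assume "\<not> strictly_positive (id_blinfun + S g)"
  then have nsp: "\<not> graph_strictly_positive (precision_op C (\<iota> g))"
    using graph_strictly_positive_iff[OF HS sym] by simp
  then obtain u :: 'h where u: "u \<noteq> 0" unfolding graph_strictly_positive_def by blast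
  have "kl_div (return borel 0) \<mu> < \<infinity>"
    using assms nsp by (simp add: objective_def gaussian_P0_def)
  then have "absolutely_continuous \<mu> (return borel (0::'h))" by (auto simp: kl_div_def split: if_splits)
  moreover have "{0} \<in> null_sets \<mu>" using measure_singleton_0[OF u] \<mu>(2) by (simp add: null_sets_def)
  ultimately have "{0} \<in> null_sets (return borel (0::'h))" by (auto simp: absolutely_continuous_def)
  then show False by (simp add: null_sets_def)
qed

lemma gaussian_P0_prob: "prob_space (gaussian_P0 C m (\<iota> g))" "sets (gaussian_P0 C m (\<iota> g)) = sets borel"
proof -
  have "prob_space (gaussian_P0 C m (\<iota> g)) \<and> sets (gaussian_P0 C m (\<iota> g)) = sets borel"
  proof (cases "graph_strictly_positive (precision_op C (\<iota> g))")
    case True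
    then have sp: "strictly_positive (id_blinfun + S g)" using graph_strictly_positive_iff[OF HS sym] by simp
    obtain R :: "'h \<Rightarrow>\<^sub>L 'h" where R: "self_adjoint R" "\<And>x. R x + S g (R x) = x" "\<And>x. R (x + S g x) = x"
      "strictly_positive (id_blinfun + S g) \<Longrightarrow> \<exists>Q. self_adjoint Q \<and> (\<forall>x. Q (Q x) = R x)"
      by (rule compact_perturbation_inverse[OF pert_self_adjoint[OF HS sym] pert_HS(1)[OF HS] strictly_positive_inj[OF sp]], assumption) (rule that)
    show ?thesis using gaussian_P0_is_gaussian(1)[OF \<mu>0 HS sym sp R(2,3)]
      by (auto simp: is_gaussian_def gaussian_measure_def)
  next
    case False
    then show ?thesis by (simp add: gaussian_P0_def prob_space_return)
  qed
  then show "prob_space (gaussian_P0 C m (\<iota> g))" "sets (gaussian_P0 C m (\<iota> g)) = sets borel" by auto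
qed

lemma finite_imp_density:
  assumes "F m g < \<infinity>"
  obtains f where "entropy_dens \<mu> f" "gaussian_P0 C m (\<iota> g) = density \<mu> (\<lambda>x. ennreal (f x))"
    "F m g = ereal ((LINT x|\<mu>. xlnx (f x)) + \<delta> * (norm g)\<^sup>2)"
proof -
  have kf: "kl_div (gaussian_P0 C m (\<iota> g)) \<mu> < \<infinity>" using assms by (auto simp: objective_def)
  obtain f where f: "entropy_dens \<mu> f" "gaussian_P0 C m (\<iota> g) = density \<mu> (\<lambda>x. ennreal (f x))"
      "kl_div (gaussian_P0 C m (\<iota> g)) \<mu> = ereal (LINT x|\<mu>. xlnx (f x))"
  proof (rule kl_div_finite_imp_density[OF \<mu>(1) gaussian_P0_prob(1) _ kf])
    show "sets (gaussian_P0 C m (\<iota> g)) = sets \<mu>" by (simp add: gaussian_P0_prob \<mu>(2))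
  qed (rule that)
  then show thesis by (intro that[of f]) (simp_all add: objective_def)
qed

lemma F_ge: "ereal (- 1) \<le> F m g"
proof (cases "F m g < \<infinity>")
  case True
  then obtain f where f: "entropy_dens \<mu> f" "F m g = ereal ((LINT x|\<mu>. xlnx (f x)) + \<delta> * (norm g)\<^sup>2)"
    by (rule finite_imp_density)
  have "0 \<le> \<delta> * (norm g)\<^sup>2" using \<delta> by simp
  then show ?thesis using entropy_ge_minus_one[OF \<mu>(1) f(1)] unfolding f(2) ereal_less_eq(3) by linarith
qed simp

text \<open>The zero operator has S = 0 and covariance \<open>C\<close>, so \<open>\<mu>0\<close> is
  admissible and the infimum is not infinite.\<close>

lemma F_m0: "F m0 0 < \<infinity>"
proof -
  have z: "\<iota> 0 v u = 0" if "u \<in> Hs C 1" "v \<in> Hs C 1" for u v using op_scale[OF that, of 0 0] by simp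
  have "S 0 x = 0" for x
  proof -
    have "S 0 x \<bullet> S 0 x = 0" unfolding inner_S by (rule z) (simp_all add: half_in_Hs_1)
    then show ?thesis by simp
  qed
  then have S0: "x + S 0 x = x" for x by simp
  have sp: "strictly_positive (id_blinfun + S 0)" by (simp add: strictly_positive_def blinfun_id_plus S0)
  have "op_powr C (1/2) o\<^sub>L id_blinfun o\<^sub>L op_powr C (1/2) = C"
    by (rule blinfun_eqI) (simp add: half_half)
  moreover have "is_gaussian (gaussian_P0 C m0 (\<iota> 0)) m0 (op_powr C (1/2) o\<^sub>L id_blinfun o\<^sub>L op_powr C (1/2))"
    by (rule gaussian_P0_is_gaussian(1)[OF \<mu>0 HS sym sp]) (simp_all add: S0)
  ultimately have "gaussian_P0 C m0 (\<iota> 0) = \<mu>0" using gaussian_eqI \<mu>0 by metis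
  then show ?thesis using fin by (simp add: objective_def)
qed

lemma in_Hs_s: "half x \<in> Hs C s"
  by (rule half_in_Hs(1)[OF s])

text \<open>Since \<open>half\<close> maps H boundedly into H^s, convergence in
  \<open>bounded_ops_norm\<close> becomes convergence of the operators S in operator norm. At this
  stage \<open>L\<close> is a bounded operator on the scale, not known to come from the space of the
  g.\<close>

lemma compact_embedding:
  fixes g :: "nat \<Rightarrow> 'g"
  assumes "bounded (range g)"
  obtains r L b where "strict_mono (r :: nat \<Rightarrow> nat)" "b \<longlonglongrightarrow> (0::real)"
    "\<And>n x z. \<bar>\<iota> (g (r n)) (half x) (half z) - L (half x) (half z)\<bar> \<le> b n * norm x * norm z"
proof -
  obtain J where J: "\<And>g. J g \<in> bounded_ops C s" "\<And>g u v. u \<in> Hs C 1 \<Longrightarrow> v \<in> Hs C 1 \<Longrightarrow> J g v u = \<iota> g v u"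
    and sub: "\<And>g :: nat \<Rightarrow> 'g. bounded (range g) \<Longrightarrow>
             (\<exists>r L. strict_mono r \<and> L \<in> bounded_ops C s \<and>
                (\<lambda>n. bounded_ops_norm C s (\<lambda>v u. J (g (r n)) v u - L v u)) \<longlonglongrightarrow> 0)"
    using emb unfolding compactly_embedded_def by blast
  obtain r L where r: "strict_mono r" "L \<in> bounded_ops C s"
    "(\<lambda>n. bounded_ops_norm C s (\<lambda>v u. J (g (r n)) v u - L v u)) \<longlonglongrightarrow> 0"
    using sub[OF assms] by blast
  define B where "B n = bounded_ops_norm C s (\<lambda>v u. J (g (r n)) v u - L v u)" for n
  define c where "c = norm (op_powr C ((1 - s) / 2))"
  have "\<bar>\<iota> (g (r n)) (half x) (half z) - L (half x) (half z)\<bar> \<le> (\<bar>B n\<bar> * c * c) * norm x * norm z" for n x z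
  proof -
    have nn: "0 \<le> Hs_norm C s (half x)" "0 \<le> Hs_norm C s (half z)" by (rule Hs_norm_nonneg[OF s(1) in_Hs_s])+
    have "\<bar>\<iota> (g (r n)) (half x) (half z) - L (half x) (half z)\<bar> = \<bar>J (g (r n)) (half x) (half z) - L (half x) (half z)\<bar>"
      using J(2) half_in_Hs_1 by simp
    also have "\<dots> \<le> B n * Hs_norm C s (half x) * Hs_norm C s (half z)"
      unfolding B_def by (rule bounded_ops_diff_bound[OF s(1) J(1) r(2) in_Hs_s in_Hs_s])
    also have "\<dots> \<le> \<bar>B n\<bar> * Hs_norm C s (half x) * Hs_norm C s (half z)"
      using nn by (intro mult_right_mono) auto
    also have "\<dots> \<le> \<bar>B n\<bar> * (c * norm x) * (c * norm z)"
      unfolding c_def using nn half_in_Hs(2)[OF s] by (intro mult_mono mult_nonneg_nonneg) auto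
    finally show ?thesis by (simp add: mult_ac)
  qed
  moreover have "(\<lambda>n. \<bar>B n\<bar> * c * c) \<longlonglongrightarrow> 0"
    using tendsto_mult_right[OF tendsto_mult_right[OF tendsto_rabs_zero[OF r(3)], of c], of c] by (simp add: B_def)
  ultimately show thesis using r(1) that[of r "\<lambda>n. \<bar>B n\<bar> * c * c" L] by blast
qed

text \<open>Continuity of the pairing in \<open>g\<close> is extracted from compactness: normalised
  elements violating every bound would have a subsequence with convergent, hence bounded,
  values.\<close>

lemma op_pointwise_bounded:
  obtains K where "\<And>g. \<bar>\<iota> g (half x) (half z)\<bar> \<le> K * norm g"
proof (rule ccontr)
  assume "\<not> thesis"
  then have "\<forall>n. \<exists>g. \<not> \<bar>\<iota> g (half x) (half z)\<bar> \<le> real n * norm g" using that by metis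
  then obtain g where g: "\<And>n. real n * norm (g n) < \<bar>\<iota> (g n) (half x) (half z)\<bar>" by (metis not_le)
  have z: "\<iota> 0 (half x) (half z) = 0" using op_scale[OF half_in_Hs_1 half_in_Hs_1, of 0 0] by simp
  have g0: "g n \<noteq> 0" for n using g[of n] z by auto
  define y where "y n = (1 / norm (g n)) *\<^sub>R g n" for n
  have y: "real n < \<bar>\<iota> (y n) (half x) (half z)\<bar>" for n
    using g[of n] g0[of n] by (simp add: y_def op_scale half_in_Hs_1 abs_mult field_simps)
  have "bounded (range y)" by (rule boundedI[where B=1]) (auto simp: y_def g0)
  then obtain r L b where r: "strict_mono (r :: nat \<Rightarrow> nat)" and b: "b \<longlonglongrightarrow> (0::real)"
    and le: "\<And>n x z. \<bar>\<iota> (y (r n)) (half x) (half z) - L (half x) (half z)\<bar> \<le> b n * norm x * norm z"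
    by (rule compact_embedding) (rule that)
  have "(\<lambda>n. b n * norm x * norm z) \<longlonglongrightarrow> 0 * norm x * norm z" by (intro tendsto_intros b)
  then have "(\<lambda>n. b n * norm x * norm z) \<longlonglongrightarrow> 0" by simp
  then have "(\<lambda>n. \<iota> (y (r n)) (half x) (half z) - L (half x) (half z)) \<longlonglongrightarrow> 0"
    by (rule Lim_null_comparison[rotated]) (simp add: le)
  then have "Bseq (\<lambda>n. \<iota> (y (r n)) (half x) (half z))"
    by (intro convergent_imp_Bseq convergentI[of _ "L (half x) (half z)"]) (simp add: LIM_zero_iff)
  then obtain B where B: "\<And>n. \<bar>\<iota> (y (r n)) (half x) (half z)\<bar> \<le> B" unfolding Bseq_def real_norm_def by blast
  obtain n where "B < real n" using reals_Archimedean2 by blast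
  moreover have "real n \<le> real (r n)" using seq_suble[OF r, of n] by simp
  ultimately show False using B[of n] y[of "r n"] by linarith
qed

lemma op_pointwise_tendsto:
  assumes "c \<longlonglongrightarrow> gs"
  shows "(\<lambda>n. \<iota> (c n) (half x) (half z)) \<longlonglongrightarrow> \<iota> gs (half x) (half z)"
proof -
  obtain K where K: "\<And>g. \<bar>\<iota> g (half x) (half z)\<bar> \<le> K * norm g" using op_pointwise_bounded[of x z] by blast
  have "\<iota> (c n) (half x) (half z) = \<iota> (c n - gs) (half x) (half z) + \<iota> gs (half x) (half z)" for n
    using op_add[OF half_in_Hs_1 half_in_Hs_1, of "c n - gs" gs] by simp
  then have eq: "\<iota> (c n) (half x) (half z) - \<iota> gs (half x) (half z) = \<iota> (c n - gs) (half x) (half z)" for n by simp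
  have "(\<lambda>n. K * norm (c n - gs)) \<longlonglongrightarrow> K * 0" by (intro tendsto_intros tendsto_norm_zero LIM_zero assms)
  then have "(\<lambda>n. K * norm (c n - gs)) \<longlonglongrightarrow> 0" by simp
  then have "(\<lambda>n. \<iota> (c n) (half x) (half z) - \<iota> gs (half x) (half z)) \<longlonglongrightarrow> 0"
    by (rule Lim_null_comparison[rotated]) (simp add: eq K)
  then show ?thesis by (simp add: LIM_zero_iff)
qed

end

section \<open>Convergence of minimising sequences\<close>

context variational_problem
begin

text \<open>Finiteness along the sequence provides a density and strict positivity for every member;
  \<open>inf\<close> turns the upper bound at the limit into optimality.\<close>

lemma minimising_subsequence:
  fixes m :: "nat \<Rightarrow> 'h" and g :: "nat \<Rightarrow> 'g"
  assumes lim: "(\<lambda>n. F (m n) (g n)) \<longlonglongrightarrow> ereal I" and fin_seq: "\<And>n. F (m n) (g n) < \<infinity>"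
    and inf: "\<And>m g. ereal I \<le> F m g"
  obtains r ms gs where "strict_mono (r :: nat \<Rightarrow> nat)" "F ms gs = ereal I" "(\<lambda>n. g (r n)) \<longlonglongrightarrow> gs"
    "(\<lambda>n. tv_dist (gaussian_P0 C (m (r n)) (\<iota> (g (r n)))) (gaussian_P0 C ms (\<iota> gs))) \<longlonglongrightarrow> 0"
proof -
  interpret M: prob_space \<mu> by (rule \<mu>(1))
  have "\<forall>n. \<exists>f. entropy_dens \<mu> f \<and> gaussian_P0 C (m n) (\<iota> (g n)) = density \<mu> (\<lambda>x. ennreal (f x)) \<and>
    F (m n) (g n) = ereal ((LINT x|\<mu>. xlnx (f x)) + \<delta> * (norm (g n))\<^sup>2)"
    using finite_imp_density[OF fin_seq] by metis
  then obtain f where f: "\<And>n. entropy_dens \<mu> (f n)"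
    and fd: "\<And>n. gaussian_P0 C (m n) (\<iota> (g n)) = density \<mu> (\<lambda>x. ennreal (f n x))"
    and fF: "\<And>n. F (m n) (g n) = ereal ((LINT x|\<mu>. xlnx (f n x)) + \<delta> * (norm (g n))\<^sup>2)"
    by metis
  have rlim: "(\<lambda>n. (LINT x|\<mu>. xlnx (f n x)) + \<delta> * (norm (g n))\<^sup>2) \<longlonglongrightarrow> I"
    using lim unfolding fF by simp
  then have "Bseq (\<lambda>n. (LINT x|\<mu>. xlnx (f n x)) + \<delta> * (norm (g n))\<^sup>2)"
    by (intro convergent_imp_Bseq convergentI)
  then obtain B where B: "\<And>n. \<bar>(LINT x|\<mu>. xlnx (f n x)) + \<delta> * (norm (g n))\<^sup>2\<bar> \<le> B"
    unfolding Bseq_def real_norm_def by blast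
  \<comment> \<open>The entropy is at least -1, so the bound on the sum splits into one for each
    term.\<close>
  have gB: "(norm (g n))\<^sup>2 \<le> (B + 1) / \<delta>" and fB: "(LINT x|\<mu>. xlnx (f n x)) \<le> B" for n
  proof -
    have 1: "- 1 \<le> (LINT x|\<mu>. xlnx (f n x))" by (rule entropy_ge_minus_one[OF \<mu>(1) f])
    have 2: "(LINT x|\<mu>. xlnx (f n x)) + \<delta> * (norm (g n))\<^sup>2 \<le> B" using B[of n] by simp
    have 3: "0 \<le> \<delta> * (norm (g n))\<^sup>2" using \<delta> by simp
    show "(LINT x|\<mu>. xlnx (f n x)) \<le> B" using 2 3 by linarith
    have "\<delta> * (norm (g n))\<^sup>2 \<le> B + 1" using 1 2 by linarith
    then show "(norm (g n))\<^sup>2 \<le> (B + 1) / \<delta>" using \<delta> by (simp add: pos_le_divide_eq mult.commute)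
  qed
  have "bounded (range g)"
  proof (rule boundedI[where B="sqrt ((B + 1) / \<delta>)"])
    fix y assume "y \<in> range g"
    then obtain n where n: "y = g n" by blast
    show "norm y \<le> sqrt ((B + 1) / \<delta>)" unfolding n by (rule real_le_rsqrt[OF gB])
  qed
  then obtain r1 L b where r1: "strict_mono (r1 :: nat \<Rightarrow> nat)" and b: "b \<longlonglongrightarrow> (0::real)"
    and bL: "\<And>n x z. \<bar>\<iota> (g (r1 n)) (half x) (half z) - L (half x) (half z)\<bar> \<le> b n * norm x * norm z"
    by (rule compact_embedding) (rule that)
  have sp: "strictly_positive (id_blinfun + S (g n))" for n by (rule finite_imp_strictly_positive[OF fin_seq])
  have "\<forall>n. \<exists>R. (\<forall>x. blinfun_apply R x + S (g n) (R x) = x) \<and> (\<forall>x. blinfun_apply R (x + S (g n) x) = x)"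
  proof
    fix n
    obtain R :: "'h \<Rightarrow>\<^sub>L 'h" where R: "self_adjoint R" "\<And>x. R x + S (g n) (R x) = x" "\<And>x. R (x + S (g n) x) = x"
      "strictly_positive (id_blinfun + S (g n)) \<Longrightarrow> \<exists>Q. self_adjoint Q \<and> (\<forall>x. Q (Q x) = R x)"
      by (rule compact_perturbation_inverse[OF pert_self_adjoint[OF HS sym] pert_HS(1)[OF HS] strictly_positive_inj[OF sp]], assumption) (rule that)
    then show "\<exists>R. (\<forall>x. blinfun_apply R x + S (g n) (R x) = x) \<and> (\<forall>x. blinfun_apply R (x + S (g n) x) = x)" by blast
  qed
  then obtain R :: "nat \<Rightarrow> 'h \<Rightarrow>\<^sub>L 'h" where R: "\<And>n x. R n x + S (g n) (R n x) = x" "\<And>n x. R n (x + S (g n) x) = x" by metis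
  define K where "K n = op_powr C (1/2) o\<^sub>L R n o\<^sub>L op_powr C (1/2)" for n
  have gauss: "is_gaussian (gaussian_P0 C (m n) (\<iota> (g n))) (m n) (K n)" for n
    unfolding K_def by (rule gaussian_P0_is_gaussian(1)[OF \<mu>0 HS sym sp R])
  have Kin: "u \<bullet> K n u = half u \<bullet> R n (half u)" for n u by (simp add: K_def half_self_adjoint)
  obtain \<rho> where \<rho>: "0 < \<rho>" "\<And>f. entropy_dens \<mu> f \<Longrightarrow> (LINT x|\<mu>. xlnx (f x)) \<le> B \<Longrightarrow>
      1/2 \<le> measure (density \<mu> (\<lambda>x. ennreal (f x))) {x. norm x \<le> \<rho>}"
    by (rule entropy_bounded_tight[OF \<mu>(1,2)]) (rule that)
  have tight: "1/2 \<le> measure (gaussian_P0 C (m n) (\<iota> (g n))) {x. norm x \<le> \<rho>}" for n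
    unfolding fd by (rule \<rho>(2)[OF f fB])
  note mb = gaussian_tight(1)[OF gauss \<rho>(1) tight] and Kb = gaussian_tight(2)[OF gauss \<rho>(1) tight]
  obtain r2 ms where r2: "strict_mono (r2 :: nat \<Rightarrow> nat)" and ms: "\<And>u. (\<lambda>n. m (r1 (r2 n)) \<bullet> u) \<longlonglongrightarrow> ms \<bullet> u"
    using weak_sequential_compactness[of "\<lambda>n. m (r1 n)" "5 * \<rho>"] mb by metis
  define r where "r n = r1 (r2 n)" for n
  have r: "strict_mono r" unfolding r_def using r1 r2 by (auto simp: strict_mono_def)
  define \<beta> where "\<beta> n = b (r2 n)" for n
  have \<beta>: "\<beta> \<longlonglongrightarrow> 0" using LIMSEQ_subseq_LIMSEQ[OF b r2] by (simp add: o_def \<beta>_def[abs_def])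
  have \<beta>L: "\<bar>\<iota> (g (r n)) (half x) (half z) - L (half x) (half z)\<bar> \<le> \<beta> n * norm x * norm z" for n x z
    using bL[of "r2 n"] by (simp add: r_def \<beta>_def)
  have limr: "(\<lambda>k. (LINT x|\<mu>. xlnx (f (r k) x)) + \<delta> * (norm (g (r k)))\<^sup>2) \<longlonglongrightarrow> I"
    using LIMSEQ_subseq_LIMSEQ[OF rlim r] by (simp add: o_def)
  obtain h gs q where h: "entropy_dens \<mu> h" and hI: "(LINT x|\<mu>. xlnx (h x)) + \<delta> * (norm gs)\<^sup>2 \<le> I"
    and q: "\<And>n. q n \<in> midpoint_hull pair_mid (\<lambda>k. (f (r k), g (r k))) n" and qe: "\<And>n. entropy_dens \<mu> (fst (q n))"
    and qh: "(\<lambda>n. LINT x|\<mu>. \<bar>fst (q n) x - h x\<bar>) \<longlonglongrightarrow> 0" and qg: "(\<lambda>n. snd (q n)) \<longlonglongrightarrow> gs"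
    and conv: "I \<le> (LINT x|\<mu>. xlnx (h x)) + \<delta> * (norm gs)\<^sup>2 \<Longrightarrow>
        (\<lambda>k. LINT x|\<mu>. \<bar>f (r k) x - h x\<bar>) \<longlonglongrightarrow> 0 \<and> (\<lambda>k. g (r k)) \<longlonglongrightarrow> gs"
    by (rule entropy_minimising_compactness[OF \<mu>(1) f \<delta> limr]) (rule that)
  have \<beta>0: "(\<lambda>n. \<beta> n * norm x * norm z) \<longlonglongrightarrow> 0" for x z :: 'h
  proof -
    have "(\<lambda>n. \<beta> n * norm x * norm z) \<longlonglongrightarrow> 0 * norm x * norm z" by (intro tendsto_intros \<beta>)
    then show ?thesis by simp
  qed
  \<comment> \<open>\<open>L\<close> is the limit of the operators along the subsequence,
    \<open>gs\<close> the limit of convex combinations of them; the pairing is affine in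
    \<open>g\<close>, so both limits agree on the range of \<open>half\<close>.\<close>
  have Lgs: "L (half x) (half z) = \<iota> gs (half x) (half z)" for x z
  proof (rule LIMSEQ_unique)
    show "(\<lambda>n. \<iota> (snd (q n)) (half x) (half z)) \<longlonglongrightarrow> L (half x) (half z)"
    proof (rule midpoint_hull_tendsto[OF q, where P="\<lambda>_. True" and T="\<lambda>p. \<iota> (snd p) (half x) (half z)"])
      show "\<iota> (snd (pair_mid p p')) (half x) (half z) = (1/2) *\<^sub>R (\<iota> (snd p) (half x) (half z) + \<iota> (snd p') (half x) (half z))" for p p' :: "('h \<Rightarrow> real) \<times> 'g"
        unfolding pair_mid_def snd_conv by (simp only: op_scale[OF half_in_Hs_1 half_in_Hs_1] op_add[OF half_in_Hs_1 half_in_Hs_1] real_scaleR_def)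
      have "(\<lambda>k. \<iota> (g (r k)) (half x) (half z) - L (half x) (half z)) \<longlonglongrightarrow> 0"
        by (rule Lim_null_comparison[OF _ \<beta>0[of x z]]) (simp add: \<beta>L)
      then show "(\<lambda>k. \<iota> (snd (f (r k), g (r k))) (half x) (half z)) \<longlonglongrightarrow> L (half x) (half z)"
        by (simp add: LIM_zero_iff)
    qed simp_all
    show "(\<lambda>n. \<iota> (snd (q n)) (half x) (half z)) \<longlonglongrightarrow> \<iota> gs (half x) (half z)"
      by (rule op_pointwise_tendsto[OF qg])
  qed
  define D where "D n = S (g (r n)) - S gs" for n
  have Dn: "norm (D n x) \<le> \<beta> n * norm x" for n x
  proof (cases "D n x = 0")
    case True
    have "0 \<le> \<beta> n * norm x"
    proof (cases "x = 0")
      case False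
      have "0 \<le> \<beta> n * norm x * norm x" using \<beta>L[of n x x] by (meson abs_ge_zero order_trans)
      then show ?thesis using False by (simp add: zero_le_mult_iff)
    qed simp
    then show ?thesis using True by simp
  next
    case False
    \<comment> \<open>Test with \<open>D n x\<close> itself and divide by its norm.\<close>
    have "D n x \<bullet> D n x = \<iota> (g (r n)) (half x) (half (D n x)) - L (half x) (half (D n x))"
      unfolding Lgs inner_S[symmetric] by (simp add: D_def blinfun.diff_left inner_diff_right)
    also have "\<dots> \<le> \<beta> n * norm x * norm (D n x)" using \<beta>L[of n x "D n x"] by linarith
    finally have "norm (D n x) * norm (D n x) \<le> (\<beta> n * norm x) * norm (D n x)"
      by (simp add: power2_norm_eq_inner[symmetric] power2_eq_square)
    then show ?thesis using False by simp
  qed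
  have Dlim: "(\<lambda>n. D n x) \<longlonglongrightarrow> 0" for x
  proof (rule Lim_null_comparison)
    show "\<forall>\<^sub>F n in sequentially. norm (D n x) \<le> \<beta> n * norm x" by (simp add: Dn)
    show "(\<lambda>n. \<beta> n * norm x) \<longlonglongrightarrow> 0" using tendsto_mult_right[OF \<beta>, of "norm x"] by simp
  qed
  have Slim: "(\<lambda>n. S (g (r n)) x) \<longlonglongrightarrow> S gs x" for x
    using Dlim[of x] by (simp add: D_def blinfun.diff_left LIM_zero_iff)
  have sps: "strictly_positive (id_blinfun + S gs)"
    unfolding strictly_positive_def blinfun_id_plus
  proof (intro allI impI)
    fix x :: 'h assume x: "x \<noteq> 0"
    let ?a = "\<lambda>n. x \<bullet> (x + S (g (r n)) x)"
    have a: "?a \<longlonglongrightarrow> x \<bullet> (x + S gs x)" by (intro tendsto_intros Slim)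
    \<comment> \<open>Cauchy-Schwarz for the form of \<open>?P\<close>, applied to \<open>?y\<close>
      and \<open>x\<close>. The factor \<open>?y \<bullet> ?P ?y\<close> is the variance in
      direction \<open>u\<close>, which tightness bounds independently of \<open>n\<close>.\<close>
    have le: "(half u \<bullet> x)\<^sup>2 \<le> (2 * \<rho> * norm u)\<^sup>2 * ?a n" for u n
    proof -
      let ?P = "id_blinfun + S (g (r n))" and ?y = "R (r n) (half u)"
      have sa: "self_adjoint ?P"
        using pert_self_adjoint[OF HS sym, of "g (r n)"] by (simp add: self_adjoint_def blinfun_id_plus inner_add_left inner_add_right)
      have Py: "?P ?y = half u" by (simp add: blinfun_id_plus R(1))
      have "half u \<bullet> x = ?y \<bullet> ?P x" using sa Py by (metis self_adjoint_def)
      then have "(half u \<bullet> x)\<^sup>2 = (?y \<bullet> ?P x)\<^sup>2" by simp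
      also have "\<dots> \<le> (?y \<bullet> ?P ?y) * (x \<bullet> ?P x)" by (rule form_cauchy_schwarz[OF sa sp])
      also have "?y \<bullet> ?P ?y = u \<bullet> K (r n) u" unfolding Py Kin by (rule inner_commute)
      also have "(u \<bullet> K (r n) u) * (x \<bullet> ?P x) \<le> (2 * \<rho> * norm u)\<^sup>2 * (x \<bullet> ?P x)"
        using Kb[of u "r n"] sp[of "r n"] x by (intro mult_right_mono) (auto simp: strictly_positive_def less_imp_le)
      finally show ?thesis by (simp add: blinfun_id_plus)
    qed
    have le': "(half u \<bullet> x)\<^sup>2 \<le> (2 * \<rho> * norm u)\<^sup>2 * (x \<bullet> (x + S gs x))" for u
      by (rule LIMSEQ_le_const[OF tendsto_mult_left[OF a]]) (use le in blast)
    obtain u where "half u \<bullet> x \<noteq> 0" using half_orthogonal_imp_0 x by blast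
    then have "0 < (2 * \<rho> * norm u)\<^sup>2 * (x \<bullet> (x + S gs x))" using le'[of u] by (meson less_le_trans zero_less_power2)
    then show "0 < x \<bullet> (x + S gs x)" using zero_less_mult_pos2 zero_le_power2 by (metis less_le mult_zero_left zero_less_mult_pos)
  qed
  obtain T :: "'h \<Rightarrow>\<^sub>L 'h" where T0: "self_adjoint T" "\<And>x. T x + S gs (T x) = x" "\<And>x. T (x + S gs x) = x"
      "strictly_positive (id_blinfun + S gs) \<Longrightarrow> \<exists>Q. self_adjoint Q \<and> (\<forall>x. Q (Q x) = T x)"
    by (rule compact_perturbation_inverse[OF pert_self_adjoint[OF HS sym] pert_HS(1)[OF HS] strictly_positive_inj[OF sps]], assumption) (rule that)
  note T = T0(2,3)
  define Ks where "Ks = op_powr C (1/2) o\<^sub>L T o\<^sub>L op_powr C (1/2)"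
  note gs_gauss = gaussian_P0_is_gaussian[OF \<mu>0 HS sym sps T, folded Ks_def]
  have Ksin: "u \<bullet> Ks v = half u \<bullet> T (half v)" for u v by (simp add: Ks_def half_self_adjoint)
  have Rlim: "(\<lambda>n. R (r n) w) \<longlonglongrightarrow> T w" for w
  proof -
    \<comment> \<open>Resolvent identity: \<open>T\<close> and \<open>R (r n)\<close> invert
      operators that differ by \<open>D n\<close>.\<close>
    have eq: "R (r n) w = T w - T (D n (R (r n) w))" for n
    proof -
      let ?y = "R (r n) w"
      have "?y + S gs ?y = w - D n ?y" using R(1)[of "r n" w] by (simp add: D_def blinfun.diff_left algebra_simps)
      then have "T (?y + S gs ?y) = T w - T (D n ?y)" by (simp add: blinfun.diff_right)
      then show ?thesis unfolding T(2) .
    qed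
    have nb: "norm (T (D n y)) \<le> norm T * \<beta> n * norm y" for n y
    proof -
      have "norm (T (D n y)) \<le> norm T * norm (D n y)" by (rule norm_blinfun)
      also have "\<dots> \<le> norm T * (\<beta> n * norm y)" by (intro mult_left_mono Dn) simp
      finally show ?thesis by (simp add: mult.assoc)
    qed
    have t0: "(\<lambda>n. norm T * \<beta> n) \<longlonglongrightarrow> 0" using tendsto_mult_left[OF \<beta>, of "norm T"] by simp
    \<comment> \<open>Once the factor is below 1/2, the resolvent identity absorbs half of
      \<open>norm (R (r n) w)\<close>. This bound comes before the convergence because no uniform
      bound on the inverses is known yet.\<close>
    then have ev: "\<forall>\<^sub>F n in sequentially. norm T * \<beta> n < 1/2" by (rule order_tendstoD) simp
    have bd: "\<forall>\<^sub>F n in sequentially. norm (R (r n) w) \<le> 2 * norm (T w)"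
      using ev
    proof eventually_elim
      fix n assume e: "norm T * \<beta> n < 1/2"
      have "norm (R (r n) w) \<le> norm (T w) + norm (T (D n (R (r n) w)))"
        using norm_triangle_ineq4[of "T w" "T (D n (R (r n) w))"] eq[of n] by simp
      also have "\<dots> \<le> norm (T w) + norm T * \<beta> n * norm (R (r n) w)" using nb by simp
      also have "\<dots> \<le> norm (T w) + (1/2) * norm (R (r n) w)"
        using e by (intro add_left_mono mult_right_mono) auto
      finally show "norm (R (r n) w) \<le> 2 * norm (T w)" by simp
    qed
    have "(\<lambda>n. R (r n) w - T w) \<longlonglongrightarrow> 0"
    proof (rule Lim_null_comparison)
      show "(\<lambda>n. \<bar>norm T * \<beta> n\<bar> * (2 * norm (T w))) \<longlonglongrightarrow> 0"
        using tendsto_mult_right[OF tendsto_rabs_zero[OF t0], of "2 * norm (T w)"] by simp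
      show "\<forall>\<^sub>F n in sequentially. norm (R (r n) w - T w) \<le> \<bar>norm T * \<beta> n\<bar> * (2 * norm (T w))"
        using bd
      proof eventually_elim
        fix n assume e: "norm (R (r n) w) \<le> 2 * norm (T w)"
        have "norm (R (r n) w - T w) = norm (T (D n (R (r n) w)))" by (subst eq) simp
        also have "\<dots> \<le> norm T * \<beta> n * norm (R (r n) w)" by (rule nb)
        also have "\<dots> \<le> \<bar>norm T * \<beta> n\<bar> * norm (R (r n) w)" by (intro mult_right_mono) auto
        also have "\<dots> \<le> \<bar>norm T * \<beta> n\<bar> * (2 * norm (T w))" by (intro mult_left_mono e) simp
        finally show "norm (R (r n) w - T w) \<le> \<bar>norm T * \<beta> n\<bar> * (2 * norm (T w))" .
      qed
    qed
    then show ?thesis by (simp add: LIM_zero_iff)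
  qed
  have Klim: "(\<lambda>n. u \<bullet> K (r n) u) \<longlonglongrightarrow> u \<bullet> Ks u" for u
    unfolding Kin Ksin by (intro tendsto_intros Rlim)
  have cflim: "(\<lambda>n. cf (density \<mu> (\<lambda>x. ennreal (f (r n) x))) u) \<longlonglongrightarrow> iexp (ms \<bullet> u) * exp (- (u \<bullet> Ks u) / 2)" for u
  proof -
    have c: "cf (density \<mu> (\<lambda>x. ennreal (f (r n) x))) u = iexp (m (r n) \<bullet> u) * exp (- (u \<bullet> K (r n) u) / 2)" for n
      unfolding fd[symmetric] by (rule is_gaussian_cf[OF gauss])
    have "(\<lambda>n. m (r n) \<bullet> u) \<longlonglongrightarrow> ms \<bullet> u" using ms[of u] by (simp add: r_def)
    moreover have "(\<lambda>n. iexp (a n) * exp (- (b n) / 2)) \<longlonglongrightarrow> iexp a' * exp (- b' / 2)"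
      if "a \<longlonglongrightarrow> a'" "b \<longlonglongrightarrow> b'" for a b :: "nat \<Rightarrow> real" and a' b'
      by (intro tendsto_intros that) auto
    ultimately show ?thesis unfolding c using Klim by blast
  qed
  have cfh: "cf (density \<mu> (\<lambda>x. ennreal (h x))) u = iexp (ms \<bullet> u) * exp (- (u \<bullet> Ks u) / 2)" for u
  proof (rule LIMSEQ_unique)
    show "(\<lambda>n. cf (density \<mu> (\<lambda>x. ennreal (fst (q n) x))) u) \<longlonglongrightarrow> cf (density \<mu> (\<lambda>x. ennreal (h x))) u"
      by (rule cf_density_L1[OF \<mu>(1,2) qe h qh])
    let ?T = "\<lambda>p::('h \<Rightarrow> real) \<times> 'g. CLINT x|\<mu>. fst p x *\<^sub>R iexp (x \<bullet> u)"
    have cfT: "cf (density \<mu> (\<lambda>x. ennreal (a x))) u = (CLINT x|\<mu>. a x *\<^sub>R iexp (x \<bullet> u))" if "entropy_dens \<mu> a" for a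
      using entropy_densD[OF that] by (intro cf_density \<mu>(2)) auto
    have int: "integrable \<mu> (\<lambda>x. a x *\<^sub>R iexp (x \<bullet> u))" if "entropy_dens \<mu> a" for a
    proof (rule Bochner_Integration.integrable_bound[OF entropy_densD(2)[OF that]])
      note [measurable] = entropy_densD(5)[OF that] and [measurable_cong] = \<mu>(2)
      show "(\<lambda>x. a x *\<^sub>R iexp (x \<bullet> u)) \<in> borel_measurable \<mu>" by measurable
    qed auto
    \<comment> \<open>The densities in the hull are mixtures; linearity of the characteristic
      function in the density carries the limit over to them.\<close>
    have "(\<lambda>n. ?T (q n)) \<longlonglongrightarrow> iexp (ms \<bullet> u) * exp (- (u \<bullet> Ks u) / 2)"
    proof (rule midpoint_hull_tendsto[OF q, where P="\<lambda>p. entropy_dens \<mu> (fst p)" and T="?T"])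
      show "entropy_dens \<mu> (fst (f (r k), g (r k)))" for k by (simp add: f)
      show "entropy_dens \<mu> (fst (pair_mid x y))" if "entropy_dens \<mu> (fst x)" "entropy_dens \<mu> (fst y)" for x y :: "('h \<Rightarrow> real) \<times> 'g"
        using entropy_dens_midpoint(1)[OF \<mu>(1) that] by (simp add: pair_mid_def)
      show "?T (pair_mid x y) = (1/2) *\<^sub>R (?T x + ?T y)" if "entropy_dens \<mu> (fst x)" "entropy_dens \<mu> (fst y)" for x y :: "('h \<Rightarrow> real) \<times> 'g"
      proof -
        have "?T (pair_mid x y) = (CLINT t|\<mu>. (1/2) *\<^sub>R (fst x t *\<^sub>R iexp (t \<bullet> u) + fst y t *\<^sub>R iexp (t \<bullet> u)))"
          by (intro Bochner_Integration.integral_cong refl) (simp add: pair_mid_def scaleR_add_left[symmetric])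
        also have "\<dots> = (1/2) *\<^sub>R (CLINT t|\<mu>. fst x t *\<^sub>R iexp (t \<bullet> u) + fst y t *\<^sub>R iexp (t \<bullet> u))"
          by (rule integral_scaleR_right)
        also have "\<dots> = (1/2) *\<^sub>R (?T x + ?T y)"
          by (simp only: Bochner_Integration.integral_add[OF int[OF that(1)] int[OF that(2)]])
        finally show ?thesis .
      qed
      show "(\<lambda>k. ?T (f (r k), g (r k))) \<longlonglongrightarrow> iexp (ms \<bullet> u) * exp (- (u \<bullet> Ks u) / 2)"
        using cflim[of u] unfolding cfT[OF f] by simp
    qed
    then show "(\<lambda>n. cf (density \<mu> (\<lambda>x. ennreal (fst (q n) x))) u) \<longlonglongrightarrow> iexp (ms \<bullet> u) * exp (- (u \<bullet> Ks u) / 2)"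
      unfolding cfT[OF qe] .
  qed
  have ph: "prob_space (density \<mu> (\<lambda>x. ennreal (h x)))"
    using h by (intro prob_space_density) (auto simp: entropy_dens_def)
  have "is_gaussian (density \<mu> (\<lambda>x. ennreal (h x))) ms Ks"
  proof (rule cf_imp_is_gaussian[OF ph _ _ _ cfh])
    show "self_adjoint Ks" using T0(1) unfolding self_adjoint_def by (metis Ksin inner_commute)
    show "0 \<le> u \<bullet> Ks u" for u unfolding Ksin by (rule gs_gauss(3))
  qed (simp add: \<mu>(2))
  then have eq: "gaussian_P0 C ms (\<iota> gs) = density \<mu> (\<lambda>x. ennreal (h x))"
    using gaussian_eqI gs_gauss(1) by metis
  have Fs: "F ms gs = ereal ((LINT x|\<mu>. xlnx (h x)) + \<delta> * (norm gs)\<^sup>2)"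
    unfolding objective_def eq kl_div_density[OF \<mu>(1) h] by simp
  \<comment> \<open>The limit density now belongs to an admissible measure, so the infimum bounds
    its value from below; this is the condition in \<open>conv\<close>.\<close>
  have Ih: "I \<le> (LINT x|\<mu>. xlnx (h x)) + \<delta> * (norm gs)\<^sup>2" using inf[of ms gs] unfolding Fs by simp
  have FI: "F ms gs = ereal I" unfolding Fs using Ih hI by simp
  note cv = conv[OF Ih]
  have "(\<lambda>n. tv_dist (gaussian_P0 C (m (r n)) (\<iota> (g (r n)))) (gaussian_P0 C ms (\<iota> gs))) \<longlonglongrightarrow> 0"
    unfolding fd eq
  proof (rule tendsto_sandwich[OF _ _ tendsto_const conjunct1[OF cv]])
    show "\<forall>\<^sub>F n in sequentially. 0 \<le> tv_dist (density \<mu> (\<lambda>x. ennreal (f (r n) x))) (density \<mu> (\<lambda>x. ennreal (h x)))"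
      using tv_dist_density_le(1)[OF \<mu>(1) f h] by simp
    show "\<forall>\<^sub>F n in sequentially. tv_dist (density \<mu> (\<lambda>x. ennreal (f (r n) x))) (density \<mu> (\<lambda>x. ennreal (h x))) \<le> (LINT x|\<mu>. \<bar>f (r n) x - h x\<bar>)"
      using tv_dist_density_le(2)[OF \<mu>(1) f h] by simp
  qed
  then show thesis using that[OF r FI conjunct2[OF cv]] by blast
qed

theorem minimising_sequence_compact:
  shows "(\<exists>ms gs. is_minimiser F ms gs)"
    and "minimising_sequence F m g \<Longrightarrow> \<exists>r ms gs. strict_mono r \<and> is_minimiser F ms gs \<and> (\<lambda>n. g (r n)) \<longlonglongrightarrow> gs \<and>
      (\<lambda>n. tv_dist (gaussian_P0 C (m (r n)) (\<iota> (g (r n)))) (gaussian_P0 C ms (\<iota> gs))) \<longlonglongrightarrow> 0"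
proof -
  define Ie where "Ie = (INF (m', g')\<in>UNIV. F m' g')"
  have Ile: "Ie \<le> F m' g'" for m' g' unfolding Ie_def by (rule INF_lower2[of "(m', g')"]) auto
  have "Ie < \<infinity>" using Ile[of m0 0] F_m0 by (rule order_le_less_trans)
  moreover have "ereal (- 1) \<le> Ie" unfolding Ie_def by (rule INF_greatest) (auto intro: F_ge)
  ultimately obtain I where I: "Ie = ereal I" by (cases Ie) auto
  have inf: "ereal I \<le> F m' g'" for m' g' using Ile I by simp
  have main: "\<exists>r ms gs. strict_mono r \<and> is_minimiser F ms gs \<and> (\<lambda>n. g (r n)) \<longlonglongrightarrow> gs \<and>
      (\<lambda>n. tv_dist (gaussian_P0 C (m (r n)) (\<iota> (g (r n)))) (gaussian_P0 C ms (\<iota> gs))) \<longlonglongrightarrow> 0"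
    if ms: "minimising_sequence F m g" for m :: "nat \<Rightarrow> 'h" and g :: "nat \<Rightarrow> 'g"
  proof -
    have lim: "(\<lambda>n. F (m n) (g n)) \<longlonglongrightarrow> ereal I" using ms by (simp add: minimising_sequence_def flip: Ie_def I)
    have "\<forall>\<^sub>F n in sequentially. F (m n) (g n) < \<infinity>" by (rule order_tendstoD(2)[OF lim]) simp
    then obtain N where N: "\<And>n. n \<ge> N \<Longrightarrow> F (m n) (g n) < \<infinity>" unfolding eventually_sequentially by blast
    \<comment> \<open>A minimising sequence may begin with infinite values; dropping them shifts the
      final subsequence by \<open>N\<close>.\<close>
    have lim': "(\<lambda>n. F (m (n + N)) (g (n + N))) \<longlonglongrightarrow> ereal I" by (rule LIMSEQ_ignore_initial_segment[OF lim])
    obtain r ms gs where r: "strict_mono (r :: nat \<Rightarrow> nat)" "F ms gs = ereal I" "(\<lambda>n. g (r n + N)) \<longlonglongrightarrow> gs"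
      "(\<lambda>n. tv_dist (gaussian_P0 C (m (r n + N)) (\<iota> (g (r n + N)))) (gaussian_P0 C ms (\<iota> gs))) \<longlonglongrightarrow> 0"
      by (rule minimising_subsequence[OF lim' N inf]) (simp, rule that)
    have "strict_mono (\<lambda>n. r n + N)" using r(1) by (auto simp: strict_mono_def)
    moreover have "is_minimiser F ms gs" using r(2) inf by (simp add: is_minimiser_def)
    ultimately show ?thesis using r(3,4) by blast
  qed
  show "minimising_sequence F m g \<Longrightarrow> \<exists>r ms gs. strict_mono r \<and> is_minimiser F ms gs \<and> (\<lambda>n. g (r n)) \<longlonglongrightarrow> gs \<and>
      (\<lambda>n. tv_dist (gaussian_P0 C (m (r n)) (\<iota> (g (r n)))) (gaussian_P0 C ms (\<iota> gs))) \<longlonglongrightarrow> 0"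
    by (rule main)
  \<comment> \<open>Existence of a minimiser is the compactness result for some minimising sequence,
    which is built here from the infimum.\<close>
  have "\<exists>p. F (fst p) (snd p) < ereal (I + 1 / real (Suc n))" for n
  proof -
    have "Ie < ereal (I + 1 / real (Suc n))" unfolding I by simp
    then have "\<exists>p. (case p of (m', g') \<Rightarrow> F m' g') < ereal (I + 1 / real (Suc n))" unfolding Ie_def by (auto simp: INF_less_iff)
    then show ?thesis by (auto simp: case_prod_beta)
  qed
  then obtain p where p: "\<And>n. F (fst (p n)) (snd (p n)) < ereal (I + 1 / real (Suc n))" by metis
  have "(\<lambda>n. F (fst (p n)) (snd (p n))) \<longlonglongrightarrow> ereal I"
  proof (rule tendsto_sandwich[OF _ _ tendsto_const])
    have "(\<lambda>n. I + 1 / real (Suc n)) \<longlonglongrightarrow> I + 0"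
      by (intro tendsto_add tendsto_const) (use LIMSEQ_inverse_real_of_nat in \<open>simp add: divide_inverse\<close>)
    then show "(\<lambda>n. ereal (I + 1 / real (Suc n))) \<longlonglongrightarrow> ereal I" by simp
  qed (use inf less_imp_le[OF p] in auto)
  then have "minimising_sequence F (\<lambda>n. fst (p n)) (\<lambda>n. snd (p n))"
    by (simp add: minimising_sequence_def flip: Ie_def I)
  from main[OF this] show "\<exists>ms gs. is_minimiser F ms gs" by blast
qed

end

section \<open>The result for the target measure with weight exp(-Phi)\<close>

theorem theorem3p10:
  fixes C0 :: "'h::{real_inner, complete_space, second_countable_topology} \<Rightarrow>\<^sub>L 'h"
    and m0 :: 'h
    and \<mu>0 \<mu> :: "'h measure"
    and j :: "'x::{banach, second_countable_topology} \<Rightarrow>\<^sub>L 'h"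
    and \<Phi> :: "'x \<Rightarrow> real"
    and \<iota> :: "'g::{real_inner, complete_space} \<Rightarrow> 'h \<Rightarrow> 'h \<Rightarrow> real"
    and \<kappa> \<delta> :: real
  assumes "covariance_operator C0"
    and "is_gaussian \<mu>0 m0 C0"
    and "inj (blinfun_apply j)"
    and "range (blinfun_apply j) \<in> sets borel"
    and "measure \<mu>0 (range (blinfun_apply j)) = 1"
    and "continuous_on UNIV \<Phi>"
    and "integrable \<mu>0 (exp_weight (blinfun_apply j) \<Phi>)"
    and "\<mu> = target_measure \<mu>0 (blinfun_apply j) \<Phi>"
    and "operator_space C0 \<iota>"
    and "\<And>g. symmetric_op C0 (\<iota> g)"
    and "0 < \<kappa>" "\<kappa> < 1"
    and "compactly_embedded C0 (1 - \<kappa>) \<iota>"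
    and "0 < \<delta>"
    and "kl_div \<mu>0 \<mu> < \<infinity>"
  shows "(\<exists>m_star g_star. is_minimiser (objective C0 \<iota> \<mu> \<delta>) m_star g_star) \<and>
    (\<forall>m g. minimising_sequence (objective C0 \<iota> \<mu> \<delta>) m g \<longrightarrow>
       (\<exists>r m_star g_star. strict_mono r \<and>
          is_minimiser (objective C0 \<iota> \<mu> \<delta>) m_star g_star \<and>
          (\<lambda>n. g (r n)) \<longlonglongrightarrow> g_star \<and>
          (\<lambda>n. tv_dist (gaussian_P0 C0 (m (r n)) (\<iota> (g (r n))))
                        (gaussian_P0 C0 m_star (\<iota> g_star))) \<longlonglongrightarrow> 0))"
proof -
  obtain e l where spec: "covariance_spectrum C0 e l" by (rule covariance_spectrum_exists[OF assms(1)])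
  have "prob_space \<mu>0" "sets \<mu>0 = sets borel" using assms(2) by (auto simp: is_gaussian_def gaussian_measure_def)
  note target = target_measure_prob[OF this assms(4,5,7), folded assms(8)]
  have "variational_problem C0 e l m0 \<mu>0 \<mu> \<iota> (1 - \<kappa>) \<delta>"
    unfolding variational_problem_def variational_problem_axioms_def using spec assms target by simp
  then interpret variational_problem C0 e l m0 \<mu>0 \<mu> \<iota> "1 - \<kappa>" \<delta> .
  show ?thesis using minimising_sequence_compact by blast
qed

end
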